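(* Every origin-symmetric convex body $K$ in $\mathbb{R}^4$ is an intersection body.
   Context: An origin-symmetric star body $K\subset\mathbb{R}^n$ (compact, star-shaped about the origin, $K=-K$, with radial function $\rho_K(x)=\max\{a>0:ax\in K\}$ continuous and positive on $S^{n-1}$) is an intersection body if there is a finite non-negative Borel measure $\mu$ on $S^{n-1}$ such that $\rho_K$ equals the spherical Radon transform of $\mu$, i.e. $\int_{S^{n-1}}\rho_K(\theta)f(\theta)\,d\theta=\int_{S^{n-1}}Rf(\xi)\,d\mu(\xi)$ for all $f\in C(S^{n-1})$, where $Rf(\xi)=\int_{S^{n-1}\cap\xi^\perp}f(x)\,dx$. A convex body is a compact convex set with nonempty interior. *)

theory Defs
  imports "HOL-Analysis.Analysis"
begin

definition radial_fun :: "'a::real_vector set \<Rightarrow> 'a \<Rightarrow> real" where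
  "radial_fun K x = Sup {a. a > 0 \<and> a *\<^sub>R x \<in> K}"

definition convex_body :: "'a::euclidean_space set \<Rightarrow> bool" where
  "convex_body K \<longleftrightarrow> compact K \<and> convex K \<and> interior K \<noteq> {}"

definition origin_symmetric :: "'a::real_vector set \<Rightarrow> bool" where
  "origin_symmetric K \<longleftrightarrow> uminus ` K = K"

definition star_body :: "'a::euclidean_space set \<Rightarrow> bool" where
  "star_body K \<longleftrightarrow> compact K \<and> 0 \<in> K \<and> (\<forall>x\<in>K. closed_segment 0 x \<subseteq> K)
     \<and> continuous_on (sphere 0 1) (radial_fun K)
     \<and> (\<forall>\<theta>\<in>sphere 0 1. radial_fun K \<theta> > 0)"

text \<open>Surface (spherical Lebesgue) measure on the unit sphere S^{n-1} of an n-dimensional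
  Euclidean space, as a Borel measure on the ambient space concentrated on the sphere:
  sigma(A) = n * vol({t x. x \<in> A, 0 < t < 1}), i.e. the push-forward of n times Lebesgue
  measure on the punctured unit ball under radial projection.\<close>
definition sphere_measure :: "'a::euclidean_space measure" where
  "sphere_measure = distr
     (density lborel (\<lambda>x. ennreal (real DIM('a)) * indicator (ball 0 1 - {0}) x))
     borel (\<lambda>x. x /\<^sub>R norm x)"

text \<open>Spherical Radon transform on S^3 in R^4: integral of f over the great 2-sphere
  S^3 \<inter> xi^\<bottom>, computed by transporting the surface measure of S^2 \<subseteq> R^3 through a
  linear isometry of R^3 onto the hyperplane xi^\<bottom>.\<close>
definition spherical_radon :: "(real^4 \<Rightarrow> real) \<Rightarrow> real^4 \<Rightarrow> real" where
  "spherical_radon f \<xi> =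
     (let L = (SOME L :: real^3 \<Rightarrow> real^4. linear L \<and> (\<forall>y. norm (L y) = norm y)
                 \<and> range L = {x. x \<bullet> \<xi> = 0})
      in (\<integral>y. f (L y) \<partial>(sphere_measure :: (real^3) measure)))"

text \<open>Intersection body in R^4: an origin-symmetric star body whose radial function is the
  spherical Radon transform of a finite non-negative Borel measure mu on S^3.\<close>
definition intersection_body :: "(real^4) set \<Rightarrow> bool" where
  "intersection_body K \<longleftrightarrow> star_body K \<and> origin_symmetric K \<and>
     (\<exists>\<mu> :: (real^4) measure. sets \<mu> = sets borel \<and> finite_measure \<mu>
        \<and> emeasure \<mu> (- sphere 0 1) = 0
        \<and> (\<forall>f :: real^4 \<Rightarrow> real. continuous_on UNIV f \<longrightarrow>
             (\<integral>\<theta>\<in>sphere 0 1. radial_fun K \<theta> * f \<theta> \<partial>sphere_measure)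
             = (\<integral>\<xi>\<in>sphere 0 1. spherical_radon f \<xi> \<partial>\<mu>)))"

end

theory Submission
  imports Defs "HOL-Probability.Probability"
begin

text \<open>Identify \<open>\<real>\<^sup>4\<close> with the quaternions, so that the great sphere \<open>\<xi>\<^sup>\<bottom>\<close> is the set of all \<open>\<eta> \<xi>\<close> with \<open>\<eta>\<close> an
  imaginary unit quaternion, and let \<open>V\<^sub>d(\<xi>)\<close> be the volume of the slab \<open>{x \<in> K. \<bar>x \<bullet> \<xi>\<bar> \<le> d}\<close>.  The
  Brunn--Minkowski inequality gives \<open>V\<^sub>3\<^sub>d \<le> 3 V\<^sub>d\<close>, so \<open>D\<^sub>d = 3 V\<^sub>d - V\<^sub>3\<^sub>d\<close> is nonnegative; up to scaling
  it is a finite difference version of minus the second derivative at \<open>0\<close> of the parallel section function.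
  The substitution \<open>\<xi> = \<eta>\<^sup>-\<^sup>1 \<zeta> \<theta>\<close> and polar coordinates turn the integral of \<open>D\<^sub>d\<close> against the Radon transform of \<open>f\<close>
  into an integral over \<open>\<theta> \<in> S\<^sup>3\<close> and over quaternions \<open>q\<close> with \<open>\<parallel>q\<parallel> \<theta> \<in> K\<close> of \<open>f((q / \<parallel>q\<parallel>) \<theta>)\<close> against a
  kernel \<open>\<beta>(Im q / d)\<close>.  By Archimedes' hat-box theorem on \<open>S\<^sup>2\<close> the kernel \<open>\<beta>\<close> is nonnegative with compact
  support, so that as \<open>d \<rightarrow> 0\<close> only real \<open>q\<close> contribute and, after division by \<open>d\<^sup>3\<close>, the limit is a multiple of
  \<open>\<integral> \<rho>\<^sub>K f\<close>.  Any weak limit of the measures with density proportional to \<open>D\<^sub>d / d\<^sup>3\<close> therefore represents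
  \<open>\<rho>\<^sub>K\<close>; it exists by Helly's selection theorem on the line, transported by a space-filling curve.\<close>

section \<open>The Brunn--Minkowski inequality\<close>

text \<open>For smooth K with parallel section function A one has V_d = 2 d A(0) + d^3 A''(0) / 3 +
  o(d^3), so that in 3 V_d - V_3d the terms linear in d cancel and -8 d^3 A''(0) remains. A general
  K has no such second derivative; slabs of positive width avoid both smoothness and an
  approximation of K by smooth bodies. The factor 3 comes from the midpoint argument: the slab of
  half-width 3 d splits into a central slab and two flanks of the same width, and midpoints between
  opposite flanks fall into the central slab. Dimension four enters twice: imaginary unit
  quaternions parametrize all great 2-spheres of S^3 at once, and on S^2 the coordinate in a fixed
  direction is uniformly distributed, so that the same combination with factor 3 vanishes when Im q
  has norm at least 3 d. The admissible imaginary parts then fill a region of R^3 of volume of order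
  d^3, which is the order of D_d. The densities D_d / d^3 have no evident uniform bound; their total
  masses are controlled by testing with f = 1, whose Radon transform is constant.\<close>

lemma emeasure_lborel_halve:
  fixes S :: "real set"
  assumes [measurable]: "S \<in> sets borel"
  shows "emeasure lborel {x. (x + b) / 2 \<in> S} = 2 * emeasure lborel S"
proof -
  have "emeasure lborel S = (\<integral>\<^sup>+x. indicator S x \<partial>lborel)" by simp
  also have "\<dots> = ennreal (1/2) * (\<integral>\<^sup>+x. indicator S (b/2 + (1/2) * x) \<partial>lborel)"
    by (subst nn_integral_real_affine[where c="1/2" and t="b/2"]) auto
  also have "(\<integral>\<^sup>+x. indicator S (b/2 + (1/2) * x) \<partial>lborel) = (\<integral>\<^sup>+x. indicator {x. (x + b) / 2 \<in> S} x \<partial>lborel)"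
    by (intro nn_integral_cong) (auto simp: indicator_def field_simps)
  also have "\<dots> = emeasure lborel {x. (x + b) / 2 \<in> S}" by simp
  finally have "2 * emeasure lborel S = (ennreal 2 * ennreal (1/2)) * emeasure lborel {x. (x + b) / 2 \<in> S}"
    by (simp add: mult.assoc)
  also have "ennreal 2 * ennreal (1/2) = 1" by (subst ennreal_mult[symmetric]) auto
  finally show ?thesis by simp
qed

text \<open>Let a be the maximum of \<open>A\<close> and b the minimum of \<open>B\<close>. The
  midpoints of \<open>A\<close> with b lie at or below m = (a + b) / 2, those of a with
  \<open>B\<close> at or above it, so \<open>S\<close> contains half-size copies of \<open>A\<close>
  and \<open>B\<close> that overlap in at most one point.\<close>

lemma brunn_minkowski_real_compact:
  fixes A B S :: "real set"
  assumes A: "compact A" "A \<noteq> {}" and B: "compact B" "B \<noteq> {}" and S[measurable]: "S \<in> sets borel"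
    and mid: "\<And>x y. x \<in> A \<Longrightarrow> y \<in> B \<Longrightarrow> (x + y) / 2 \<in> S"
  shows "emeasure lborel A + emeasure lborel B \<le> 2 * emeasure lborel S"
proof -
  obtain a where a: "a \<in> A" "\<And>x. x \<in> A \<Longrightarrow> x \<le> a" using compact_attains_sup[OF A] by auto
  obtain b where b: "b \<in> B" "\<And>x. x \<in> B \<Longrightarrow> b \<le> x" using compact_attains_inf[OF B] by auto
  define m where "m = (a + b) / 2"
  have "emeasure lborel A \<le> emeasure lborel {x. (x + b) / 2 \<in> S \<inter> {..m}}"
    using a b mid by (intro emeasure_mono) (auto simp: m_def)
  also have "\<dots> = 2 * emeasure lborel (S \<inter> {..m})" by (rule emeasure_lborel_halve) simp
  finally have 1: "emeasure lborel A \<le> 2 * emeasure lborel (S \<inter> {..m})" .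
  \<comment> \<open>The midpoint of a and b is m itself, which the open half-line omits; adding the
    null set {b} repairs the inclusion.\<close>
  have "emeasure lborel B \<le> emeasure lborel ({y. (y + a) / 2 \<in> S \<inter> {m<..}} \<union> {b})"
  proof (rule emeasure_mono)
    show "B \<subseteq> {y. (y + a) / 2 \<in> S \<inter> {m<..}} \<union> {b}"
    proof
      fix y assume y: "y \<in> B"
      then show "y \<in> {y. (y + a) / 2 \<in> S \<inter> {m<..}} \<union> {b}"
        using b(2)[OF y] mid[OF a(1) y] by (auto simp: m_def add.commute)
    qed
  qed simp
  also have "\<dots> \<le> emeasure lborel {y. (y + a) / 2 \<in> S \<inter> {m<..}} + emeasure lborel {b}"
    by (rule emeasure_subadditive) auto
  also have "\<dots> = 2 * emeasure lborel (S \<inter> {m<..})"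
    by (subst emeasure_lborel_halve) auto
  finally have 2: "emeasure lborel B \<le> 2 * emeasure lborel (S \<inter> {m<..})" .
  have "emeasure lborel (S \<inter> {..m}) + emeasure lborel (S \<inter> {m<..}) = emeasure lborel S"
    by (subst plus_emeasure) (auto intro!: arg_cong[where f="emeasure lborel"])
  then have "2 * emeasure lborel (S \<inter> {..m}) + 2 * emeasure lborel (S \<inter> {m<..}) = 2 * emeasure lborel S"
    by (simp flip: distrib_left)
  with add_mono[OF 1 2] show ?thesis by simp
qed

text \<open>The prescribed point a is adjoined to the inner approximation, so that the set stays
  nonempty when intersected with balls around a, as the compact case of the Brunn--Minkowski
  inequality requires.\<close>

lemma closed_inner_approx:
  fixes A :: "'a::euclidean_space set"
  assumes A[measurable]: "A \<in> sets borel" and "a \<in> A" and e: "e > 0"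
  obtains T where "closed T" "T \<subseteq> A" "a \<in> T" "emeasure lborel A \<le> emeasure lborel T + ennreal e"
proof -
  have "A \<in> sets lebesgue" using A by auto
  from sets_lebesgue_inner_closed[OF this e] obtain T where
    T: "closed T" "T \<subseteq> A" "A - T \<in> lmeasurable" "emeasure lebesgue (A - T) < ennreal e" by metis
  have [measurable]: "T \<in> sets borel" using T by auto
  have "emeasure lborel A = emeasure lborel T + emeasure lborel (A - T)"
    using T by (subst plus_emeasure) (auto intro!: arg_cong[where f="emeasure lborel"])
  also have "emeasure lborel (A - T) = emeasure lebesgue (A - T)"
    by simp
  also have "emeasure lborel T + emeasure lebesgue (A - T) \<le> emeasure lborel (T \<union> {a}) + ennreal e"
    using T by (intro add_mono emeasure_mono) auto
  finally show ?thesis using T \<open>a \<in> A\<close> by (intro that[of "T \<union> {a}"]) auto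
qed

text \<open>Inner approximation reduces Borel sets to closed ones, and exhaustion by balls around
  the retained points reduces these to compact ones. Both passages take place in the extended
  nonnegative reals, so sets of infinite measure are covered.\<close>

lemma brunn_minkowski_real:
  fixes A B S :: "real set"
  assumes [measurable]: "A \<in> sets borel" "B \<in> sets borel" "S \<in> sets borel"
    and ne: "A \<noteq> {}" "B \<noteq> {}"
    and mid: "\<And>x y. x \<in> A \<Longrightarrow> y \<in> B \<Longrightarrow> (x + y) / 2 \<in> S"
  shows "emeasure lborel A + emeasure lborel B \<le> 2 * emeasure lborel S"
proof (rule ennreal_le_epsilon)
  fix e :: real assume "e > 0"
  then have e: "e / 2 > 0" by simp
  from ne obtain a b where ab: "a \<in> A" "b \<in> B" by auto
  obtain T where T: "closed T" "T \<subseteq> A" "a \<in> T" "emeasure lborel A \<le> emeasure lborel T + ennreal (e/2)"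
    using closed_inner_approx[OF _ ab(1) e] by auto
  obtain U where U: "closed U" "U \<subseteq> B" "b \<in> U" "emeasure lborel B \<le> emeasure lborel U + ennreal (e/2)"
    using closed_inner_approx[OF _ ab(2) e] by auto
  have lim: "(\<lambda>n. emeasure lborel (V \<inter> cball c (real n))) \<longlonglongrightarrow> emeasure lborel V"
    if "closed V" for V :: "real set" and c
  proof -
    have "(\<lambda>n. emeasure lborel (V \<inter> cball c (real n))) \<longlonglongrightarrow> emeasure lborel (\<Union>n. V \<inter> cball c (real n))"
      using that by (intro Lim_emeasure_incseq) (auto simp: incseq_def)
    also have "(\<Union>n. V \<inter> cball c (real n)) = V"
      using real_arch_simple by (auto)
    finally show ?thesis .
  qed
  have "emeasure lborel T + emeasure lborel U \<le> 2 * emeasure lborel S"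
  proof (rule LIMSEQ_le_const2)
    show "(\<lambda>n. emeasure lborel (T \<inter> cball a (real n)) + emeasure lborel (U \<inter> cball b (real n)))
      \<longlonglongrightarrow> emeasure lborel T + emeasure lborel U"
      by (intro tendsto_add lim T U)
    show "\<exists>N. \<forall>n\<ge>N. emeasure lborel (T \<inter> cball a (real n)) + emeasure lborel (U \<inter> cball b (real n)) \<le> 2 * emeasure lborel S"
    proof (intro exI allI impI brunn_minkowski_real_compact)
      fix n
      show "T \<inter> cball a (real n) \<noteq> {}" "U \<inter> cball b (real n) \<noteq> {}"
        using T(3) U(3) by (metis IntI centre_in_cball empty_iff of_nat_0_le_iff)+
    qed (use T U mid in \<open>auto intro: closed_Int_compact\<close>)
  qed
  then have "emeasure lborel A + emeasure lborel B \<le> 2 * emeasure lborel S + (ennreal (e/2) + ennreal (e/2))"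
    using add_mono[OF T(4) U(4)]
    by (smt (verit, best) add.assoc add.left_commute add_right_mono order_trans)
  also have "ennreal (e/2) + ennreal (e/2) = ennreal e" using e by (subst ennreal_plus[symmetric]) auto
  finally show "emeasure lborel A + emeasure lborel B \<le> 2 * emeasure lborel S + ennreal e" .
qed

section \<open>From sets to functions: the Prekopa--Leindler inequality on the line\<close>

lemma nn_integral_layer_cake:
  assumes "sigma_finite_measure M" and f[measurable]: "f \<in> borel_measurable M" and le: "\<And>x. f x \<le> (1::ennreal)"
  shows "(\<integral>\<^sup>+x. f x \<partial>M) = (\<integral>\<^sup>+l\<in>{0<..<1}. emeasure M {x\<in>space M. ennreal l < f x} \<partial>lborel)"
proof -
  interpret M: sigma_finite_measure M by fact
  interpret P: pair_sigma_finite M "lborel :: real measure" ..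
  have "f x = (\<integral>\<^sup>+l. indicator {l. 0 < l \<and> l < 1 \<and> ennreal l < f x} l \<partial>lborel)" for x
  proof -
    obtain r where r: "f x = ennreal r" "0 \<le> r" "r \<le> 1" using le[of x] by (cases "f x") (auto simp: top_unique)
    have "{l. 0 < l \<and> l < 1 \<and> ennreal l < f x} = {0<..<r}" using r by (auto simp: ennreal_less_iff)
    then show ?thesis using r by simp
  qed
  then have "(\<integral>\<^sup>+x. f x \<partial>M) = (\<integral>\<^sup>+x. \<integral>\<^sup>+l. indicator {l. 0 < l \<and> l < 1 \<and> ennreal l < f x} l \<partial>lborel \<partial>M)" by simp
  also have "\<dots> = (\<integral>\<^sup>+l. \<integral>\<^sup>+x. indicator {l. 0 < l \<and> l < 1 \<and> ennreal l < f x} l \<partial>M \<partial>lborel)"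
    by (rule P.Fubini'[symmetric]) simp
  also have "\<dots> = (\<integral>\<^sup>+l\<in>{0<..<1}. emeasure M {x\<in>space M. ennreal l < f x} \<partial>lborel)"
  proof (rule nn_integral_cong)
    fix l :: real
    have "(\<integral>\<^sup>+x. indicator {l. 0 < l \<and> l < 1 \<and> ennreal l < f x} l \<partial>M) = (\<integral>\<^sup>+x. indicator {0<..<1} l * indicator {x\<in>space M. ennreal l < f x} x \<partial>M)"
      by (intro nn_integral_cong) (auto simp: indicator_def)
    then show "(\<integral>\<^sup>+x. indicator {l. 0 < l \<and> l < 1 \<and> ennreal l < f x} l \<partial>M) = emeasure M {x\<in>space M. ennreal l < f x} * indicator {0<..<1} l"
      by (simp add: nn_integral_cmult mult.commute)
  qed
  finally show ?thesis .
qed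

text \<open>Superlevel sets are compared level by level: for l < 1 both {f > l} and {g > l} are
  nonempty because the suprema are 1, and their midpoints lie in {h > l}. The one-dimensional
  Brunn--Minkowski inequality is then integrated over l. If the suprema differed, one of the level
  sets could be empty.\<close>

lemma prekopa_leindler_real_normalized:
  fixes f g h :: "real \<Rightarrow> ennreal"
  assumes [measurable]: "f \<in> borel_measurable borel" "g \<in> borel_measurable borel" "h \<in> borel_measurable borel"
    and f: "(SUP x. f x) = 1" and g: "(SUP x. g x) = 1"
    and mid: "\<And>x y. min (f x) (g y) \<le> h ((x + y) / 2)"
  shows "(\<integral>\<^sup>+x. f x \<partial>lborel) + (\<integral>\<^sup>+x. g x \<partial>lborel) \<le> 2 * (\<integral>\<^sup>+x. h x \<partial>lborel)"
proof -
  \<comment> \<open>The layer-cake formula over (0,1) asks for functions bounded by 1; capping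
    \<open>h\<close> does not change its superlevel sets at levels below 1.\<close>
  define h' where "h' x = min (h x) 1" for x
  have [measurable]: "h' \<in> borel_measurable borel" unfolding h'_def by measurable
  have f1: "f x \<le> 1" for x using SUP_upper[of x UNIV f] f by simp
  have g1: "g x \<le> 1" for x using SUP_upper[of x UNIV g] g by simp
  let ?L = "\<lambda>u l. emeasure lborel {x. ennreal l < u x}"
  have lc: "(\<integral>\<^sup>+x. u x \<partial>lborel) = (\<integral>\<^sup>+l\<in>{0<..<1}. ?L u l \<partial>lborel)"
    if "u \<in> borel_measurable borel" "\<And>x. u x \<le> 1" for u
    using nn_integral_layer_cake[of lborel u] that by (simp add: lborel.sigma_finite_measure_axioms)
  have meas[measurable]: "(\<lambda>l. ?L u l) \<in> borel_measurable borel"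
    if [measurable]: "u \<in> borel_measurable borel" for u :: "real \<Rightarrow> ennreal"
  proof -
    have "(\<lambda>l. emeasure lborel (Pair l -` {(l, x). ennreal l < u x})) \<in> borel_measurable (borel :: real measure)"
    proof (rule lborel.measurable_emeasure_Pair)
      have "{p \<in> space (borel \<Otimes>\<^sub>M borel). ennreal (fst p) < u (snd p)} \<in> sets ((borel :: real measure) \<Otimes>\<^sub>M borel)"
        by measurable
      then show "{(l, x). ennreal l < u x} \<in> sets (borel \<Otimes>\<^sub>M lborel)"
        by (simp add: space_pair_measure case_prod_unfold)
    qed
    then show ?thesis by (simp add: vimage_def)
  qed
  have "(\<integral>\<^sup>+x. f x \<partial>lborel) + (\<integral>\<^sup>+x. g x \<partial>lborel) =
    (\<integral>\<^sup>+l. ?L f l * indicator {0<..<1} l + ?L g l * indicator {0<..<1} l \<partial>lborel)"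
    unfolding lc[of f, OF _ f1, simplified] lc[of g, OF _ g1, simplified] by (rule nn_integral_add[symmetric]) measurable
  also have "\<dots> \<le> (\<integral>\<^sup>+l. 2 * (?L h' l * indicator {0<..<1} l) \<partial>lborel)"
  proof (rule nn_integral_mono)
    fix l :: real
    show "?L f l * indicator {0<..<1} l + ?L g l * indicator {0<..<1} l \<le> 2 * (?L h' l * indicator {0<..<1} l)"
    proof (cases "0 < l \<and> l < 1")
      case True
      then have l: "ennreal l < 1" by (simp add: ennreal_less_one_iff)
      have "?L f l + ?L g l \<le> 2 * ?L h' l"
      proof (rule brunn_minkowski_real)
        show "{x. ennreal l < f x} \<noteq> {}" using l f by (metis (mono_tags, lifting) empty_iff less_SUP_iff mem_Collect_eq)
        show "{x. ennreal l < g x} \<noteq> {}" using l g by (metis (mono_tags, lifting) empty_iff less_SUP_iff mem_Collect_eq)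
        fix x y assume "x \<in> {x. ennreal l < f x}" "y \<in> {x. ennreal l < g x}"
        then have "ennreal l < min (f x) (g y)" by auto
        also note mid
        finally show "(x + y) / 2 \<in> {x. ennreal l < h' x}" using l by (auto simp: h'_def)
      qed measurable
      with True show ?thesis by simp
    qed auto
  qed
  also have "\<dots> = 2 * (\<integral>\<^sup>+x. h' x \<partial>lborel)"
    by (subst lc[of h']) (auto simp: h'_def[of x for x] nn_integral_cmult)
  also have "\<dots> \<le> 2 * (\<integral>\<^sup>+x. h x \<partial>lborel)"
    by (intro mult_left_mono nn_integral_mono) (auto simp: h'_def)
  finally show ?thesis .
qed

lemma ennreal_power2_le_imp_le: "p\<^sup>2 \<le> q\<^sup>2 \<Longrightarrow> p \<le> q" for p q :: ennreal
proof (cases "q = top")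
  case False
  assume le: "p\<^sup>2 \<le> q\<^sup>2"
  obtain b where b: "q = ennreal b" "0 \<le> b" using False by (cases q) auto
  have "p \<noteq> top" using le b by (auto simp: ennreal_power top_unique)
  then obtain a where a: "p = ennreal a" "0 \<le> a" by (cases p) auto
  show ?thesis using le a b by (auto simp: ennreal_power intro: power2_le_imp_le)
qed simp

text \<open>A property of the type, so that it can be passed from two factors to their product and
  along isomorphisms. Squaring the right-hand sides keeps square roots out of
  \<open>ennreal\<close>.\<close>

definition prekopa_leindler :: "'a::euclidean_space itself \<Rightarrow> bool" where
  "prekopa_leindler _ \<longleftrightarrow> (\<forall>f g h :: 'a \<Rightarrow> ennreal.
     f \<in> borel_measurable borel \<longrightarrow> g \<in> borel_measurable borel \<longrightarrow> h \<in> borel_measurable borel \<longrightarrow>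
     (\<forall>x y. f x * g y \<le> (h ((1/2) *\<^sub>R (x + y)))\<^sup>2) \<longrightarrow>
     (\<integral>\<^sup>+x. f x \<partial>lborel) * (\<integral>\<^sup>+x. g x \<partial>lborel) \<le> (\<integral>\<^sup>+x. h x \<partial>lborel)\<^sup>2)"

lemma prekopa_leindlerD:
  fixes f g h :: "'a::euclidean_space \<Rightarrow> ennreal"
  assumes "prekopa_leindler TYPE('a)"
    and "f \<in> borel_measurable borel" "g \<in> borel_measurable borel" "h \<in> borel_measurable borel"
    and "\<And>x y. f x * g y \<le> (h ((1/2) *\<^sub>R (x + y)))\<^sup>2"
  shows "(\<integral>\<^sup>+x. f x \<partial>lborel) * (\<integral>\<^sup>+x. g x \<partial>lborel) \<le> (\<integral>\<^sup>+x. h x \<partial>lborel)\<^sup>2"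
  using assms unfolding prekopa_leindler_def by blast

text \<open>Dividing f and g by their suprema a and b, and h by \<open>sqrt (a * b)\<close>, gives
  the normalized situation, because a minimum is at most the geometric mean. The resulting additive
  bound becomes multiplicative by the inequality of arithmetic and geometric means.\<close>

lemma prekopa_leindler_real_bounded:
  fixes f g h :: "real \<Rightarrow> ennreal"
  assumes [measurable]: "f \<in> borel_measurable borel" "g \<in> borel_measurable borel" "h \<in> borel_measurable borel"
    and f: "(SUP x. f x) < top" and g: "(SUP x. g x) < top"
    and mid: "\<And>x y. f x * g y \<le> (h ((x + y) / 2))\<^sup>2"
  shows "(\<integral>\<^sup>+x. f x \<partial>lborel) * (\<integral>\<^sup>+x. g x \<partial>lborel) \<le> (\<integral>\<^sup>+x. h x \<partial>lborel)\<^sup>2"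
proof (cases "(SUP x. f x) = 0 \<or> (SUP x. g x) = 0 \<or> (\<integral>\<^sup>+x. h x \<partial>lborel) = top")
  case True
  then show ?thesis
  proof (elim disjE)
    assume "(SUP x. f x) = 0"
    then have "f x = 0" for x by (metis SUP_upper UNIV_I le_zero_eq)
    then show ?thesis by simp
  next
    assume "(SUP x. g x) = 0"
    then have "g x = 0" for x by (metis SUP_upper UNIV_I le_zero_eq)
    then show ?thesis by simp
  qed (simp add: power2_eq_square)
next
  case False
  obtain a where a: "(SUP x. f x) = ennreal a" "a > 0"
    using f False by (cases "SUP x. f x") (auto simp: less_le)
  obtain b where b: "(SUP x. g x) = ennreal b" "b > 0"
    using g False by (cases "SUP x. g x") (auto simp: less_le)
  define c where "c = sqrt (a * b)"
  have c: "c > 0" "c\<^sup>2 = a * b" using a b by (auto simp: c_def)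
  have *: "(\<integral>\<^sup>+x. ennreal (1/a) * f x \<partial>lborel) + (\<integral>\<^sup>+x. ennreal (1/b) * g x \<partial>lborel) \<le> 2 * (\<integral>\<^sup>+x. ennreal (1/c) * h x \<partial>lborel)"
  proof (rule prekopa_leindler_real_normalized)
    show "(SUP x. ennreal (1/a) * f x) = 1"
      using a by (subst SUP_mult_left_ennreal[symmetric]) (simp add: ennreal_mult[symmetric])
    show "(SUP x. ennreal (1/b) * g x) = 1"
      using b by (subst SUP_mult_left_ennreal[symmetric]) (simp add: ennreal_mult[symmetric])
    fix x y
    let ?p = "ennreal (1/a) * f x" and ?q = "ennreal (1/b) * g y"
    have "(min ?p ?q)\<^sup>2 \<le> ?p * ?q" unfolding power2_eq_square by (intro mult_mono) auto
    also have "\<dots> = ennreal (1/(a*b)) * (f x * g y)"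
      using a b by (simp add: ennreal_mult[symmetric] ac_simps flip: mult.assoc) 
    also have "\<dots> \<le> ennreal (1/(a*b)) * (h ((x + y) / 2))\<^sup>2" by (intro mult_left_mono mid) auto
    also have "\<dots> = (ennreal (1/c) * h ((x + y) / 2))\<^sup>2"
      using c by (simp add: power_mult_distrib ennreal_power power_divide)
    finally show "min ?p ?q \<le> ennreal (1/c) * h ((x + y) / 2)" by (rule ennreal_power2_le_imp_le)
  qed measurable
  obtain w where w: "(\<integral>\<^sup>+x. h x \<partial>lborel) = ennreal w" "w \<ge> 0"
    using False by (cases "\<integral>\<^sup>+x. h x \<partial>lborel") auto
  have fin: "ennreal (1/a) * (\<integral>\<^sup>+x. f x \<partial>lborel) + ennreal (1/b) * (\<integral>\<^sup>+x. g x \<partial>lborel) \<le> 2 * (ennreal (1/c) * ennreal w)"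
    using * w by (simp add: nn_integral_cmult)
  also have "\<dots> = ennreal (2 * w / c)"
    using w c by (simp add: ennreal_mult[symmetric] flip: ennreal_numeral)
  finally have fin: "ennreal (1/a) * (\<integral>\<^sup>+x. f x \<partial>lborel) + ennreal (1/b) * (\<integral>\<^sup>+x. g x \<partial>lborel) \<le> ennreal (2 * w / c)" .
  have "(\<integral>\<^sup>+x. f x \<partial>lborel) \<noteq> top" "(\<integral>\<^sup>+x. g x \<partial>lborel) \<noteq> top"
    using fin a b by (auto simp: ennreal_mult_top top_unique)
  then obtain u v where u: "(\<integral>\<^sup>+x. f x \<partial>lborel) = ennreal u" "u \<ge> 0" and v: "(\<integral>\<^sup>+x. g x \<partial>lborel) = ennreal v" "v \<ge> 0"
    by (cases "\<integral>\<^sup>+x. f x \<partial>lborel"; cases "\<integral>\<^sup>+x. g x \<partial>lborel") auto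
  have le: "u / a + v / b \<le> 2 * w / c"
    using fin u v a b w c by (simp add: ennreal_mult[symmetric] ennreal_plus[symmetric] del: ennreal_plus)
  have "4 * ((u/a) * (v/b)) \<le> (u/a + v/b)\<^sup>2"
    using zero_le_power2[of "u/a - v/b"] unfolding power2_sum power2_diff by linarith
  also have "\<dots> \<le> (2 * w / c)\<^sup>2" using le u v a b by (intro power_mono) auto
  also have "\<dots> = 4 * w\<^sup>2 / (a * b)" using c by (simp add: power_divide power_mult_distrib)
  finally have "u * v \<le> w\<^sup>2" using a b by (simp add: field_simps)
  then show ?thesis using u v w by (simp add: ennreal_mult[symmetric] ennreal_power)
qed

text \<open>Truncation at integer heights makes f and g bounded. The heights for f and g vary
  separately, so that the product of the two monotone limits is a supremum over pairs.\<close>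

lemma prekopa_leindler_real: "prekopa_leindler TYPE(real)"
  unfolding prekopa_leindler_def
proof (intro allI impI)
  fix f g h :: "real \<Rightarrow> ennreal"
  assume [measurable]: "f \<in> borel_measurable borel" "g \<in> borel_measurable borel" "h \<in> borel_measurable borel"
    and mid: "\<forall>x y. f x * g y \<le> (h ((1/2) *\<^sub>R (x + y)))\<^sup>2"
  let ?W = "(\<integral>\<^sup>+x. h x \<partial>lborel)\<^sup>2"
  have trunc: "(\<integral>\<^sup>+x. min (f x) (of_nat n) \<partial>lborel) * (\<integral>\<^sup>+x. min (g x) (of_nat m) \<partial>lborel) \<le> ?W" for n m
  proof (rule prekopa_leindler_real_bounded)
    show "(SUP x. min (f x) (of_nat n)) < top"
      by (rule le_less_trans[OF SUP_least[of UNIV _ "of_nat n"]]) (auto simp: of_nat_less_top)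
    show "(SUP x. min (g x) (of_nat m)) < top"
      by (rule le_less_trans[OF SUP_least[of UNIV _ "of_nat m"]]) (auto simp: of_nat_less_top)
    fix x y
    have "min (f x) (of_nat n) * min (g y) (of_nat m) \<le> f x * g y" by (intro mult_mono) auto
    also have "\<dots> \<le> (h ((x + y)/2))\<^sup>2" using mid by simp
    finally show "min (f x) (of_nat n) * min (g y) (of_nat m) \<le> (h ((x + y)/2))\<^sup>2" .
  qed measurable
  have SUP: "(\<integral>\<^sup>+x. u x \<partial>lborel) = (SUP n. \<integral>\<^sup>+x. min (u x) (of_nat n) \<partial>lborel)"
    if [measurable]: "u \<in> borel_measurable borel" for u :: "real \<Rightarrow> ennreal"
  proof -
    have "(SUP n. min (u x) (of_nat n)) = u x" for x
    proof -
      have "(SUP n. min (u x) (of_nat n)) = min (u x) (SUP n. of_nat n)"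
        by (simp add: inf_min[symmetric] inf_SUP)
      then show ?thesis by (simp add: ennreal_SUP_of_nat_eq_top)
    qed
    then have "(\<integral>\<^sup>+x. u x \<partial>lborel) = (\<integral>\<^sup>+x. (SUP n. min (u x) (of_nat n)) \<partial>lborel)" by simp
    also have "\<dots> = (SUP n. \<integral>\<^sup>+x. min (u x) (of_nat n) \<partial>lborel)"
      by (rule nn_integral_monotone_convergence_SUP) (auto simp: incseq_def le_fun_def min.coboundedI2)
    finally show ?thesis .
  qed
  show "(\<integral>\<^sup>+x. f x \<partial>lborel) * (\<integral>\<^sup>+x. g x \<partial>lborel) \<le> ?W"
    unfolding SUP[of f, simplified] SUP[of g, simplified]
    by (auto simp: SUP_mult_left_ennreal SUP_mult_right_ennreal intro!: SUP_least trunc)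
qed

section \<open>Tensorization and transfer to other coordinate spaces\<close>

lemma nn_integral_lborel_pair:
  fixes f :: "'a::euclidean_space \<times> 'b::euclidean_space \<Rightarrow> ennreal"
  assumes "f \<in> borel_measurable borel"
  shows "(\<integral>\<^sup>+p. f p \<partial>lborel) = (\<integral>\<^sup>+x. \<integral>\<^sup>+y. f (x, y) \<partial>lborel \<partial>lborel)"
proof -
  have "f \<in> borel_measurable (lborel \<Otimes>\<^sub>M lborel)" using assms by (simp add: lborel_prod)
  from lborel.nn_integral_fst[OF this] show ?thesis by (simp add: lborel_prod)
qed

text \<open>For fixed first coordinates, the inequality in the second factor says precisely that the
  marginals of f, g and h satisfy the hypothesis of the inequality in the first factor.\<close>

lemma prekopa_leindler_prod:
  assumes a: "prekopa_leindler TYPE('a::euclidean_space)" and b: "prekopa_leindler TYPE('b::euclidean_space)"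
  shows "prekopa_leindler TYPE('a \<times> 'b)"
  unfolding prekopa_leindler_def
proof (intro allI impI)
  fix f g h :: "'a \<times> 'b \<Rightarrow> ennreal"
  assume m[measurable]: "f \<in> borel_measurable borel" "g \<in> borel_measurable borel" "h \<in> borel_measurable borel"
    and mid: "\<forall>x y. f x * g y \<le> (h ((1/2) *\<^sub>R (x + y)))\<^sup>2"
  have [measurable]: "f \<in> borel_measurable (borel \<Otimes>\<^sub>M borel)" "g \<in> borel_measurable (borel \<Otimes>\<^sub>M borel)"
    "h \<in> borel_measurable (borel \<Otimes>\<^sub>M borel)" using m by (simp_all add: borel_prod)
  show "(\<integral>\<^sup>+x. f x \<partial>lborel) * (\<integral>\<^sup>+x. g x \<partial>lborel) \<le> (\<integral>\<^sup>+x. h x \<partial>lborel)\<^sup>2"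
    unfolding nn_integral_lborel_pair[OF m(1)] nn_integral_lborel_pair[OF m(2)] nn_integral_lborel_pair[OF m(3)]
  proof (rule prekopa_leindlerD[OF a])
    fix x y :: 'a
    show "(\<integral>\<^sup>+z. f (x, z) \<partial>lborel) * (\<integral>\<^sup>+z. g (y, z) \<partial>lborel)
      \<le> (\<integral>\<^sup>+z. h ((1/2) *\<^sub>R (x + y), z) \<partial>lborel)\<^sup>2"
    proof (rule prekopa_leindlerD[OF b])
      fix z w
      show "f (x, z) * g (y, w) \<le> (h ((1/2) *\<^sub>R (x + y), (1/2) *\<^sub>R (z + w)))\<^sup>2"
        using mid[rule_format, of "(x,z)" "(y,w)"] by simp
    qed measurable
  qed measurable
qed

lemma prekopa_leindler_linear_image:
  fixes T :: "'a::euclidean_space \<Rightarrow> 'b::euclidean_space"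
  assumes a: "prekopa_leindler TYPE('a)" and T: "linear T" and d: "distr lborel borel T = lborel"
  shows "prekopa_leindler TYPE('b)"
  unfolding prekopa_leindler_def
proof (intro allI impI)
  fix f g h :: "'b \<Rightarrow> ennreal"
  assume m[measurable]: "f \<in> borel_measurable borel" "g \<in> borel_measurable borel" "h \<in> borel_measurable borel"
    and mid: "\<forall>x y. f x * g y \<le> (h ((1/2) *\<^sub>R (x + y)))\<^sup>2"
  have [measurable]: "T \<in> borel \<rightarrow>\<^sub>M borel"
    using T by (intro borel_measurable_continuous_onI linear_continuous_on) (simp add: linear_conv_bounded_linear)
  have "(\<integral>\<^sup>+x. u x \<partial>lborel) = (\<integral>\<^sup>+x. u (T x) \<partial>lborel)" if [measurable]: "u \<in> borel_measurable borel" for u :: "'b \<Rightarrow> ennreal"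
    by (subst d[symmetric], subst nn_integral_distr) auto
  note eq = this[OF m(1)] this[OF m(2)] this[OF m(3)]
  show "(\<integral>\<^sup>+x. f x \<partial>lborel) * (\<integral>\<^sup>+x. g x \<partial>lborel) \<le> (\<integral>\<^sup>+x. h x \<partial>lborel)\<^sup>2"
    unfolding eq
    by (rule prekopa_leindlerD[OF a]) (use mid in \<open>simp_all add: linear_cmul[OF T] linear_add[OF T]\<close>)
qed

lemma distr_lborel_uminus: "distr lborel borel uminus = (lborel :: 'a::euclidean_space measure)"
proof -
  have "lborel = density (distr lborel borel (\<lambda>x::'a. - x)) (\<lambda>_. 1)"
    using lborel_affine[of "-1" "0::'a"] by simp
  then show ?thesis by (simp add: density_1)
qed

text \<open>The part of the slab \<open>d < x \<bullet> \<xi> \<le> 3 d\<close> inside \<open>K\<close> and its reflection have all their midpoints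
  in the central slab.\<close>
lemma emeasure_slab_le:
  fixes K :: "'a::euclidean_space set"
  assumes pl: "prekopa_leindler TYPE('a)" and K: "convex K" "K \<in> sets borel" "uminus ` K = K"
  shows "emeasure lborel (K \<inter> {x. \<bar>x \<bullet> \<xi>\<bar> \<le> 3 * d}) \<le> 3 * emeasure lborel (K \<inter> {x. \<bar>x \<bullet> \<xi>\<bar> \<le> d})"
proof -
  define T where "T = K \<inter> {x. d < x \<bullet> \<xi> \<and> x \<bullet> \<xi> \<le> 3 * d}"
  define C where "C = K \<inter> {x. \<bar>x \<bullet> \<xi>\<bar> \<le> d}"
  have [measurable]: "T \<in> sets borel" "C \<in> sets borel"
    unfolding T_def C_def using K(2) by measurable
  have um[measurable]: "{x. - x \<in> T} \<in> sets borel"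
    using measurable_sets[of uminus borel borel T] by (simp add: vimage_def)
  have Kneg: "- x \<in> K" if "x \<in> K" for x using that K(3) by blast
  have eqT: "emeasure lborel {x. - x \<in> T} = emeasure lborel T"
    by (subst (2) distr_lborel_uminus[symmetric], subst emeasure_distr) (auto simp: vimage_def)
  \<comment> \<open>For indicators the inequality reads |T| |-T| <= |C|^2, and |T| = |-T| turns this
    into |T| <= |C|.\<close>
  have "(\<integral>\<^sup>+x. indicator T x \<partial>lborel) * (\<integral>\<^sup>+x. indicator {x. - x \<in> T} x \<partial>lborel) \<le> (\<integral>\<^sup>+x. indicator C x \<partial>lborel)\<^sup>2"
  proof (rule prekopa_leindlerD[OF pl])
    fix x y
    have "(1/2) *\<^sub>R (x + y) \<in> C" if "x \<in> T" "- y \<in> T"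
    proof -
      have "y \<in> K" using that(2) Kneg[of "- y"] by (auto simp: T_def)
      then have "(1/2) *\<^sub>R x + (1/2) *\<^sub>R y \<in> K"
        using that(1) by (intro convexD[OF K(1)]) (auto simp: T_def)
      then show ?thesis using that by (auto simp: C_def T_def inner_add_left scaleR_add_right)
    qed
    then show "indicator T x * indicator {x. - x \<in> T} y \<le> (indicator C ((1/2) *\<^sub>R (x + y)) :: ennreal)\<^sup>2"
      by (auto simp: indicator_def)
  qed auto
  then have "(emeasure lborel T)\<^sup>2 \<le> (emeasure lborel C)\<^sup>2" using eqT by (simp add: power2_eq_square)
  then have le: "emeasure lborel T \<le> emeasure lborel C" by (rule ennreal_power2_le_imp_le)
  have "emeasure lborel (K \<inter> {x. \<bar>x \<bullet> \<xi>\<bar> \<le> 3 * d}) \<le> emeasure lborel ((C \<union> T) \<union> {x. - x \<in> T})"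
  proof (rule emeasure_mono)
    show "K \<inter> {x. \<bar>x \<bullet> \<xi>\<bar> \<le> 3 * d} \<subseteq> (C \<union> T) \<union> {x. - x \<in> T}"
      using Kneg by (auto simp: C_def T_def abs_le_iff not_less)
  qed simp
  also have "\<dots> \<le> emeasure lborel (C \<union> T) + emeasure lborel {x. - x \<in> T}"
    by (intro emeasure_subadditive) auto
  also have "\<dots> \<le> (emeasure lborel C + emeasure lborel T) + emeasure lborel T"
    unfolding eqT by (intro add_mono emeasure_subadditive) auto
  also have "\<dots> \<le> (emeasure lborel C + emeasure lborel C) + emeasure lborel C"
    by (intro add_mono le order.refl)
  also have "\<dots> = 3 * emeasure lborel C"
    by (cases "emeasure lborel C") (simp_all add: ennreal_plus[symmetric] ennreal_mult_top flip: ennreal_numeral ennreal_mult del: ennreal_plus)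
  finally show ?thesis unfolding C_def .
qed

section \<open>Weak compactness\<close>

text \<open>A Schoenberg curve: \<open>tent\<close> reads off a ternary digit \<open>0\<close> or \<open>2\<close> of \<open>t\<close> after scaling by \<open>3\<^sup>j\<close>, and is
  insensitive to the lower digits.\<close>

definition tent :: "real \<Rightarrow> real" where
  "tent t = max 0 (min 1 (1/2 - cos (pi * t)))"

lemma tent_bounds: "0 \<le> tent t" "tent t \<le> 1"
  by (auto simp: tent_def)

lemma continuous_on_tent [continuous_intros]:
  "continuous_on S f \<Longrightarrow> continuous_on S (\<lambda>x. tent (f x))" for S :: "'a::t2_space set"
  unfolding tent_def by (intro continuous_intros)

text \<open>Modulo 2 the argument lies in [0,1/3] for digit 0 and in [2/3,1] for digit 1; there the
  cosine is at least 1/2 or at most -1/2, and the clipping in \<open>tent\<close> returns exactly 0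
  or 1. The tolerance 1/3 is the room that the later ternary digits take up.\<close>

lemma tent_digit:
  fixes m :: int and d :: nat
  assumes d: "d \<le> 1" and r: "0 \<le> r" "r \<le> 1/3"
  shows "tent (2 * of_int m + 2 * real d / 3 + r) = real d"
proof -
  have "cos (pi * (2 * of_int m + 2 * real d / 3 + r)) = cos (pi * (2 * real d / 3 + r) + of_int m * (2 * pi))"
    by (simp add: algebra_simps)
  also have "\<dots> = cos (pi * (2 * real d / 3 + r))"
    using sin_cos_eq_iff[of "pi * (2 * real d / 3 + r) + of_int m * (2 * pi)" "pi * (2 * real d / 3 + r)"] by auto
  finally have c: "cos (pi * (2 * of_int m + 2 * real d / 3 + r)) = cos (pi * (2 * real d / 3 + r))" .
  consider "d = 0" | "d = 1" using d by linarith
  then show ?thesis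
  proof cases
    case 1
    have "cos (pi / 3) \<le> cos (pi * r)"
      using r by (intro cos_monotone_0_pi_le) (auto simp: field_simps)
    then show ?thesis using c 1 by (simp add: tent_def cos_60)
  next
    case 2
    have "cos (pi * (2 / 3 + r)) \<le> cos (2 * pi / 3)"
      using r by (intro cos_monotone_0_pi_le) (auto simp: field_simps)
    then show ?thesis using c 2 by (simp add: tent_def cos_120)
  qed
qed

text \<open>For \<open>d\<close> with values 0 and 1 this is the point of the Cantor set with
  ternary digits \<open>2 * d k\<close>.\<close>

definition ternary :: "(nat \<Rightarrow> nat) \<Rightarrow> real" where
  "ternary d = (\<Sum>k. 2 * real (d k) / 3 ^ Suc k)"

lemma sums_two_thirds: "(\<lambda>k. 2 / 3 ^ Suc k :: real) sums 1"
proof -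
  have "(\<lambda>k. (2/3) * (1/3) ^ k :: real) sums ((2/3) * (1 / (1 - 1/3)))"
    by (intro sums_mult geometric_sums) auto
  then show ?thesis by (simp add: power_divide field_simps)
qed

lemma ternary_summable:
  assumes "\<And>k. d k \<le> 1" shows "summable (\<lambda>k. 2 * real (d k) / 3 ^ Suc k)"
proof (rule summable_comparison_test')
  show "summable (\<lambda>k. 2 / 3 ^ Suc k :: real)" using sums_two_thirds by (rule sums_summable)
  show "norm (2 * real (d n) / 3 ^ Suc n) \<le> 2 / 3 ^ Suc n" if "n \<ge> 0" for n
    using assms[of n] by (simp add: divide_right_mono)
qed

lemma ternary_bounds:
  assumes "\<And>k. d k \<le> 1" shows "0 \<le> ternary d" "ternary d \<le> 1"
proof -
  show "0 \<le> ternary d" unfolding ternary_def by (intro suminf_nonneg ternary_summable assms) auto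
  have "ternary d \<le> (\<Sum>k. 2 / 3 ^ Suc k)"
    unfolding ternary_def using assms
    by (intro suminf_le ternary_summable) (auto intro!: divide_right_mono sums_summable[OF sums_two_thirds] simp del: power_Suc)
  then show "ternary d \<le> 1" using sums_unique[OF sums_two_thirds] by simp
qed

lemma tent_ternary:
  assumes d: "\<And>k. d k \<le> 1"
  shows "tent (3 ^ j * ternary d) = real (d j)"
proof -
  \<comment> \<open>Scaling by 3^j turns the digits before j into the even integer 2 m, invisible to
    \<open>tent\<close> because of its period 2, and the digits after j into a remainder r of at
    most 1/3.\<close>
  define m where "m = (\<Sum>k<j. int (d k) * 3 ^ (j - Suc k))"
  define r where "r = ternary (\<lambda>k. d (k + Suc j)) / 3"
  have r: "0 \<le> r" "r \<le> 1/3" using ternary_bounds[of "\<lambda>k. d (k + Suc j)"] d by (auto simp: r_def)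
  have "ternary d = (\<Sum>k. 2 * real (d (k + Suc j)) / 3 ^ Suc (k + Suc j)) + (\<Sum>k<Suc j. 2 * real (d k) / 3 ^ Suc k)"
    unfolding ternary_def by (rule suminf_split_initial_segment) (rule ternary_summable[OF d])
  also have "(\<Sum>k. 2 * real (d (k + Suc j)) / 3 ^ Suc (k + Suc j)) = ternary (\<lambda>k. d (k + Suc j)) / 3 ^ Suc j"
    unfolding ternary_def using ternary_summable[of "\<lambda>k. d (k + Suc j)"] d
    by (subst suminf_divide[symmetric]) (auto simp: power_add field_simps)
  finally have "3 ^ j * ternary d = 3 ^ j * (\<Sum>k<j. 2 * real (d k) / 3 ^ Suc k) + 2 * real (d j) / 3 + r"
    by (simp add: r_def field_simps)
  also have "3 ^ j * (\<Sum>k<j. 2 * real (d k) / 3 ^ Suc k) = 2 * real_of_int m"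
  proof -
    have "3 ^ j * (2 * real (d k) / 3 ^ Suc k) = 2 * (real (d k) * 3 ^ (j - Suc k))" if "k < j" for k
    proof -
      have "(3::real) ^ j = 3 ^ (j - Suc k) * 3 ^ Suc k" using that by (simp add: power_add[symmetric] del: power_Suc)
      then show ?thesis by simp
    qed
    then show ?thesis by (simp add: m_def sum_distrib_left del: power_Suc)
  qed
  finally show ?thesis using tent_digit[OF d[of j] r, of m] by simp
qed

section \<open>Binary digits and a space-filling curve\<close>

definition bin_digit :: "real \<Rightarrow> nat \<Rightarrow> nat" where
  "bin_digit x k = nat (\<lfloor>2 ^ Suc k * x\<rfloor> - 2 * \<lfloor>2 ^ k * x\<rfloor>)"

lemma bin_digit_int: "int (bin_digit x k) = \<lfloor>2 ^ Suc k * x\<rfloor> - 2 * \<lfloor>2 ^ k * x\<rfloor>" and bin_digit_le: "bin_digit x k \<le> 1"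
proof -
  define y where "y = 2 ^ k * x"
  have "0 \<le> \<lfloor>2 * y\<rfloor> - 2 * \<lfloor>y\<rfloor>" "\<lfloor>2 * y\<rfloor> - 2 * \<lfloor>y\<rfloor> \<le> 1" by linarith+
  then show "int (bin_digit x k) = \<lfloor>2 ^ Suc k * x\<rfloor> - 2 * \<lfloor>2 ^ k * x\<rfloor>" "bin_digit x k \<le> 1"
    by (auto simp: bin_digit_def y_def mult.assoc)
qed

text \<open>The terms are differences of consecutive dyadic truncations of x, so the series
  telescopes; the initial truncation is the integer part of x, which is 0.\<close>

lemma bin_digit_sums:
  assumes "0 \<le> x" "x < 1" shows "(\<lambda>k. real (bin_digit x k) / 2 ^ Suc k) sums x"
proof -
  let ?a = "\<lambda>k. real_of_int \<lfloor>2 ^ k * x\<rfloor> / 2 ^ k"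
  have "?a \<longlonglongrightarrow> x"
  proof (rule tendsto_sandwich)
    show "\<forall>\<^sub>F k in sequentially. x - (1/2) ^ k \<le> ?a k"
    proof (rule always_eventually, rule allI)
      fix k
      have "2 ^ k * x - 1 \<le> real_of_int \<lfloor>2 ^ k * x\<rfloor>" by linarith
      then have "(2 ^ k * x - 1) / 2 ^ k \<le> ?a k" by (rule divide_right_mono) simp
      then show "x - (1/2) ^ k \<le> ?a k" by (simp add: diff_divide_distrib power_divide)
    qed
    show "\<forall>\<^sub>F k in sequentially. ?a k \<le> x"
      by (rule always_eventually) (auto simp: divide_le_eq mult.commute)
    show "(\<lambda>k. x - (1/2) ^ k) \<longlonglongrightarrow> x"
      using tendsto_diff[OF tendsto_const LIMSEQ_power_zero[of "1/2 :: real"]] by simp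
  qed simp
  then have "(\<lambda>k. ?a (Suc k) - ?a k) sums (x - ?a 0)" by (rule telescope_sums)
  moreover have "?a 0 = 0" using assms by (simp add: floor_eq_iff)
  moreover have "?a (Suc k) - ?a k = real (bin_digit x k) / 2 ^ Suc k" for k
  proof -
    have "real (bin_digit x k) = real_of_int (int (bin_digit x k))" by simp
    then show ?thesis by (simp add: bin_digit_int field_simps)
  qed
  ultimately show ?thesis by simp
qed

lemma measurable_bin_digit [measurable]: "(\<lambda>x. bin_digit x k) \<in> borel \<rightarrow>\<^sub>M count_space UNIV"
  unfolding bin_digit_def by measurable

text \<open>\<open>\<sigma>\<close> interleaves the binary digits of all coordinates of x into the
  ternary digits of one point of the Cantor set, and \<open>\<phi>\<close> reads them back with
  \<open>tent\<close>. Continuity is asked of \<open>\<phi>\<close>, along which test functions are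
  pulled back to the line; measures are pushed to the line along the Borel map
  \<open>\<sigma>\<close>.\<close>

lemma space_filling_curve:
  obtains \<phi> :: "real \<Rightarrow> 'a::euclidean_space" and \<sigma> :: "'a \<Rightarrow> real"
  where "continuous_on UNIV \<phi>" "\<sigma> \<in> borel \<rightarrow>\<^sub>M borel" "range \<sigma> \<subseteq> {0..1}" "bounded (range \<phi>)"
    "\<forall>x. (\<forall>b\<in>Basis. \<bar>x \<bullet> b\<bar> \<le> 1) \<longrightarrow> \<phi> (\<sigma> x) = x"
proof -
  define I :: "('a \<times> nat) set" where "I = Basis \<times> UNIV"
  have cI: "countable I" by (simp add: I_def countable_finite)
  define e where "e = to_nat_on I"
  have e: "inj_on e I" unfolding e_def by (rule inj_on_to_nat_on[OF cI])
  \<comment> \<open>A coordinate t in [-1,1] is encoded as (t + 1) / 4 in [0,1/2], safely below 1,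
    where the digit expansion would break down; the outer 4 and -1 undo this.\<close>
  define \<phi> :: "real \<Rightarrow> 'a" where
    "\<phi> t = (\<Sum>b\<in>Basis. (4 * (\<Sum>k. tent (3 ^ e (b, k) * t) / 2 ^ Suc k) - 1) *\<^sub>R b)" for t
  define dig where "dig x j = (if j \<in> e ` I then bin_digit ((x \<bullet> fst (inv_into I e j) + 1) / 4) (snd (inv_into I e j)) else 0)" for x j
  define \<sigma> where "\<sigma> x = ternary (dig x)" for x
  have dig_le: "dig x j \<le> 1" for x j using bin_digit_le by (simp add: dig_def del: One_nat_def)
  have half: "summable (\<lambda>k. 1 / 2 ^ Suc k :: real)"
    using summable_mult[OF summable_geometric[of "1/2 :: real"], of "1/2"] by (simp add: power_divide)
  have halfsum: "(\<Sum>k. 1 / 2 ^ Suc k :: real) = 1"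
    using power_half_series sums_unique by (fastforce simp: power_divide)
  have tb: "norm (tent (3 ^ e (b, k) * t) / 2 ^ Suc k) \<le> 1 / 2 ^ Suc k" for b k t
    using tent_bounds[of "3 ^ e (b, k) * t"] by (auto intro!: divide_right_mono simp del: power_Suc)
  have cont: "continuous_on UNIV (\<lambda>t. \<Sum>k. tent (3 ^ e (b, k) * t) / 2 ^ Suc k)" for b
  proof (rule uniform_limit_theorem)
    show "\<forall>\<^sub>F n in sequentially. continuous_on UNIV (\<lambda>t. \<Sum>k<n. tent (3 ^ e (b, k) * t) / 2 ^ Suc k)"
      by (intro always_eventually allI continuous_intros) auto
    show "uniform_limit UNIV (\<lambda>n t. \<Sum>k<n. tent (3 ^ e (b, k) * t) / 2 ^ Suc k) (\<lambda>t. \<Sum>k. tent (3 ^ e (b, k) * t) / 2 ^ Suc k) sequentially"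
      by (rule Weierstrass_m_test[OF tb half])
  qed simp
  show thesis
  proof (rule that)
    show "continuous_on UNIV \<phi>" unfolding \<phi>_def by (intro continuous_intros cont)
    have "(\<lambda>x. dig x j) \<in> borel \<rightarrow>\<^sub>M count_space UNIV" for j
      unfolding dig_def by measurable
    then show "\<sigma> \<in> borel \<rightarrow>\<^sub>M borel" unfolding \<sigma>_def ternary_def by measurable
    show "range \<sigma> \<subseteq> {0..1}" using ternary_bounds dig_le by (auto simp: \<sigma>_def)
    show "bounded (range \<phi>)"
    proof (rule boundedI)
      fix x assume "x \<in> range \<phi>"
      then obtain t where t: "x = \<phi> t" by auto
      have "norm (\<phi> t) \<le> (\<Sum>b\<in>(Basis :: 'a set). 5)"
        unfolding \<phi>_def
      proof (rule sum_norm_le)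
        fix b :: 'a assume b: "b \<in> Basis"
        have sm: "summable (\<lambda>k. tent (3 ^ e (b, k) * t) / 2 ^ Suc k)"
          using half tb by (rule summable_comparison_test')
        have "(\<Sum>k. tent (3 ^ e (b, k) * t) / 2 ^ Suc k) \<le> (\<Sum>k. 1 / 2 ^ Suc k)"
          using tb tent_bounds by (intro suminf_le sm half) (auto intro!: divide_right_mono simp del: power_Suc)
        moreover have "0 \<le> (\<Sum>k. tent (3 ^ e (b, k) * t) / 2 ^ Suc k)"
          using tent_bounds by (intro suminf_nonneg sm) auto
        ultimately show "norm ((4 * (\<Sum>k. tent (3 ^ e (b, k) * t) / 2 ^ Suc k) - 1) *\<^sub>R b) \<le> 5"
          using b halfsum by simp
      qed
      then show "norm x \<le> (\<Sum>b\<in>(Basis :: 'a set). 5)" using t by simp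
    qed
    show "\<forall>x. (\<forall>b\<in>Basis. \<bar>x \<bullet> b\<bar> \<le> 1) \<longrightarrow> \<phi> (\<sigma> x) = x"
    proof (intro allI impI)
      fix x :: 'a assume x: "\<forall>b\<in>Basis. \<bar>x \<bullet> b\<bar> \<le> 1"
      have "\<phi> (\<sigma> x) = (\<Sum>b\<in>Basis. (x \<bullet> b) *\<^sub>R b)"
        unfolding \<phi>_def
      proof (rule sum.cong[OF refl])
        fix b :: 'a assume b: "b \<in> Basis"
        have "tent (3 ^ e (b, k) * \<sigma> x) = real (bin_digit ((x \<bullet> b + 1) / 4) k)" for k
        proof -
          have "(b, k) \<in> I" using b by (simp add: I_def)
          then have "dig x (e (b, k)) = bin_digit ((x \<bullet> b + 1) / 4) k"
            using e by (simp add: dig_def)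
          then show ?thesis unfolding \<sigma>_def by (simp add: tent_ternary[OF dig_le])
        qed
        moreover have "(\<lambda>k. real (bin_digit ((x \<bullet> b + 1) / 4) k) / 2 ^ Suc k) sums ((x \<bullet> b + 1) / 4)"
          using x b by (intro bin_digit_sums) (auto simp: abs_le_iff)
        ultimately have "(\<Sum>k. tent (3 ^ e (b, k) * \<sigma> x) / 2 ^ Suc k) = (x \<bullet> b + 1) / 4"
          by (simp add: sums_iff del: power_Suc)
        then show "(4 * (\<Sum>k. tent (3 ^ e (b, k) * \<sigma> x) / 2 ^ Suc k) - 1) *\<^sub>R b = (x \<bullet> b) *\<^sub>R b" by simp
      qed
      then show "\<phi> (\<sigma> x) = x" by (simp add: euclidean_representation)
    qed
  qed
qed

text \<open>Helly's theorem on the line is transported through a space-filling curve and a Borel section of it.\<close>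
lemma weakly_convergent_subsequence:
  fixes \<mu> :: "nat \<Rightarrow> 'a::euclidean_space measure" and m :: real
  assumes sets[measurable_cong]: "\<And>n. sets (\<mu> n) = sets borel"
    and cube: "\<And>n. AE x in \<mu> n. norm x \<le> 1"
    and m: "m > 0" "\<And>n. 0 < mass n" "\<And>n. emeasure (\<mu> n) UNIV = ennreal (mass n)" "mass \<longlonglongrightarrow> m"
  obtains s :: "nat \<Rightarrow> nat" and \<nu> :: "'a measure" where "strict_mono s" "sets \<nu> = sets borel" "finite_measure \<nu>"
    "\<And>g :: 'a \<Rightarrow> real. continuous_on UNIV g \<Longrightarrow> integrable \<nu> g"
    "\<And>g :: 'a \<Rightarrow> real. continuous_on UNIV g \<Longrightarrow> (\<lambda>n. \<integral>x. g x \<partial>\<mu> (s n)) \<longlonglongrightarrow> (\<integral>x. g x \<partial>\<nu>)"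
proof -
  obtain \<phi> :: "real \<Rightarrow> 'a" and \<sigma> :: "'a \<Rightarrow> real" where
    \<phi>1: "continuous_on UNIV \<phi>" and \<sigma>[measurable]: "\<sigma> \<in> borel \<rightarrow>\<^sub>M borel" and
    \<sigma>01: "range \<sigma> \<subseteq> {0..1}" and \<phi>2: "bounded (range \<phi>)" and \<phi>\<sigma>: "\<forall>x. (\<forall>b\<in>Basis. \<bar>x \<bullet> b\<bar> \<le> 1) \<longrightarrow> \<phi> (\<sigma> x) = x"
    by (rule space_filling_curve)
  have [measurable]: "\<phi> \<in> borel \<rightarrow>\<^sub>M borel" using \<phi>1 by (intro borel_measurable_continuous_onI)
  have space: "space (\<mu> n) = UNIV" for n using sets_eq_imp_space_eq[OF sets[of n]] by simp
  \<comment> \<open>Normalized to probability measures and transported to the line, all measures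
    live on [0,1], so that tightness is automatic.\<close>
  define P where "P n = distr (density (\<mu> n) (\<lambda>_. ennreal (1 / mass n))) borel \<sigma>" for n
  have emP: "emeasure (P n) A = ennreal (1 / mass n) * emeasure (\<mu> n) (\<sigma> -` A)" if [measurable]: "A \<in> sets borel" for A n
  proof -
    have [measurable]: "\<sigma> -` A \<in> sets (\<mu> n)"
      using measurable_sets[OF \<sigma> that] by (simp add: sets)
    have "emeasure (P n) A = (\<integral>\<^sup>+x. ennreal (1 / mass n) * indicator (\<sigma> -` A) x \<partial>\<mu> n)"
      by (simp add: P_def emeasure_distr space emeasure_density)
    then show ?thesis by (simp add: nn_integral_cmult)
  qed
  have prob: "prob_space (P n)" for n
    by (rule prob_spaceI) (simp add: P_def[of n] emeasure_distr emeasure_density space m(2,3) less_imp_le ennreal_mult[symmetric] less_imp_neq[OF m(2), symmetric])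
  interpret P: prob_space "P n" for n by (rule prob)
  have rd: "real_distribution (P n)" for n
    unfolding real_distribution_def real_distribution_axioms_def using prob by (simp add: P_def)
  have "tight P"
    unfolding tight_def
  proof (intro conjI allI impI rd)
    fix \<epsilon> :: real assume \<epsilon>: "\<epsilon> > 0"
    have "measure (P n) {-1<..2} = 1" for n
    proof -
      have "\<sigma> x \<in> {0..1}" for x using \<sigma>01 by blast
      then have "\<sigma> x \<in> {-1<..2}" for x by (rule subsetD[rotated]) auto
      then have "\<sigma> -` {-1<..2} = UNIV" by blast
      then have "emeasure (P n) {-1<..2} = 1"
        using m(2)[of n] by (simp add: emP m(3) ennreal_mult[symmetric])
      then show ?thesis by (simp add: measure_def)
    qed
    then show "\<exists>a b. a < b \<and> (\<forall>n. 1 - \<epsilon> < measure (P n) {a<..b})"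
      using \<epsilon> by (intro exI[of _ "-1"] exI[of _ 2]) auto
  qed
  from tight_imp_convergent_subsubsequence[OF this strict_mono_id] obtain s Q where
    s: "strict_mono (s :: nat \<Rightarrow> nat)" and Q: "real_distribution Q" and conv: "weak_conv_m (P \<circ> s) Q"
    by (auto simp: o_def id_def)
  interpret Q: real_distribution Q by (rule Q)
  \<comment> \<open>\<open>\<phi>\<close> pushes the Helly limit back to the space, and the factor m
    restores the limit of the masses that were divided out.\<close>
  define \<nu> where "\<nu> = density (distr Q borel \<phi>) (\<lambda>_. ennreal m)"
  have [measurable_cong]: "sets Q = sets borel" by simp
  have setsnu: "sets \<nu> = sets borel" by (simp add: \<nu>_def)
  have finnu: "finite_measure \<nu>"
  proof
    have "emeasure \<nu> (space \<nu>) = ennreal m * emeasure (distr Q borel \<phi>) UNIV"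
      by (simp add: \<nu>_def emeasure_density nn_integral_cmult)
    also have "\<dots> = ennreal m" using Q.emeasure_space_1 by (simp add: emeasure_distr)
    finally show "emeasure \<nu> (space \<nu>) \<noteq> \<infinity>" by simp
  qed
  obtain R where R: "\<And>t. norm (\<phi> t) \<le> R" using \<phi>2 by (auto simp: bounded_iff)
  have bdd: "\<exists>B. \<forall>t. norm (g (\<phi> t)) \<le> B" if g: "continuous_on UNIV g" for g :: "'a \<Rightarrow> real"
  proof -
    have "compact (g ` cball 0 R)" by (intro compact_continuous_image continuous_on_subset[OF g]) auto
    then obtain B where "\<And>y. y \<in> g ` cball 0 R \<Longrightarrow> norm y \<le> B" by (meson bounded_iff compact_imp_bounded)
    then show ?thesis using R by (intro exI[of _ B]) auto
  qed
  have lim: "integrable \<nu> g \<and> (\<lambda>n. \<integral>x. g x \<partial>\<mu> (s n)) \<longlonglongrightarrow> (\<integral>x. g x \<partial>\<nu>)" if g: "continuous_on UNIV g" for g :: "'a \<Rightarrow> real"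
  proof -
    have [measurable]: "g \<in> borel_measurable borel" using g by (intro borel_measurable_continuous_onI)
    have gphi: "continuous_on UNIV (\<lambda>t. g (\<phi> t))"
      by (rule continuous_on_compose2[OF g \<phi>1]) auto
    obtain B where B: "\<And>t. norm (g (\<phi> t)) \<le> B" using bdd[OF g] by blast
    have mu: "(\<integral>x. g x \<partial>\<mu> n) = mass n * (\<integral>t. g (\<phi> t) \<partial>P n)" for n
    proof -
      have "(\<integral>t. g (\<phi> t) \<partial>P n) = (\<integral>x. g (\<phi> (\<sigma> x)) \<partial>density (\<mu> n) (\<lambda>_. ennreal (1 / mass n)))"
        unfolding P_def by (rule integral_distr) measurable
      also have "\<dots> = (\<integral>x. (1 / mass n) *\<^sub>R g (\<phi> (\<sigma> x)) \<partial>\<mu> n)"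
        using m(2)[of n] by (intro integral_density) auto
      also have "\<dots> = (1 / mass n) * (\<integral>x. g (\<phi> (\<sigma> x)) \<partial>\<mu> n)" by simp
      \<comment> \<open>The unit ball, which carries \<open>\<mu> n\<close>, lies in the cube on
        which \<open>\<phi>\<close> inverts \<open>\<sigma>\<close>.\<close>
      also have "(\<integral>x. g (\<phi> (\<sigma> x)) \<partial>\<mu> n) = (\<integral>x. g x \<partial>\<mu> n)"
      proof (rule integral_cong_AE)
        show "AE x in \<mu> n. g (\<phi> (\<sigma> x)) = g x"
          using cube[of n]
        proof eventually_elim
          fix x :: 'a assume "norm x \<le> 1"
          then have "\<phi> (\<sigma> x) = x" using Basis_le_norm[of _ x] by (intro \<phi>\<sigma>[rule_format]) force
          then show "g (\<phi> (\<sigma> x)) = g x" by simp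
        qed
      qed measurable
      finally show ?thesis using m(2)[of n] by simp
    qed
    have "(\<lambda>n. \<integral>t. g (\<phi> t) \<partial>(P \<circ> s) n) \<longlonglongrightarrow> (\<integral>t. g (\<phi> t) \<partial>Q)"
    proof (rule weak_conv_imp_integral_bdd_continuous_conv)
      show "real_distribution ((P \<circ> s) n)" for n by (simp add: rd)
      show "isCont (\<lambda>t. g (\<phi> t)) t" for t using gphi by (simp add: continuous_on_eq_continuous_at)
    qed (use Q conv B in \<open>auto simp: o_def\<close>)
    moreover have "(\<lambda>n. mass (s n)) \<longlonglongrightarrow> m" using LIMSEQ_subseq_LIMSEQ[OF m(4) s] by (simp add: o_def)
    ultimately have "(\<lambda>n. mass (s n) * (\<integral>t. g (\<phi> t) \<partial>(P \<circ> s) n)) \<longlonglongrightarrow> m * (\<integral>t. g (\<phi> t) \<partial>Q)"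
      by (intro tendsto_mult)
    then have 1: "(\<lambda>n. \<integral>x. g x \<partial>\<mu> (s n)) \<longlonglongrightarrow> m * (\<integral>t. g (\<phi> t) \<partial>Q)" by (simp add: mu)
    have int: "integrable Q (\<lambda>t. g (\<phi> t))"
      by (rule Q.integrable_const_bound[of _ B]) (use B in auto)
    have "integrable (distr Q borel \<phi>) g" by (subst integrable_distr_eq) (use int in auto)
    then have 2: "integrable \<nu> g" unfolding \<nu>_def using m(1) by (subst integrable_density) auto
    have "(\<integral>x. g x \<partial>\<nu>) = (\<integral>x. m *\<^sub>R g x \<partial>distr Q borel \<phi>)"
      unfolding \<nu>_def using m(1) by (intro integral_density) auto
    also have "\<dots> = m * (\<integral>t. g (\<phi> t) \<partial>Q)" by (simp add: integral_distr)
    finally show ?thesis using 1 2 by simp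
  qed
  show thesis by (rule that[OF s setsnu finnu]) (use lim in auto)
qed

section \<open>Surface measure and polar coordinates\<close>

lemma ball_borel [measurable]: "ball (x::'a::euclidean_space) r \<in> sets borel"
  by simp

lemma sets_sphere_measure [measurable_cong, simp]: "sets sphere_measure = sets borel"
  by (simp add: sphere_measure_def)

lemma space_sphere_measure [simp]: "space sphere_measure = UNIV"
  by (simp add: sphere_measure_def)

lemma nn_integral_sphere_measure:
  fixes g :: "'a::euclidean_space \<Rightarrow> ennreal"
  assumes [measurable]: "g \<in> borel_measurable borel"
  shows "(\<integral>\<^sup>+x. g x \<partial>sphere_measure) =
    ennreal (real DIM('a)) * (\<integral>\<^sup>+x. indicator (ball 0 1 - {0}) x * g (x /\<^sub>R norm x) \<partial>lborel)"
proof -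
  have [measurable]: "(\<lambda>x::'a. x /\<^sub>R norm x) \<in> borel \<rightarrow>\<^sub>M borel" by measurable
  have "(\<integral>\<^sup>+x. g x \<partial>sphere_measure) = (\<integral>\<^sup>+x. ennreal (real DIM('a)) * indicator (ball 0 1 - {0}) x * g (x /\<^sub>R norm x) \<partial>lborel)"
    unfolding sphere_measure_def by (subst nn_integral_distr, measurable) (rule nn_integral_density, measurable)
  also have "\<dots> = ennreal (real DIM('a)) * (\<integral>\<^sup>+x. indicator (ball 0 1 - {0}) x * g (x /\<^sub>R norm x) \<partial>lborel)"
    unfolding mult.assoc by (rule nn_integral_cmult) measurable
  finally show ?thesis .
qed

lemma emeasure_sphere_measure_UNIV:
  "emeasure (sphere_measure :: 'a::euclidean_space measure) UNIV
     = ennreal (real DIM('a)) * emeasure lborel (ball 0 1 :: 'a set)"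
proof -
  have "emeasure (sphere_measure :: 'a measure) UNIV = (\<integral>\<^sup>+x. 1 \<partial>(sphere_measure :: 'a measure))"
    by simp
  also have "\<dots> = ennreal (real DIM('a)) * emeasure lborel (ball 0 1 - {0::'a})"
    by (subst nn_integral_sphere_measure) (simp_all add: Int_absorb)
  also have "emeasure lborel (ball 0 1 - {0::'a}) = emeasure lborel (ball 0 1 :: 'a set)"
    by (rule emeasure_Diff_null_set) auto
  finally show ?thesis .
qed

lemma finite_measure_sphere_measure: "finite_measure (sphere_measure :: 'a::euclidean_space measure)"
proof
  show "emeasure (sphere_measure :: 'a measure) (space sphere_measure) \<noteq> \<infinity>"
    using emeasure_lborel_ball_finite[of "0::'a" 1]
    by (simp add: emeasure_sphere_measure_UNIV ennreal_mult_eq_top_iff)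
qed

interpretation sphere: finite_measure "sphere_measure :: 'a::euclidean_space measure"
  by (rule finite_measure_sphere_measure)

lemma emeasure_sphere_measure_pos: "emeasure (sphere_measure :: 'a::euclidean_space measure) UNIV > 0"
  by (simp add: emeasure_sphere_measure_UNIV emeasure_ball ennreal_zero_less_mult_iff)

lemma AE_sphere_measure: "AE x in (sphere_measure :: 'a::euclidean_space measure). norm x = 1"
proof (rule AE_I[where N="{x. norm x \<noteq> 1}"])
  have "emeasure sphere_measure {x::'a. norm x \<noteq> 1} = (\<integral>\<^sup>+x. indicator {x::'a. norm x \<noteq> 1} x \<partial>sphere_measure)"
    by simp
  also have "\<dots> = ennreal (real DIM('a)) * (\<integral>\<^sup>+x. indicator (ball 0 1 - {0}) x * indicator {x::'a. norm x \<noteq> 1} (x /\<^sub>R norm x) \<partial>lborel)"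
    by (rule nn_integral_sphere_measure) simp
  also have "(\<integral>\<^sup>+x. indicator (ball 0 1 - {0}) x * indicator {x::'a. norm x \<noteq> 1} (x /\<^sub>R norm x) \<partial>lborel) = (\<integral>\<^sup>+(x::'a). 0 \<partial>lborel)"
  proof (rule nn_integral_cong)
    show "indicator (ball 0 1 - {0}) x * indicator {x::'a. norm x \<noteq> 1} (x /\<^sub>R norm x) = (0::ennreal)" for x :: 'a
      by (cases "x = 0") auto
  qed
  finally show "emeasure sphere_measure {x::'a. norm x \<noteq> 1} = 0" by simp
qed auto

lemma nn_integral_lborel_scale:
  fixes F :: "'a::euclidean_space \<Rightarrow> ennreal"
  assumes [measurable]: "F \<in> borel_measurable borel" and s: "s > 0"
  shows "(\<integral>\<^sup>+x. F (s *\<^sub>R x) \<partial>lborel) = ennreal (1 / s ^ DIM('a)) * (\<integral>\<^sup>+x. F x \<partial>lborel)"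
proof -
  have "(\<integral>\<^sup>+x. F x \<partial>lborel) = (\<integral>\<^sup>+x. F x \<partial>density (distr lborel borel (\<lambda>x. 0 + s *\<^sub>R x)) (\<lambda>_. ennreal (\<bar>s\<bar>^DIM('a))))"
    using s by (subst lborel_affine[of s 0]) auto
  also have "\<dots> = ennreal (s^DIM('a)) * (\<integral>\<^sup>+x. F (s *\<^sub>R x) \<partial>lborel)"
    using s by (simp add: nn_integral_density nn_integral_distr nn_integral_cmult)
  finally show ?thesis
    using s by (simp add: mult.assoc[symmetric] ennreal_mult[symmetric])
qed

text \<open>Used with n the dimension and a = \<open>norm y\<close>: in the polar formula this tail
  integral cancels the weight \<open>norm y ^ n\<close> and the factor n that comes from the surface
  measure.\<close>

lemma nn_integral_power_tail:
  fixes a :: real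
  assumes a: "a > 0" and n: "n > 0"
  shows "(\<integral>\<^sup>+s. ennreal (1 / s ^ Suc n) * indicator {a<..} s \<partial>lborel) = ennreal (1 / (real n * a ^ n))"
proof -
  have "(\<integral>\<^sup>+s. ennreal (1 / s ^ Suc n) * indicator {a<..} s \<partial>lborel) = (\<integral>\<^sup>+s. ennreal (1 / s ^ Suc n) * indicator {a..} s \<partial>lborel)"
    by (rule nn_integral_cong_AE, rule AE_I[where N="{a}"]) (auto simp: indicator_def)
  also have "\<dots> = ennreal (0 - (- 1 / (real n * a ^ n)))"
  proof (rule nn_integral_FTC_atLeast)
    show "((\<lambda>s. - 1 / (real n * s ^ n)) \<longlongrightarrow> 0) at_top"
    proof -
      have "filterlim (\<lambda>s::real. real n * s ^ n) at_top at_top"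
        using n by (intro filterlim_tendsto_pos_mult_at_top[OF tendsto_const] filterlim_pow_at_top filterlim_ident) auto
      then show ?thesis by (intro tendsto_divide_0[OF tendsto_const]) (rule filterlim_at_top_imp_at_infinity)
    qed
    fix x assume "a \<le> x"
    then have x: "x > 0" using a by simp
    have "((\<lambda>s. - 1 / (real n * s ^ n)) has_real_derivative (real n * (real n * x ^ (n - 1))) / (real n * x ^ n)\<^sup>2) (at x)"
      using x n by (auto intro!: derivative_eq_intros simp: power2_eq_square)
    moreover have "(real n * (real n * x ^ (n - 1))) / (real n * x ^ n)\<^sup>2 = 1 / x ^ Suc n"
    proof -
      obtain k where k: "n = Suc k" using n by (cases n) auto
      have "(m * (m * x ^ k)) / (m * (x * x ^ k))\<^sup>2 = 1 / (x * (x * x ^ k))" if "m \<noteq> 0" for m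
        using x that by (simp add: divide_simps power2_eq_square)
      from this[of "real n"] show ?thesis using n by (simp add: k del: of_nat_Suc)
    qed
    ultimately show "((\<lambda>s. - 1 / (real n * s ^ n)) has_real_derivative 1 / x ^ Suc n) (at x)" by simp
  qed (use a in auto)
  finally show ?thesis by simp
qed

text \<open>Substituting the definition of the surface measure, the radial integral is a scale average
  of the integrals of \<open>F\<close> over balls, which Fubini evaluates.\<close>
lemma nn_integral_polar:
  fixes F :: "'a::euclidean_space \<Rightarrow> ennreal"
  assumes [measurable]: "F \<in> borel_measurable borel"
  shows "(\<integral>\<^sup>+\<theta>. (\<integral>\<^sup>+r\<in>{0<..}. ennreal (r ^ (DIM('a) - 1)) * F (r *\<^sub>R \<theta>) \<partial>lborel) \<partial>sphere_measure) = (\<integral>\<^sup>+x. F x \<partial>lborel)"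
proof -
  define n where "n = DIM('a)"
  have n: "n > 0" by (simp add: n_def)
  let ?B = "ball 0 1 - {0::'a}"
  have "(\<integral>\<^sup>+\<theta>. (\<integral>\<^sup>+r\<in>{0<..}. ennreal (r ^ (n - 1)) * F (r *\<^sub>R \<theta>) \<partial>lborel) \<partial>sphere_measure)
    = ennreal n * (\<integral>\<^sup>+x. indicator ?B x * (\<integral>\<^sup>+r\<in>{0<..}. ennreal (r ^ (n - 1)) * F (r *\<^sub>R (x /\<^sub>R norm x)) \<partial>lborel) \<partial>lborel)"
    unfolding n_def by (rule nn_integral_sphere_measure) measurable
  also have "(\<integral>\<^sup>+x. indicator ?B x * (\<integral>\<^sup>+r\<in>{0<..}. ennreal (r ^ (n - 1)) * F (r *\<^sub>R (x /\<^sub>R norm x)) \<partial>lborel) \<partial>lborel)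
    = (\<integral>\<^sup>+x. \<integral>\<^sup>+s. indicator ?B x * ennreal (norm x ^ n) * (ennreal (s ^ (n - 1)) * F (s *\<^sub>R x) * indicator {0<..} s) \<partial>lborel \<partial>lborel)"
  proof (rule nn_integral_cong)
    fix x :: 'a
    show "indicator ?B x * (\<integral>\<^sup>+r\<in>{0<..}. ennreal (r ^ (n - 1)) * F (r *\<^sub>R (x /\<^sub>R norm x)) \<partial>lborel)
      = (\<integral>\<^sup>+s. indicator ?B x * ennreal (norm x ^ n) * (ennreal (s ^ (n - 1)) * F (s *\<^sub>R x) * indicator {0<..} s) \<partial>lborel)"
    proof (cases "x \<in> ?B")
      case True
      then have x: "norm x > 0" by auto
      \<comment> \<open>The substitution r = s \<open>norm x\<close> removes the normalization of x;
        the powers combine to \<open>norm x ^ n * s ^ (n - 1)\<close>.\<close>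
      have "(\<integral>\<^sup>+r\<in>{0<..}. ennreal (r ^ (n - 1)) * F (r *\<^sub>R (x /\<^sub>R norm x)) \<partial>lborel)
        = ennreal \<bar>norm x\<bar> * (\<integral>\<^sup>+s. ennreal ((0 + norm x * s) ^ (n - 1)) * F ((0 + norm x * s) *\<^sub>R (x /\<^sub>R norm x)) * indicator {0<..} (0 + norm x * s) \<partial>lborel)"
        using x by (intro nn_integral_real_affine) auto
      also have "\<dots> = (\<integral>\<^sup>+s. ennreal (norm x) * (ennreal ((norm x * s) ^ (n - 1)) * F ((norm x * s) *\<^sub>R (x /\<^sub>R norm x)) * indicator {0<..} (norm x * s)) \<partial>lborel)"
        by (simp add: nn_integral_cmult)
      also have "\<dots> = (\<integral>\<^sup>+s. indicator ?B x * ennreal (norm x ^ n) * (ennreal (s ^ (n - 1)) * F (s *\<^sub>R x) * indicator {0<..} s) \<partial>lborel)"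
      proof (rule nn_integral_cong)
        fix s :: real
        have "ennreal (norm x) * ennreal ((norm x * s) ^ (n - 1)) = ennreal (norm x ^ n) * ennreal (s ^ (n - 1))" if "s > 0"
          using n that x by (cases n) (auto simp: ennreal_mult[symmetric] power_mult_distrib ac_simps)
        moreover have "(norm x * s) *\<^sub>R (x /\<^sub>R norm x) = s *\<^sub>R x"
          using x by simp
        ultimately show "ennreal (norm x) * (ennreal ((norm x * s) ^ (n - 1)) * F ((norm x * s) *\<^sub>R (x /\<^sub>R norm x)) * indicator {0<..} (norm x * s))
          = indicator ?B x * ennreal (norm x ^ n) * (ennreal (s ^ (n - 1)) * F (s *\<^sub>R x) * indicator {0<..} s)"
          using True x by (cases "s > 0") (auto simp: zero_less_mult_iff mult.assoc[symmetric] simp del: scaleR_scaleR)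
      qed
      finally show ?thesis using True by simp
    qed auto
  qed
  also have "\<dots> = (\<integral>\<^sup>+s. \<integral>\<^sup>+x. indicator ?B x * ennreal (norm x ^ n) * (ennreal (s ^ (n - 1)) * F (s *\<^sub>R x) * indicator {0<..} s) \<partial>lborel \<partial>lborel)"
    by (rule lborel_pair.Fubini'[symmetric]) measurable
  \<comment> \<open>The substitution y = s x in the inner integral turns membership of x in the unit
    ball into the condition \<open>norm y < s\<close>.\<close>
  also have "\<dots> = (\<integral>\<^sup>+s. \<integral>\<^sup>+y. F y * ennreal (norm y ^ n) * (ennreal (1 / s ^ Suc n) * indicator {norm y<..} s) \<partial>lborel \<partial>lborel)"
  proof (rule nn_integral_cong)
    fix s :: real
    show "(\<integral>\<^sup>+x. indicator ?B x * ennreal (norm x ^ n) * (ennreal (s ^ (n - 1)) * F (s *\<^sub>R x) * indicator {0<..} s) \<partial>lborel)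
      = (\<integral>\<^sup>+y. F y * ennreal (norm y ^ n) * (ennreal (1 / s ^ Suc n) * indicator {norm y<..} s) \<partial>lborel)"
    proof (cases "s > 0")
      case True
      let ?u = "\<lambda>y::'a. indicator {y. 0 < norm y \<and> norm y < s} y * ennreal (norm y ^ n) * (ennreal (1 / s) * F y)"
      have "(\<integral>\<^sup>+x. indicator ?B x * ennreal (norm x ^ n) * (ennreal (s ^ (n - 1)) * F (s *\<^sub>R x) * indicator {0<..} s) \<partial>lborel) = (\<integral>\<^sup>+x. ?u (s *\<^sub>R x) \<partial>lborel)"
      proof (rule nn_integral_cong)
        fix x :: 'a
        have "ennreal (norm x ^ n) * ennreal (s ^ (n - 1)) = ennreal ((s * norm x) ^ n) * ennreal (1 / s)"
          using True n by (cases n) (auto simp: ennreal_mult[symmetric] power_mult_distrib ac_simps)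
        then show "indicator ?B x * ennreal (norm x ^ n) * (ennreal (s ^ (n - 1)) * F (s *\<^sub>R x) * indicator {0<..} s) = ?u (s *\<^sub>R x)"
          using True by (auto simp: indicator_def mult.assoc[symmetric])
      qed
      also have "\<dots> = ennreal (1 / s ^ n) * (\<integral>\<^sup>+y. ?u y \<partial>lborel)"
        unfolding n_def using True by (intro nn_integral_lborel_scale) measurable
      also have "\<dots> = (\<integral>\<^sup>+y. ennreal (1 / s ^ n) * ?u y \<partial>lborel)" by (simp add: nn_integral_cmult)
      also have "\<dots> = (\<integral>\<^sup>+y. F y * ennreal (norm y ^ n) * (ennreal (1 / s ^ Suc n) * indicator {norm y<..} s) \<partial>lborel)"
      proof (rule nn_integral_cong)
        fix y :: 'a
        have "ennreal (1 / s ^ n) * ennreal (1 / s) = ennreal (1 / s ^ Suc n)"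
          using True by (simp add: ennreal_mult[symmetric] mult.commute)
        then have *: "ennreal (1 / s ^ n) * (ennreal (norm y ^ n) * (ennreal (1 / s) * F y)) = F y * ennreal (norm y ^ n) * ennreal (1 / s ^ Suc n)"
          by (metis (no_types, lifting) mult.assoc mult.commute)
        show "ennreal (1 / s ^ n) * ?u y = F y * ennreal (norm y ^ n) * (ennreal (1 / s ^ Suc n) * indicator {norm y<..} s)"
          using * n by (cases "y = 0") (auto simp: indicator_def mult.assoc)
      qed
      finally show ?thesis .
    next
      case False
      then have "\<not> norm y < s" for y :: 'a using norm_ge_zero[of y] by linarith
      with False show ?thesis by simp
    qed
  qed
  also have "\<dots> = (\<integral>\<^sup>+y. \<integral>\<^sup>+s. F y * ennreal (norm y ^ n) * (ennreal (1 / s ^ Suc n) * indicator {norm y<..} s) \<partial>lborel \<partial>lborel)"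
    unfolding greaterThan_def by (rule lborel_pair.Fubini') measurable
  also have "\<dots> = (\<integral>\<^sup>+y. ennreal (1 / n) * F y \<partial>lborel)"
  proof (rule nn_integral_cong_AE, rule AE_I[where N="{0}"])
    show "{y \<in> space lborel. (\<integral>\<^sup>+s. F y * ennreal (norm y ^ n) * (ennreal (1 / s ^ Suc n) * indicator {norm y<..} s) \<partial>lborel) \<noteq> ennreal (1 / n) * F y} \<subseteq> {0}"
    proof (clarsimp, rule ccontr)
      fix y :: 'a
      assume ne: "(\<integral>\<^sup>+s. F y * ennreal (norm y ^ n) * (ennreal (1 / (s * s ^ n)) * indicator {norm y<..} s) \<partial>lborel) \<noteq> ennreal (1 / n) * F y" and "y \<noteq> 0"
      then have y: "norm y > 0" by simp
      have "(\<integral>\<^sup>+s. F y * ennreal (norm y ^ n) * (ennreal (1 / s ^ Suc n) * indicator {norm y<..} s) \<partial>lborel) = F y * ennreal (norm y ^ n) * ennreal (1 / (real n * norm y ^ n))"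
        by (subst nn_integral_cmult) (simp, simp only: nn_integral_power_tail[OF y n])
      also have "\<dots> = F y * (ennreal (norm y ^ n) * ennreal (1 / (real n * norm y ^ n)))" by (simp add: mult.assoc)
      also have "ennreal (norm y ^ n) * ennreal (1 / (real n * norm y ^ n)) = ennreal (1 / n)"
        using y n by (simp add: ennreal_mult[symmetric])
      finally show False using ne by (simp add: mult.commute)
    qed
  qed auto
  also have "ennreal n * (\<integral>\<^sup>+y. ennreal (1 / n) * F y \<partial>lborel) = (\<integral>\<^sup>+y. F y \<partial>lborel)"
    using n by (simp add: nn_integral_cmult mult.assoc[symmetric] ennreal_mult[symmetric])
  finally show ?thesis unfolding n_def .
qed

section \<open>Invariance under orthogonal maps and coordinate identifications\<close>

lemma distr_lborel_orthogonal:
  fixes T :: "real^'n::{finite,wellorder} \<Rightarrow> real^'n::_"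
  assumes T: "orthogonal_transformation T"
  shows "distr lborel borel T = lborel"
proof (rule lborel_eqI[symmetric])
  have lin: "linear T" using T by (simp add: orthogonal_transformation_linear)
  have [measurable]: "T \<in> borel \<rightarrow>\<^sub>M borel"
    using lin by (intro borel_measurable_continuous_onI linear_continuous_on) (simp add: linear_conv_bounded_linear)
  obtain S where S: "orthogonal_transformation S" "\<And>x. S (T x) = x" "\<And>x. T (S x) = x"
    using orthogonal_transformation_inv[OF T] orthogonal_transformation_bij[OF T]
    by (metis bij_inv_eq_iff)
  fix l u :: "real^'n::_" assume le: "\<And>b. b \<in> Basis \<Longrightarrow> l \<bullet> b \<le> u \<bullet> b"
  have eq: "T -` box l u = S ` box l u" using S by (auto simp: image_iff) metis+
  have "box l u \<in> lmeasurable" by simp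
  from measurable_orthogonal_image[OF S(1) this] measure_orthogonal_image[OF S(1) this]
  have *: "T -` box l u \<in> lmeasurable" "measure lebesgue (T -` box l u) = measure lebesgue (box l u)"
    unfolding eq by auto
  have "T -` box l u \<in> sets borel" using measurable_sets[of T borel borel "box l u"] by simp
  then have "emeasure lborel (T -` box l u) = emeasure lebesgue (T -` box l u)" by simp
  also have "\<dots> = emeasure lebesgue (box l u)"
    using * by (metis \<open>box l u \<in> lmeasurable\<close> emeasure_eq_measure2)
  also have "\<dots> = emeasure lborel (box l u)" by simp
  finally show "emeasure (distr lborel borel T) (box l u) = (\<Prod>b\<in>Basis. (u - l) \<bullet> b)"
    using le by (simp add: emeasure_distr emeasure_lborel_box)
qed simp

lemma nn_integral_sphere_orthogonal:
  fixes T :: "real^'n::{finite,wellorder} \<Rightarrow> real^'n::_" and g :: "real^'n::_ \<Rightarrow> ennreal"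
  assumes T: "orthogonal_transformation T" and [measurable]: "g \<in> borel_measurable borel"
  shows "(\<integral>\<^sup>+x. g (T x) \<partial>sphere_measure) = (\<integral>\<^sup>+x. g x \<partial>sphere_measure)"
proof -
  have lin: "linear T" using T by (simp add: orthogonal_transformation_linear)
  have [measurable]: "T \<in> borel \<rightarrow>\<^sub>M borel"
    using lin by (intro borel_measurable_continuous_onI linear_continuous_on) (simp add: linear_conv_bounded_linear)
  have nT: "norm (T x) = norm x" for x using T by (simp add: orthogonal_transformation_norm)
  then have T0: "T x = 0 \<longleftrightarrow> x = 0" for x by (metis norm_eq_zero)
  let ?u = "\<lambda>x::real^'n::_. indicator (ball 0 1 - {0}) x * g (x /\<^sub>R norm x)"
  have "(\<integral>\<^sup>+x. ?u x \<partial>lborel) = (\<integral>\<^sup>+x. ?u (T x) \<partial>lborel)"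
    by (subst distr_lborel_orthogonal[OF T, symmetric], subst nn_integral_distr) auto
  also have "\<dots> = (\<integral>\<^sup>+x. indicator (ball 0 1 - {0}) x * g (T (x /\<^sub>R norm x)) \<partial>lborel)"
    by (intro nn_integral_cong) (auto simp: indicator_def nT T0 linear_cmul[OF lin])
  finally show ?thesis by (simp add: nn_integral_sphere_measure)
qed

text \<open>Serves to identify product types, where Fubini applies, with the indexed vector spaces
  R^3 and R^4. Since T maps the basis onto the basis, preimages of boxes are boxes.\<close>

lemma distr_lborel_Basis:
  fixes T :: "'a::euclidean_space \<Rightarrow> 'b::euclidean_space"
  assumes lin: "linear T" and inner: "\<And>x y. T x \<bullet> T y = x \<bullet> y" and B: "T ` Basis \<subseteq> Basis" and D: "DIM('a) = DIM('b)"
  shows "distr lborel borel T = lborel"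
proof (rule lborel_eqI[symmetric])
  have [measurable]: "T \<in> borel \<rightarrow>\<^sub>M borel"
    using lin by (intro borel_measurable_continuous_onI linear_continuous_on) (simp add: linear_conv_bounded_linear)
  have inj: "inj_on T Basis"
    by (rule inj_onI) (metis inner inner_Basis zero_neq_one)
  have TB: "T ` Basis = Basis"
    by (rule card_subset_eq) (use B D inj in \<open>auto simp: card_image\<close>)
  fix l u :: 'b assume le: "\<And>b. b \<in> Basis \<Longrightarrow> l \<bullet> b \<le> u \<bullet> b"
  define L U where "L = (\<Sum>b\<in>Basis. (l \<bullet> T b) *\<^sub>R b)" and "U = (\<Sum>b\<in>Basis. (u \<bullet> T b) *\<^sub>R b)"
  have LU: "L \<bullet> b = l \<bullet> T b" "U \<bullet> b = u \<bullet> T b" if "b \<in> Basis" for b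
    using that by (auto simp: L_def U_def)
  have "T -` box l u = box L U"
  proof (rule set_eqI)
    fix x
    have "x \<in> T -` box l u \<longleftrightarrow> (\<forall>b\<in>T ` Basis. l \<bullet> b < T x \<bullet> b \<and> T x \<bullet> b < u \<bullet> b)"
      unfolding TB by (simp add: box_def)
    also have "\<dots> \<longleftrightarrow> x \<in> box L U" by (simp add: box_def LU inner)
    finally show "x \<in> T -` box l u \<longleftrightarrow> x \<in> box L U" .
  qed
  moreover have "emeasure lborel (box L U) = (\<Prod>b\<in>Basis. (U - L) \<bullet> b)"
    using le B LU by (intro emeasure_lborel_box) auto
  moreover have "(\<Prod>b\<in>Basis. (U - L) \<bullet> b) = (\<Prod>b\<in>Basis. (u - l) \<bullet> T b)"
    by (rule prod.cong) (auto simp: LU inner_diff_left)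
  moreover have "\<dots> = (\<Prod>b\<in>Basis. (u - l) \<bullet> b)"
    using prod.reindex[OF inj, of "\<lambda>b. (u - l) \<bullet> b"] by (simp add: TB)
  ultimately show "emeasure (distr lborel borel T) (box l u) = (\<Prod>b\<in>Basis. (u - l) \<bullet> b)"
    by (simp add: emeasure_distr)
qed simp

section \<open>Quaternions and the hat-box theorem\<close>

lemma measurable_linear_borel:
  fixes T :: "'a::euclidean_space \<Rightarrow> 'b::euclidean_space"
  assumes "linear T" shows "T \<in> borel \<rightarrow>\<^sub>M borel"
  using assms by (intro borel_measurable_continuous_onI linear_continuous_on) (simp add: linear_conv_bounded_linear)

definition triple :: "real \<times> real \<times> real \<Rightarrow> real^3" where
  "triple p = (\<chi> i. if i = 1 then fst p else if i = 2 then fst (snd p) else snd (snd p))"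

lemma triple_nth [simp]: "triple p $ 1 = fst p" "triple p $ 2 = fst (snd p)" "triple p $ 3 = snd (snd p)"
  by (simp_all add: triple_def)

lemma linear_triple: "linear triple"
  by (rule linearI) (auto simp: vec_eq_iff forall_3)

lemma inner_triple: "triple p \<bullet> triple q = p \<bullet> q"
  by (simp add: inner_vec_def sum_3 inner_prod_def)

lemma distr_lborel_triple: "distr lborel borel triple = lborel"
proof (rule distr_lborel_Basis[OF linear_triple inner_triple])
  have "triple (1, 0, 0) = axis 1 1" "triple (0, 1, 0) = axis 2 1" "triple (0, 0, 1) = axis 3 1"
    by (auto simp: vec_eq_iff forall_3 axis_def)
  then show "triple ` Basis \<subseteq> Basis"
    by (auto simp: Basis_prod_def Basis_vec_def zero_prod_def)
qed simp

text \<open>The pair keeps real and imaginary part apart, so that Fubini can integrate over them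
  separately.\<close>

definition quat :: "real \<times> (real^3) \<Rightarrow> real^4" where
  "quat p = (\<chi> i. if i = 1 then fst p else if i = 2 then snd p $ 1 else if i = 3 then snd p $ 2 else snd p $ 3)"

lemma quat_nth [simp]: "quat p $ 1 = fst p" "quat p $ 2 = snd p $ 1" "quat p $ 3 = snd p $ 2" "quat p $ 4 = snd p $ 3"
  by (simp_all add: quat_def)

lemma linear_quat: "linear quat"
  by (rule linearI) (auto simp: vec_eq_iff forall_4)

lemma inner_quat: "quat p \<bullet> quat q = p \<bullet> q"
  by (simp add: inner_vec_def sum_4 sum_3 inner_prod_def)

lemma norm_quat: "norm (quat p) = norm p"
  by (simp add: norm_eq_sqrt_inner inner_quat)

lemma quat_surj: "\<exists>p. q = quat p"
proof -
  have "q = quat (q $ 1, \<chi> i. if i = 1 then q $ 2 else if i = 2 then q $ 3 else q $ 4)"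
    by (simp add: vec_eq_iff forall_4)
  then show ?thesis by blast
qed

lemma distr_lborel_quat: "distr lborel borel quat = lborel"
proof (rule distr_lborel_Basis[OF linear_quat inner_quat])
  have "quat (1, 0) = axis 1 1" "quat (0, axis 1 1) = axis 2 1" "quat (0, axis 2 1) = axis 3 1" "quat (0, axis 3 1) = axis 4 1"
    by (auto simp: vec_eq_iff forall_4 axis_def)
  then show "quat ` Basis \<subseteq> Basis"
    by (auto simp: Basis_prod_def Basis_vec_def) (metis exhaust_3)
qed simp

text \<open>R^4 is reached as R x R^3 with R^3 = R x R x R, so the product rule is used three
  times.\<close>

lemma prekopa_leindler_real4: "prekopa_leindler TYPE(real^4)"
  by (intro prekopa_leindler_linear_image[OF _ linear_quat distr_lborel_quat] prekopa_leindler_prod prekopa_leindler_real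
      prekopa_leindler_linear_image[OF _ linear_triple distr_lborel_triple])

text \<open>The Hamilton product, with the real part in coordinate 1.\<close>

definition qmul :: "real^4 \<Rightarrow> real^4 \<Rightarrow> real^4" (infixl "\<odot>" 70) where
  "p \<odot> q = quat (p$1 * q$1 - p$2 * q$2 - p$3 * q$3 - p$4 * q$4,
     triple (p$1 * q$2 + p$2 * q$1 + p$3 * q$4 - p$4 * q$3,
       p$1 * q$3 - p$2 * q$4 + p$3 * q$1 + p$4 * q$2,
       p$1 * q$4 + p$2 * q$3 - p$3 * q$2 + p$4 * q$1))"

definition qcnj :: "real^4 \<Rightarrow> real^4" where
  "qcnj p = quat (p$1, triple (- p$2, - p$3, - p$4))"

definition imq :: "real^3 \<Rightarrow> real^4" where "imq v = quat (0, v)"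

lemma qmul_assoc: "(p \<odot> q) \<odot> r = p \<odot> (q \<odot> r)"
  by (simp add: qmul_def vec_eq_iff forall_4 algebra_simps)

text \<open>Rests on Euler's four-square identity.\<close>

lemma norm_qmul: "norm (p \<odot> q) = norm p * norm q"
proof -
  have "(p \<odot> q) \<bullet> (p \<odot> q) = (p \<bullet> p) * (q \<bullet> q)"
    by (simp add: qmul_def inner_vec_def sum_4) algebra
  then show ?thesis by (simp add: norm_eq_sqrt_inner real_sqrt_mult)
qed

lemma linear_qmul_left: "linear (\<lambda>p. p \<odot> q)"
  by (rule linearI) (auto simp: qmul_def vec_eq_iff forall_4 algebra_simps)

lemma linear_qmul_right: "linear (\<lambda>q. p \<odot> q)"
  by (rule linearI) (auto simp: qmul_def vec_eq_iff forall_4 algebra_simps)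

lemma continuous_on_qmul [continuous_intros]:
  assumes "continuous_on S f" "continuous_on S g"
  shows "continuous_on S (\<lambda>x. f x \<odot> g x)"
proof -
  have "continuous_on S (\<lambda>x. \<chi> i. (f x \<odot> g x) $ i)"
  proof (rule continuous_on_vec_lambda)
    show "continuous_on S (\<lambda>x. (f x \<odot> g x) $ i)" for i
      using exhaust_4[of i] by (elim disjE; simp add: qmul_def; intro continuous_intros assms)
  qed
  then show ?thesis by simp
qed

lemma measurable_qmul [measurable]:
  assumes [measurable]: "f \<in> borel_measurable M" "g \<in> borel_measurable M"
  shows "(\<lambda>x. f x \<odot> g x) \<in> borel_measurable M"
proof -
  have "continuous_on UNIV (\<lambda>p :: (real^4) \<times> (real^4). fst p \<odot> snd p)" by (intro continuous_intros)
  from borel_measurable_continuous_onI[OF this]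
  have [measurable]: "(\<lambda>p :: (real^4) \<times> (real^4). fst p \<odot> snd p) \<in> borel \<rightarrow>\<^sub>M borel" .
  have "(\<lambda>x. (f x, g x)) \<in> M \<rightarrow>\<^sub>M borel" by measurable
  then have "(\<lambda>x. fst (f x, g x) \<odot> snd (f x, g x)) \<in> borel_measurable M" by measurable
  then show ?thesis by simp
qed

lemma linear_imq: "linear imq"
  by (rule linearI) (auto simp: imq_def vec_eq_iff forall_4)

lemma measurable_imq [measurable]: "imq \<in> borel \<rightarrow>\<^sub>M borel"
  by (rule measurable_linear_borel[OF linear_imq])

lemma norm_imq [simp]: "norm (imq v) = norm v"
  by (simp add: imq_def norm_quat norm_Pair)

lemma norm_qcnj [simp]: "norm (qcnj q) = norm q"
  by (simp add: norm_eq_sqrt_inner qcnj_def inner_vec_def sum_4)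

text \<open>Left multiplication by an imaginary quaternion is skew-symmetric.\<close>

lemma inner_qmul_imq_orthogonal: "(imq y \<odot> x) \<bullet> x = 0"
  by (simp add: qmul_def imq_def inner_vec_def sum_4) algebra

text \<open>These identities carry the substitution of \<zeta> for \<xi>; conjugation inverts a unit
  quaternion. The second one holds because right multiplication by a unit t is an isometry and the
  real part of \<open>qcnj p \<odot> q\<close> is p \<bullet> q.\<close>

lemma qmul_qcnj_cancel: "norm p = 1 \<Longrightarrow> p \<odot> (qcnj p \<odot> q) = q"
  and inner_qmul_qcnj: "norm t = 1 \<Longrightarrow> t \<bullet> (qcnj p \<odot> q \<odot> t) = p \<bullet> q"
proof -
  assume "norm p = 1"
  then have *: "p \<bullet> p = 1" by (simp add: norm_eq_1)
  have "p \<odot> (qcnj p \<odot> q) = (p \<bullet> p) *\<^sub>R q"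
    by (simp add: qmul_def qcnj_def inner_vec_def sum_4 vec_eq_iff forall_4 algebra_simps)
  with * show "p \<odot> (qcnj p \<odot> q) = q" by simp
next
  assume "norm t = 1"
  then have *: "t \<bullet> t = 1" by (simp add: norm_eq_1)
  have "t \<bullet> (qcnj p \<odot> q \<odot> t) = (t \<bullet> t) * (p \<bullet> q)"
    by (simp add: qmul_def qcnj_def inner_vec_def sum_4) algebra
  with * show "t \<bullet> (qcnj p \<odot> q \<odot> t) = p \<bullet> q" by simp
qed

lemma inner_imq_quat: "imq v \<bullet> quat (a, w) = v \<bullet> w"
  by (simp add: imq_def inner_quat)

text \<open>Slicing perpendicular to the first axis turns the region \<open>\<bar>x\<^sub>1\<bar> \<le> k \<parallel>x\<parallel>\<close> of the unit ball into annuli whose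
  area at height \<open>s\<close> is that of the slice of the ball at height \<open>s / k\<close>.\<close>
lemma emeasure_double_cone_ball:
  fixes k :: real
  assumes k: "0 < k" "k < 1"
  shows "emeasure lborel {x :: real^3. norm x < 1 \<and> \<bar>x $ 1\<bar> \<le> k * norm x} = ennreal k * emeasure lborel (ball 0 1 :: (real^3) set)"
proof -
  let ?\<omega> = "unit_ball_vol 2"
  have slice: "emeasure lborel {x :: real^3. P (x $ 1) (norm x)} =
     (\<integral>\<^sup>+s. emeasure lborel {y :: real \<times> real. P s (sqrt (s\<^sup>2 + (norm y)\<^sup>2))} \<partial>lborel)"
    if [measurable]: "{x :: real^3. P (x $ 1) (norm x)} \<in> sets borel" for P
  proof -
    have [measurable]: "triple \<in> borel \<rightarrow>\<^sub>M borel" by (rule measurable_linear_borel[OF linear_triple])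
    have nt: "norm (triple (s, y)) = sqrt (s\<^sup>2 + (norm y)\<^sup>2)" for s y
      by (simp add: norm_eq_sqrt_inner inner_triple) (simp add: power2_eq_square norm_prod_def)
    have "emeasure lborel {x :: real^3. P (x $ 1) (norm x)} = (\<integral>\<^sup>+x. indicator {x :: real^3. P (x $ 1) (norm x)} x \<partial>lborel)"
      by simp
    also have "\<dots> = (\<integral>\<^sup>+p. indicator {x :: real^3. P (x $ 1) (norm x)} (triple p) \<partial>lborel)"
      by (subst distr_lborel_triple[symmetric], subst nn_integral_distr) auto
    also have "\<dots> = (\<integral>\<^sup>+s. \<integral>\<^sup>+y. indicator {x :: real^3. P (x $ 1) (norm x)} (triple (s, y)) \<partial>lborel \<partial>lborel)"
      by (rule nn_integral_lborel_pair) measurable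
    also have "\<dots> = (\<integral>\<^sup>+s. emeasure lborel {y :: real \<times> real. P s (sqrt (s\<^sup>2 + (norm y)\<^sup>2))} \<partial>lborel)"
    proof (rule nn_integral_cong)
      fix s :: real
      have "{x :: real^3. P (x $ 1) (norm x)} \<in> sets borel" by fact
      then have "(\<lambda>y. triple (s, y)) -` {x :: real^3. P (x $ 1) (norm x)} \<inter> space borel \<in> sets borel"
        by (rule measurable_sets[rotated]) measurable
      then have [measurable]: "{y :: real \<times> real. P s (sqrt (s\<^sup>2 + (norm y)\<^sup>2))} \<in> sets borel"
        by (simp add: vimage_def nt)
      have "(\<integral>\<^sup>+y. indicator {x :: real^3. P (x $ 1) (norm x)} (triple (s, y)) \<partial>lborel)
        = (\<integral>\<^sup>+y. indicator {y :: real \<times> real. P s (sqrt (s\<^sup>2 + (norm y)\<^sup>2))} y \<partial>lborel)"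
        by (intro nn_integral_cong) (simp add: indicator_def nt)
      then show "(\<integral>\<^sup>+y. indicator {x :: real^3. P (x $ 1) (norm x)} (triple (s, y)) \<partial>lborel)
        = emeasure lborel {y :: real \<times> real. P s (sqrt (s\<^sup>2 + (norm y)\<^sup>2))}" by simp
    qed
    finally show ?thesis .
  qed
  let ?A = "\<lambda>t::real. ennreal (?\<omega> * max 0 (1 - t\<^sup>2))"
  have [measurable]: "(\<lambda>x::real^3. x $ 1) \<in> borel_measurable borel"
    by (intro borel_measurable_continuous_onI continuous_intros)
  have ball: "emeasure lborel (ball 0 1 :: (real^3) set) = (\<integral>\<^sup>+t. ?A t \<partial>lborel)"
  proof -
    have "emeasure lborel (ball 0 1 :: (real^3) set) = emeasure lborel {x :: real^3. norm x < 1}"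
      by (rule arg_cong[where f="emeasure lborel"]) auto
    also have "\<dots> = (\<integral>\<^sup>+s. emeasure lborel {y :: real \<times> real. sqrt (s\<^sup>2 + (norm y)\<^sup>2) < 1} \<partial>lborel)"
      by (rule slice) simp
    also have "\<dots> = (\<integral>\<^sup>+t. ?A t \<partial>lborel)"
    proof (rule nn_integral_cong)
      fix s :: real
      have "{y :: real \<times> real. sqrt (s\<^sup>2 + (norm y)\<^sup>2) < 1} = ball 0 (sqrt (max 0 (1 - s\<^sup>2)))"
      proof -
        have "sqrt (s\<^sup>2 + n\<^sup>2) < 1 \<longleftrightarrow> n < sqrt (max 0 (1 - s\<^sup>2))" if "n \<ge> 0" for n
        proof -
          have "n < sqrt (max 0 (1 - s\<^sup>2)) \<longleftrightarrow> sqrt (n\<^sup>2) < sqrt (max 0 (1 - s\<^sup>2))" using that by simp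
          also have "\<dots> \<longleftrightarrow> n\<^sup>2 < max 0 (1 - s\<^sup>2)" by (rule real_sqrt_less_iff)
          also have "\<dots> \<longleftrightarrow> s\<^sup>2 + n\<^sup>2 < 1" using zero_le_power2[of n] unfolding max_def by (split if_split) linarith
          finally show ?thesis by simp
        qed
        from this[OF norm_ge_zero] show ?thesis
          by (intro set_eqI) (simp only: mem_Collect_eq mem_ball_0)
      qed
      then show "emeasure lborel {y :: real \<times> real. sqrt (s\<^sup>2 + (norm y)\<^sup>2) < 1} = ?A s"
        by (simp add: emeasure_ball)
    qed
    finally show ?thesis .
  qed
  have "emeasure lborel {x :: real^3. norm x < 1 \<and> \<bar>x $ 1\<bar> \<le> k * norm x} =
    (\<integral>\<^sup>+s. emeasure lborel {y :: real \<times> real. sqrt (s\<^sup>2 + (norm y)\<^sup>2) < 1 \<and> \<bar>s\<bar> \<le> k * sqrt (s\<^sup>2 + (norm y)\<^sup>2)} \<partial>lborel)"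
    by (rule slice[where P="\<lambda>a b. b < 1 \<and> \<bar>a\<bar> \<le> k * b"]) measurable
  also have "\<dots> = (\<integral>\<^sup>+s. ?A (s / k) \<partial>lborel)"
  proof (rule nn_integral_cong)
    fix s :: real
    \<comment> \<open>For |s| < k the slice at height s is the annulus r <= norm y < R: the cone
      gives r^2 = s^2 / k^2 - s^2, the ball gives R^2 = 1 - s^2, and the area is proportional to R^2
      - r^2 = 1 - (s / k)^2. For other s the slice is empty.\<close>
    define r where "r = \<bar>s\<bar> * sqrt (1 - k\<^sup>2) / k"
    define R where "R = sqrt (max 0 (1 - s\<^sup>2))"
    have k2: "k\<^sup>2 < 1" using k by (simp add: power_less_one_iff)
    have r: "r \<ge> 0" "r\<^sup>2 = s\<^sup>2 / k\<^sup>2 - s\<^sup>2"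
      using k k2 by (auto simp: r_def power_mult_distrib power_divide field_simps)
    have iff1: "sqrt (s\<^sup>2 + n\<^sup>2) < 1 \<longleftrightarrow> s\<^sup>2 + n\<^sup>2 < 1" for n by simp
    have iff2: "\<bar>s\<bar> \<le> k * sqrt (s\<^sup>2 + n\<^sup>2) \<longleftrightarrow> r \<le> n" if "n \<ge> 0" for n
    proof -
      have "\<bar>s\<bar> \<le> k * sqrt (s\<^sup>2 + n\<^sup>2) \<longleftrightarrow> \<bar>s\<bar>\<^sup>2 \<le> (k * sqrt (s\<^sup>2 + n\<^sup>2))\<^sup>2"
        using k by (simp add: abs_le_square_iff[symmetric] abs_mult)
      also have "\<dots> \<longleftrightarrow> s\<^sup>2 \<le> k\<^sup>2 * (s\<^sup>2 + n\<^sup>2)" by (simp add: power_mult_distrib)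
      also have "\<dots> \<longleftrightarrow> r\<^sup>2 \<le> n\<^sup>2" using k by (simp add: r field_simps)
      also have "\<dots> \<longleftrightarrow> r \<le> n" using that r(1) by (simp add: power_mono_iff)
      finally show ?thesis .
    qed
    have eq: "{y :: real \<times> real. sqrt (s\<^sup>2 + (norm y)\<^sup>2) < 1 \<and> \<bar>s\<bar> \<le> k * sqrt (s\<^sup>2 + (norm y)\<^sup>2)}
      = {y. s\<^sup>2 + (norm y)\<^sup>2 < 1 \<and> r \<le> norm y}" by (simp add: iff2)
    show "emeasure lborel {y :: real \<times> real. sqrt (s\<^sup>2 + (norm y)\<^sup>2) < 1 \<and> \<bar>s\<bar> \<le> k * sqrt (s\<^sup>2 + (norm y)\<^sup>2)} = ?A (s / k)"
    proof (cases "\<bar>s\<bar> < k")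
      case True
      have s1: "s\<^sup>2 < 1" using True k by (simp add: abs_square_less_1)
      have sk: "(s / k)\<^sup>2 < 1" using True k by (simp add: abs_square_less_1)
      have rR: "r\<^sup>2 < R\<^sup>2" using sk s1 r by (simp add: R_def power_divide)
      have R: "R \<ge> 0" "R\<^sup>2 = 1 - s\<^sup>2" using s1 by (auto simp: R_def)
      have rR': "r < R" using rR R(1) by (rule power_less_imp_less_base)
      have *: "s\<^sup>2 + n\<^sup>2 < 1 \<longleftrightarrow> n < R" if "n \<ge> 0" for n
      proof -
        have "s\<^sup>2 + n\<^sup>2 < 1 \<longleftrightarrow> n\<^sup>2 < R\<^sup>2" by (auto simp: R)
        also have "\<dots> \<longleftrightarrow> n < R" using that R(1) by (metis abs_of_nonneg abs_square_less_1 linorder_not_less power2_le_iff_abs_le power_mono)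
        finally show ?thesis .
      qed
      have "{y :: real \<times> real. s\<^sup>2 + (norm y)\<^sup>2 < 1 \<and> r \<le> norm y} = ball 0 R - ball 0 r"
        by (auto simp: *)
      moreover have "emeasure lborel (ball 0 R - ball (0 :: real \<times> real) r) = ennreal (?\<omega> * R\<^sup>2) - ennreal (?\<omega> * r\<^sup>2)"
        using rR' R r by (subst emeasure_Diff) (auto simp: emeasure_ball power2_eq_square)
      moreover have "\<dots> = ennreal (?\<omega> * R\<^sup>2 - ?\<omega> * r\<^sup>2)"
        by (rule ennreal_minus) simp
      moreover have "?\<omega> * R\<^sup>2 - ?\<omega> * r\<^sup>2 = ?\<omega> * max 0 (1 - (s / k)\<^sup>2)"
        using sk by (simp add: R r power_divide algebra_simps)
      ultimately show ?thesis unfolding eq by simp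
    next
      case False
      have empty: "{y :: real \<times> real. s\<^sup>2 + (norm y)\<^sup>2 < 1 \<and> r \<le> norm y} = {}"
      proof (safe, simp)
        fix a b :: real assume 1: "s\<^sup>2 + (norm (a, b))\<^sup>2 < 1" "r \<le> norm (a, b)"
        have "r\<^sup>2 \<le> (norm (a, b))\<^sup>2" using 1 r by (intro power_mono) auto
        with 1 r have "(s / k)\<^sup>2 < 1" by (simp add: power_divide)
        then show False using False k by (simp add: abs_square_less_1)
      qed
      have "(s / k)\<^sup>2 \<ge> 1" using False k by (simp add: abs_square_less_1 flip: not_less)
      then show ?thesis unfolding eq empty by simp
    qed
  qed
  also have "\<dots> = ennreal \<bar>k\<bar> * (\<integral>\<^sup>+t. ?A ((0 + k * t) / k) \<partial>lborel)"
    using k by (intro nn_integral_real_affine) auto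
  also have "\<dots> = ennreal k * emeasure lborel (ball 0 1 :: (real^3) set)"
    using k by (simp add: ball)
  finally show ?thesis .
qed

text \<open>A rotation moves v onto the first axis, and radial projection pulls the slab of the
  sphere back to the double cone in the ball, so the area is proportional to c. Once c reaches
  \<open>norm v\<close> the slab contains the whole sphere, whence the minimum with 1.\<close>

lemma archimedes_hat_box:
  fixes v :: "real^3"
  assumes v: "v \<noteq> 0" and c: "c > 0"
  shows "emeasure sphere_measure {x. \<bar>x \<bullet> v\<bar> \<le> c} = ennreal (min 1 (c / norm v)) * emeasure (sphere_measure :: (real^3) measure) UNIV"
proof -
  obtain T where T: "orthogonal_transformation T" "T v = norm v *\<^sub>R (axis 1 1 :: real^3)"
  proof -
    have "norm v = norm (norm v *\<^sub>R axis 1 1 :: real^3)" by simp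
    from this obtain f where "orthogonal_transformation f" "f v = norm v *\<^sub>R (axis 1 1 :: real^3)"
      by (rule orthogonal_transformation_exists)
    then show thesis by (rule that)
  qed
  define k where "k = c / norm v"
  have k: "k > 0" using v c by (simp add: k_def)
  have [measurable]: "(\<lambda>x::real^3. x $ 1) \<in> borel_measurable borel"
    by (intro borel_measurable_continuous_onI continuous_intros)
  have iff: "\<bar>x \<bullet> v\<bar> \<le> c \<longleftrightarrow> \<bar>T x $ 1\<bar> \<le> k" for x
  proof -
    have "x \<bullet> v = T x \<bullet> T v" using T(1) unfolding orthogonal_transformation_def by metis
    also have "\<dots> = norm v * T x $ 1" by (simp add: T inner_axis)
    finally show ?thesis using v by (simp add: k_def field_simps abs_mult)
  qed
  have "emeasure sphere_measure {x. \<bar>x \<bullet> v\<bar> \<le> c} = (\<integral>\<^sup>+x. indicator {x. \<bar>x \<bullet> v\<bar> \<le> c} x \<partial>sphere_measure)"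
    by (subst nn_integral_indicator) auto
  also have "\<dots> = (\<integral>\<^sup>+x. indicator {x. \<bar>x $ 1\<bar> \<le> k} (T x) \<partial>sphere_measure)"
    by (simp add: indicator_def iff)
  also have "\<dots> = (\<integral>\<^sup>+x. indicator {x. \<bar>x $ 1\<bar> \<le> k} (x :: real^3) \<partial>sphere_measure)"
    by (rule nn_integral_sphere_orthogonal[OF T(1)]) measurable
  also have "\<dots> = emeasure sphere_measure {x :: real^3. \<bar>x $ 1\<bar> \<le> k}" by simp
  also have "\<dots> = ennreal (min 1 k) * emeasure (sphere_measure :: (real^3) measure) UNIV"
  proof (cases "k < 1")
    case False
    have "emeasure sphere_measure {x :: real^3. \<bar>x $ 1\<bar> \<le> k} = emeasure (sphere_measure :: (real^3) measure) UNIV"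
    proof (rule emeasure_eq_AE)
      show "AE x in (sphere_measure :: (real^3) measure). (x \<in> {x. \<bar>x $ 1\<bar> \<le> k}) = (x \<in> UNIV)"
        using AE_sphere_measure
      proof eventually_elim
        fix x :: "real^3" assume "norm x = 1"
        then show "(x \<in> {x. \<bar>x $ 1\<bar> \<le> k}) = (x \<in> UNIV)" using component_le_norm_cart[of x 1] False by simp
      qed
    qed auto
    with False show ?thesis by (simp add: min_def)
  next
    case True
    have "emeasure sphere_measure {x :: real^3. \<bar>x $ 1\<bar> \<le> k} = (\<integral>\<^sup>+x. indicator {x :: real^3. \<bar>x $ 1\<bar> \<le> k} x \<partial>sphere_measure)" by simp
    also have "\<dots> = ennreal 3 * (\<integral>\<^sup>+x. indicator (ball 0 1 - {0}) x * indicator {x :: real^3. \<bar>x $ 1\<bar> \<le> k} (x /\<^sub>R norm x) \<partial>lborel)"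
      by (subst nn_integral_sphere_measure) auto
    also have "(\<integral>\<^sup>+x. indicator (ball 0 1 - {0}) x * indicator {x :: real^3. \<bar>x $ 1\<bar> \<le> k} (x /\<^sub>R norm x) \<partial>lborel)
      = (\<integral>\<^sup>+x. indicator {x :: real^3. norm x < 1 \<and> \<bar>x $ 1\<bar> \<le> k * norm x} x \<partial>lborel)"
    proof (rule nn_integral_cong_AE, rule AE_I[where N="{0}"])
      show "{x \<in> space lborel. \<not> indicator (ball 0 1 - {0}) x * indicator {x :: real^3. \<bar>x $ 1\<bar> \<le> k} (x /\<^sub>R norm x) = (indicator {x :: real^3. norm x < 1 \<and> \<bar>x $ 1\<bar> \<le> k * norm x} x :: ennreal)} \<subseteq> {0}"
      proof
        fix x :: "real^3"
        assume *: "x \<in> {x \<in> space lborel. \<not> indicator (ball 0 1 - {0}) x * indicator {x :: real^3. \<bar>x $ 1\<bar> \<le> k} (x /\<^sub>R norm x) = (indicator {x :: real^3. norm x < 1 \<and> \<bar>x $ 1\<bar> \<le> k * norm x} x :: ennreal)}"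
        show "x \<in> {0}"
        proof (rule ccontr)
          assume "x \<notin> {0}"
          then have "norm x > 0" by simp
          then have "\<bar>(x /\<^sub>R norm x) $ 1\<bar> \<le> k \<longleftrightarrow> \<bar>x $ 1\<bar> \<le> k * norm x"
            by (simp add: abs_mult divide_inverse_commute[symmetric] pos_divide_le_eq)
          with * \<open>norm x > 0\<close> show False by (auto simp: indicator_def)
        qed
      qed
    qed auto
    also have "\<dots> = emeasure lborel {x :: real^3. norm x < 1 \<and> \<bar>x $ 1\<bar> \<le> k * norm x}"
      by (subst nn_integral_indicator) auto
    also have "\<dots> = ennreal k * emeasure lborel (ball 0 1 :: (real^3) set)"
      by (rule emeasure_double_cone_ball[OF k True])
    finally show ?thesis using True by (simp add: emeasure_sphere_measure_UNIV min_def ac_simps)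
  qed
  finally show ?thesis unfolding k_def .
qed

section \<open>Radial functions of symmetric convex bodies\<close>

text \<open>A ball around an interior point x reflects to a ball around -x, and by convexity the
  averages of the two fill a ball of the same radius around 0.\<close>

lemma convex_body_ball:
  fixes K :: "'a::euclidean_space set"
  assumes "convex_body K" "origin_symmetric K"
  obtains r where "r > 0" "ball 0 r \<subseteq> K"
proof -
  have K: "convex K" "interior K \<noteq> {}" "uminus ` K = K"
    using assms by (auto simp: convex_body_def origin_symmetric_def)
  obtain x where x: "x \<in> interior K" using K by blast
  then obtain r where r: "r > 0" "ball x r \<subseteq> K" by (meson mem_interior)
  have "y \<in> K" if "y \<in> ball 0 r" for y
  proof -
    have "x + y \<in> K" using r that by (auto simp: dist_norm)
    moreover have "x - y \<in> K" using r that by (auto simp: dist_norm)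
    then have "- (x - y) \<in> K" using K by blast
    ultimately have "(1/2) *\<^sub>R (x + y) + (1/2) *\<^sub>R (- (x - y)) \<in> K" by (intro convexD[OF K(1)]) auto
    moreover have "(1/2) *\<^sub>R (x + y) + (1/2) *\<^sub>R (- (x - y)) = y"
      by (simp add: scaleR_add_right scaleR_diff_right scaleR_add_left[symmetric])
    ultimately show ?thesis by simp
  qed
  with r show thesis by (intro that[of r]) auto
qed

text \<open>The radii r and M are parameters because they serve as explicit constants: the radial
  function lies between r / 2 and M on the unit sphere.\<close>

locale symmetric_convex_body =
  fixes K :: "'a::euclidean_space set" and r M :: real
  assumes convex_body: "convex_body K" and sym: "origin_symmetric K"
    and r: "r > 0" "ball 0 r \<subseteq> K" and M: "\<And>x. x \<in> K \<Longrightarrow> norm x \<le> M"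
begin

lemma convex: "convex K" and compact: "compact K"
  using convex_body by (auto simp: convex_body_def)

lemma zero_in: "0 \<in> K" using r by auto

lemma uminus_in: "- x \<in> K \<longleftrightarrow> x \<in> K"
  using sym unfolding origin_symmetric_def by (metis (no_types) image_iff minus_minus)

lemma borel [measurable]: "K \<in> sets borel" using compact by (simp add: borel_compact)

lemma scale_down: "x \<in> K \<Longrightarrow> 0 \<le> t \<Longrightarrow> t \<le> 1 \<Longrightarrow> t *\<^sub>R x \<in> K"
  using convexD[OF convex, of x 0 t "1 - t"] zero_in by auto

lemma ray_bdd_above:
  assumes "norm x = 1" shows "bdd_above {a. a > 0 \<and> a *\<^sub>R x \<in> K}"
  using M assms by (intro bdd_aboveI[of _ M]) force

lemma radial_fun_ge:
  assumes "norm x = 1" "a > 0" "a *\<^sub>R x \<in> K" shows "a \<le> radial_fun K x"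
  unfolding radial_fun_def using assms by (intro cSup_upper ray_bdd_above) auto

text \<open>Half of r is taken because the inscribed ball is open.\<close>

lemma radial_fun_ge_r:
  assumes "norm x = 1" shows "radial_fun K x \<ge> r / 2"
  using r assms by (intro radial_fun_ge) auto

lemma radial_fun_pos: "norm x = 1 \<Longrightarrow> radial_fun K x > 0"
  using radial_fun_ge_r[of x] r by linarith

lemma radial_fun_le:
  assumes "norm x = 1" shows "radial_fun K x \<le> M"
  unfolding radial_fun_def
proof (rule cSup_least)
  have "(r/2) *\<^sub>R x \<in> K" using r assms by auto
  then show "{a. a > 0 \<and> a *\<^sub>R x \<in> K} \<noteq> {}" using r by (auto intro!: exI[of _ "r/2"])
qed (use M assms in force)

lemma scaleR_in:
  assumes "norm x = 1" "0 \<le> a" "a < radial_fun K x" shows "a *\<^sub>R x \<in> K"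
proof -
  have "{a. a > 0 \<and> a *\<^sub>R x \<in> K} \<noteq> {}"
    using r assms(1) by (auto intro!: exI[of _ "r/2"])
  then obtain b where b: "b > 0" "b *\<^sub>R x \<in> K" "a < b"
    using less_cSupE[of a "{a. a > 0 \<and> a *\<^sub>R x \<in> K}"] assms(3) unfolding radial_fun_def by auto
  then have "(a / b) *\<^sub>R (b *\<^sub>R x) \<in> K" using assms by (intro scale_down[of "b *\<^sub>R x" "a / b"]) auto
  with b show ?thesis by simp
qed

lemma scaleR_notin: "norm x = 1 \<Longrightarrow> a > radial_fun K x \<Longrightarrow> a *\<^sub>R x \<notin> K"
  using radial_fun_ge[of x a] radial_fun_pos[of x] by force

text \<open>A point b x slightly further out still lies in K; shrinking it towards the interior
  point 0 lands in the interior.\<close>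

lemma scaleR_interior:
  assumes x: "norm x = 1" and a: "0 \<le> a" "a < radial_fun K x" shows "a *\<^sub>R x \<in> interior K"
proof -
  obtain b where b: "a < b" "b < radial_fun K x" using dense a by blast
  have bK: "b *\<^sub>R x \<in> K" using x a b by (intro scaleR_in) auto
  have "0 \<in> interior K" using r by (meson mem_interior)
  then have "b *\<^sub>R x - ((b - a) / b) *\<^sub>R (b *\<^sub>R x - 0) \<in> interior K"
    using a b bK by (intro mem_interior_convex_shrink[OF convex]) auto
  then show ?thesis using a b by (simp add: scaleR_left_diff_distrib[symmetric])
qed

text \<open>Lower semicontinuity: for 0 < c < \<open>radial_fun K x\<close> the point c x is
  interior and stays in K when x moves a little. Upper semicontinuity: beyond the radius the points
  lie in the open complement of K.\<close>

lemma continuous_on_radial_fun: "continuous_on (sphere 0 1) (radial_fun K)"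
  unfolding continuous_on_def
proof (intro ballI order_tendstoI)
  fix x :: 'a and a assume "x \<in> sphere 0 1" and a: "a < radial_fun K x"
  then have x: "norm x = 1" by simp
  \<comment> \<open>The level a may be negative, while the scale c has to be positive.\<close>
  obtain c where c: "max a 0 < c" "c < radial_fun K x"
    using dense[of "max a 0" "radial_fun K x"] a radial_fun_pos[OF x] by auto
  have "c *\<^sub>R x \<in> interior K" using c by (intro scaleR_interior x) auto
  moreover have "((\<lambda>y. c *\<^sub>R y) \<longlongrightarrow> c *\<^sub>R x) (at x within sphere 0 1)" by (intro tendsto_intros)
  ultimately have "\<forall>\<^sub>F y in at x within sphere 0 1. c *\<^sub>R y \<in> interior K"
    by (intro topological_tendstoD) auto
  moreover have "\<forall>\<^sub>F y in at x within sphere 0 1. y \<in> sphere 0 1"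
    by (simp add: eventually_at_filter)
  ultimately show "\<forall>\<^sub>F y in at x within sphere 0 1. a < radial_fun K y"
  proof eventually_elim
    fix y assume "c *\<^sub>R y \<in> interior K" "y \<in> sphere 0 1"
    then have "c \<le> radial_fun K y" using c interior_subset by (intro radial_fun_ge) auto
    then show "a < radial_fun K y" using c by simp
  qed
next
  fix x :: 'a and a assume "x \<in> sphere 0 1" and a: "radial_fun K x < a"
  then have x: "norm x = 1" by simp
  obtain c where c: "radial_fun K x < c" "c < a" using dense[OF a] by auto
  have "c *\<^sub>R x \<in> - K" using scaleR_notin[OF x c(1)] by simp
  moreover have "((\<lambda>y. c *\<^sub>R y) \<longlongrightarrow> c *\<^sub>R x) (at x within sphere 0 1)" by (intro tendsto_intros)
  moreover have "open (- K)" using compact by (simp add: compact_imp_closed open_Compl)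
  ultimately have "\<forall>\<^sub>F y in at x within sphere 0 1. c *\<^sub>R y \<in> - K"
    by (intro topological_tendstoD) auto
  moreover have "\<forall>\<^sub>F y in at x within sphere 0 1. y \<in> sphere 0 1"
    by (simp add: eventually_at_filter)
  ultimately show "\<forall>\<^sub>F y in at x within sphere 0 1. radial_fun K y < a"
  proof eventually_elim
    fix y assume y: "c *\<^sub>R y \<in> - K" "y \<in> sphere 0 1"
    then have "\<not> c < radial_fun K y" using scaleR_in[of y c] c radial_fun_pos[OF x] by auto
    then show "radial_fun K y < a" using c by simp
  qed
qed

lemma radial_fun_uminus: "radial_fun K (- x) = radial_fun K x"
  unfolding radial_fun_def by (simp add: uminus_in)

lemma star_body: "star_body K"
  unfolding star_body_def
proof (intro conjI ballI compact zero_in continuous_on_radial_fun)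
  show "closed_segment 0 x \<subseteq> K" if "x \<in> K" for x
    by (rule closed_segment_subset[OF zero_in that convex])
  show "radial_fun K \<theta> > 0" if "\<theta> \<in> sphere 0 1" for \<theta>
    using that by (intro radial_fun_pos) auto
qed

end

section \<open>The Radon transform of slab volumes\<close>

lemma nn_integral_swap:
  assumes "sigma_finite_measure M" "sigma_finite_measure N"
    and "case_prod f \<in> borel_measurable (M \<Otimes>\<^sub>M N)"
  shows "(\<integral>\<^sup>+x. \<integral>\<^sup>+y. f x y \<partial>N \<partial>M) = (\<integral>\<^sup>+y. \<integral>\<^sup>+x. f x y \<partial>M \<partial>N)"
proof -
  interpret M: sigma_finite_measure M by fact
  interpret N: sigma_finite_measure N by fact
  interpret P: pair_sigma_finite M N ..
  show ?thesis using P.Fubini'[OF assms(3)] by simp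
qed

lemmas sphere_swap = nn_integral_swap[OF sphere.sigma_finite_measure_axioms sphere.sigma_finite_measure_axioms]
lemmas sphere_lborel_swap = nn_integral_swap[OF sphere.sigma_finite_measure_axioms lborel.sigma_finite_measure_axioms]

text \<open>At unit \<xi> this is the Radon transform, for extended-valued f. The map \<eta> |->
  \<eta> \<xi> onto the orthogonal hyperplane replaces an arbitrarily chosen isometry and depends
  algebraically on \<xi>, which makes the substitution below possible.\<close>

definition nn_radon :: "(real^4 \<Rightarrow> ennreal) \<Rightarrow> real^4 \<Rightarrow> ennreal" where
  "nn_radon f \<xi> = (\<integral>\<^sup>+\<eta>. f (imq \<eta> \<odot> \<xi>) \<partial>sphere_measure)"

lemma measurable_nn_radon [measurable]:
  assumes [measurable]: "f \<in> borel_measurable borel"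
  shows "nn_radon f \<in> borel_measurable borel"
  unfolding nn_radon_def by measurable

text \<open>For unit quaternions the substitution \<open>\<xi> = \<eta>\<^sup>-\<^sup>1 \<zeta> \<theta>\<close> turns \<open>\<theta> \<bullet> \<xi>\<close> into \<open>\<eta> \<bullet> \<zeta>\<close> and \<open>\<eta> \<xi>\<close> into \<open>\<zeta> \<theta>\<close>.\<close>
lemma nn_integral_nn_radon:
  fixes f :: "real^4 \<Rightarrow> ennreal" and W :: "real \<Rightarrow> ennreal" and K :: "(real^4) set"
  assumes [measurable]: "f \<in> borel_measurable borel" "W \<in> borel_measurable borel" "K \<in> sets borel"
  shows "(\<integral>\<^sup>+\<xi>. (\<integral>\<^sup>+x. indicator K x * W (x \<bullet> \<xi>) \<partial>lborel) * nn_radon f \<xi> \<partial>sphere_measure) =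
    (\<integral>\<^sup>+\<theta>. \<integral>\<^sup>+q. indicator K (norm q *\<^sub>R \<theta>) * f ((q /\<^sub>R norm q) \<odot> \<theta>) *
      (\<integral>\<^sup>+\<eta>. W (imq \<eta> \<bullet> q) \<partial>sphere_measure) \<partial>lborel \<partial>sphere_measure)"
proof -
  \<comment> \<open>The integrand with x = r \<theta> in polar coordinates; \<open>H'\<close> is its
    form after the substitution.\<close>
  define H where "H \<xi> \<eta> \<theta> = (\<integral>\<^sup>+r\<in>{0<..}. ennreal (r ^ 3) * (indicator K (r *\<^sub>R \<theta>) * W ((r *\<^sub>R \<theta>) \<bullet> \<xi>) * f (imq \<eta> \<odot> \<xi>)) \<partial>lborel)"
    for \<xi> \<theta> :: "real^4" and \<eta> :: "real^3"
  have H[measurable]: "(\<lambda>x. H (a x) (b x) (c x)) \<in> borel_measurable M"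
    if [measurable]: "a \<in> borel_measurable M" "b \<in> borel_measurable M" "c \<in> borel_measurable M" for M :: "'z measure" and a b c
    unfolding H_def by measurable
  define H' where "H' \<zeta> \<eta> \<theta> = (\<integral>\<^sup>+r\<in>{0<..}. ennreal (r ^ 3) * (indicator K (r *\<^sub>R \<theta>) * W (imq \<eta> \<bullet> (r *\<^sub>R \<zeta>)) * f (\<zeta> \<odot> \<theta>)) \<partial>lborel)"
    for \<zeta> \<theta> :: "real^4" and \<eta> :: "real^3"
  have H'[measurable]: "(\<lambda>x. H' (a x) (b x) (c x)) \<in> borel_measurable M"
    if [measurable]: "a \<in> borel_measurable M" "b \<in> borel_measurable M" "c \<in> borel_measurable M" for M :: "'z measure" and a b c
    unfolding H'_def by measurable
  have "(\<integral>\<^sup>+\<xi>. (\<integral>\<^sup>+x. indicator K x * W (x \<bullet> \<xi>) \<partial>lborel) * nn_radon f \<xi> \<partial>sphere_measure)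
    = (\<integral>\<^sup>+\<xi>. \<integral>\<^sup>+\<eta>. \<integral>\<^sup>+\<theta>. H \<xi> \<eta> \<theta> \<partial>sphere_measure \<partial>sphere_measure \<partial>sphere_measure)"
  proof (rule nn_integral_cong)
    fix \<xi> :: "real^4"
    have "(\<integral>\<^sup>+x. indicator K x * W (x \<bullet> \<xi>) \<partial>lborel) * nn_radon f \<xi> =
      (\<integral>\<^sup>+\<eta>. (\<integral>\<^sup>+x. indicator K x * W (x \<bullet> \<xi>) \<partial>lborel) * f (imq \<eta> \<odot> \<xi>) \<partial>sphere_measure)"
      unfolding nn_radon_def by (rule nn_integral_cmult[symmetric]) measurable
    also have "\<dots> = (\<integral>\<^sup>+\<eta>. \<integral>\<^sup>+\<theta>. H \<xi> \<eta> \<theta> \<partial>sphere_measure \<partial>sphere_measure)"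
    proof (rule nn_integral_cong)
      fix \<eta> :: "real^3"
      have "(\<integral>\<^sup>+x. indicator K x * W (x \<bullet> \<xi>) \<partial>lborel) * f (imq \<eta> \<odot> \<xi>)
        = (\<integral>\<^sup>+x. indicator K x * W (x \<bullet> \<xi>) * f (imq \<eta> \<odot> \<xi>) \<partial>lborel)"
        by (rule nn_integral_multc[symmetric]) measurable
      also have "\<dots> = (\<integral>\<^sup>+\<theta>. H \<xi> \<eta> \<theta> \<partial>sphere_measure)"
        unfolding H_def by (subst nn_integral_polar[symmetric]) simp_all
      finally show "(\<integral>\<^sup>+x. indicator K x * W (x \<bullet> \<xi>) \<partial>lborel) * f (imq \<eta> \<odot> \<xi>) = (\<integral>\<^sup>+\<theta>. H \<xi> \<eta> \<theta> \<partial>sphere_measure)" .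
    qed
    finally show "(\<integral>\<^sup>+x. indicator K x * W (x \<bullet> \<xi>) \<partial>lborel) * nn_radon f \<xi> =
      (\<integral>\<^sup>+\<eta>. \<integral>\<^sup>+\<theta>. H \<xi> \<eta> \<theta> \<partial>sphere_measure \<partial>sphere_measure)" .
  qed
  also have "\<dots> = (\<integral>\<^sup>+\<eta>. \<integral>\<^sup>+\<xi>. \<integral>\<^sup>+\<theta>. H \<xi> \<eta> \<theta> \<partial>sphere_measure \<partial>sphere_measure \<partial>sphere_measure)"
    by (rule sphere_swap) measurable
  also have "\<dots> = (\<integral>\<^sup>+\<eta>. \<integral>\<^sup>+\<theta>. \<integral>\<^sup>+\<xi>. H \<xi> \<eta> \<theta> \<partial>sphere_measure \<partial>sphere_measure \<partial>sphere_measure)"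
    by (intro nn_integral_cong sphere_swap) measurable
  \<comment> \<open>The quaternion identities ask for unit \<eta> and \<theta>, hence equality only
    almost everywhere; for such \<eta> and \<theta> the substitution is an orthogonal map of
    R^4.\<close>
  also have "\<dots> = (\<integral>\<^sup>+\<eta>. \<integral>\<^sup>+\<theta>. \<integral>\<^sup>+\<zeta>. H' \<zeta> \<eta> \<theta> \<partial>sphere_measure \<partial>sphere_measure \<partial>sphere_measure)"
  proof (rule nn_integral_cong_AE)
    show "AE \<eta> in sphere_measure. (\<integral>\<^sup>+\<theta>. \<integral>\<^sup>+\<xi>. H \<xi> \<eta> \<theta> \<partial>sphere_measure \<partial>sphere_measure)
      = (\<integral>\<^sup>+\<theta>. \<integral>\<^sup>+\<zeta>. H' \<zeta> \<eta> \<theta> \<partial>sphere_measure \<partial>sphere_measure)"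
      using AE_sphere_measure
    proof eventually_elim
      fix \<eta> :: "real^3" assume \<eta>: "norm \<eta> = 1"
      show "(\<integral>\<^sup>+\<theta>. \<integral>\<^sup>+\<xi>. H \<xi> \<eta> \<theta> \<partial>sphere_measure \<partial>sphere_measure)
        = (\<integral>\<^sup>+\<theta>. \<integral>\<^sup>+\<zeta>. H' \<zeta> \<eta> \<theta> \<partial>sphere_measure \<partial>sphere_measure)"
      proof (rule nn_integral_cong_AE)
        show "AE \<theta> in sphere_measure. (\<integral>\<^sup>+\<xi>. H \<xi> \<eta> \<theta> \<partial>sphere_measure) = (\<integral>\<^sup>+\<zeta>. H' \<zeta> \<eta> \<theta> \<partial>sphere_measure)"
          using AE_sphere_measure
        proof eventually_elim
          fix \<theta> :: "real^4" assume \<theta>: "norm \<theta> = 1"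
          have T: "orthogonal_transformation (\<lambda>\<zeta>. qcnj (imq \<eta>) \<odot> \<zeta> \<odot> \<theta>)"
            unfolding orthogonal_transformation
            using linear_compose[OF linear_qmul_right[of "qcnj (imq \<eta>)"] linear_qmul_left[of \<theta>]] \<eta> \<theta>
            by (simp add: o_def norm_qmul)
          have "(\<integral>\<^sup>+\<xi>. H \<xi> \<eta> \<theta> \<partial>sphere_measure) = (\<integral>\<^sup>+\<zeta>. H (qcnj (imq \<eta>) \<odot> \<zeta> \<odot> \<theta>) \<eta> \<theta> \<partial>sphere_measure)"
            by (rule nn_integral_sphere_orthogonal[OF T, symmetric]) measurable
          also have "\<dots> = (\<integral>\<^sup>+\<zeta>. H' \<zeta> \<eta> \<theta> \<partial>sphere_measure)"
          proof (rule nn_integral_cong)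
            fix \<zeta>
            have "imq \<eta> \<odot> (qcnj (imq \<eta>) \<odot> \<zeta> \<odot> \<theta>) = \<zeta> \<odot> \<theta>"
              using \<eta> by (simp add: qmul_assoc qmul_qcnj_cancel)
            with \<theta> show "H (qcnj (imq \<eta>) \<odot> \<zeta> \<odot> \<theta>) \<eta> \<theta> = H' \<zeta> \<eta> \<theta>"
              by (simp add: H_def H'_def inner_qmul_qcnj)
          qed
          finally show "(\<integral>\<^sup>+\<xi>. H \<xi> \<eta> \<theta> \<partial>sphere_measure) = (\<integral>\<^sup>+\<zeta>. H' \<zeta> \<eta> \<theta> \<partial>sphere_measure)" .
        qed
      qed
    qed
  qed
  also have "\<dots> = (\<integral>\<^sup>+\<theta>. \<integral>\<^sup>+\<eta>. \<integral>\<^sup>+\<zeta>. H' \<zeta> \<eta> \<theta> \<partial>sphere_measure \<partial>sphere_measure \<partial>sphere_measure)"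
    by (rule sphere_swap) measurable
  also have "\<dots> = (\<integral>\<^sup>+\<theta>. \<integral>\<^sup>+\<zeta>. \<integral>\<^sup>+\<eta>. H' \<zeta> \<eta> \<theta> \<partial>sphere_measure \<partial>sphere_measure \<partial>sphere_measure)"
    by (intro nn_integral_cong sphere_swap) measurable
  \<comment> \<open>Polar coordinates are now read backwards: r \<zeta> becomes the quaternion q of
    norm r, while \<theta> stays fixed.\<close>
  also have "\<dots> = (\<integral>\<^sup>+\<theta>. \<integral>\<^sup>+q. indicator K (norm q *\<^sub>R \<theta>) * f ((q /\<^sub>R norm q) \<odot> \<theta>) *
      (\<integral>\<^sup>+\<eta>. W (imq \<eta> \<bullet> q) \<partial>sphere_measure) \<partial>lborel \<partial>sphere_measure)"
  proof (rule nn_integral_cong)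
    fix \<theta> :: "real^4"
    let ?\<Phi> = "\<lambda>q. indicator K (norm q *\<^sub>R \<theta>) * f ((q /\<^sub>R norm q) \<odot> \<theta>) * (\<integral>\<^sup>+\<eta>. W (imq \<eta> \<bullet> q) \<partial>sphere_measure)"
    have "(\<integral>\<^sup>+\<zeta>. \<integral>\<^sup>+\<eta>. H' \<zeta> \<eta> \<theta> \<partial>sphere_measure \<partial>sphere_measure) =
      (\<integral>\<^sup>+\<zeta>. (\<integral>\<^sup>+r\<in>{0<..}. ennreal (r ^ 3) * ?\<Phi> (r *\<^sub>R \<zeta>) \<partial>lborel) \<partial>sphere_measure)"
    proof (rule nn_integral_cong_AE)
      show "AE \<zeta> in sphere_measure. (\<integral>\<^sup>+\<eta>. H' \<zeta> \<eta> \<theta> \<partial>sphere_measure) = (\<integral>\<^sup>+r\<in>{0<..}. ennreal (r ^ 3) * ?\<Phi> (r *\<^sub>R \<zeta>) \<partial>lborel)"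
        using AE_sphere_measure
      proof eventually_elim
        fix \<zeta> :: "real^4" assume \<zeta>: "norm \<zeta> = 1"
        have "(\<integral>\<^sup>+\<eta>. H' \<zeta> \<eta> \<theta> \<partial>sphere_measure) =
          (\<integral>\<^sup>+r. \<integral>\<^sup>+\<eta>. ennreal (r ^ 3) * (indicator K (r *\<^sub>R \<theta>) * W (imq \<eta> \<bullet> (r *\<^sub>R \<zeta>)) * f (\<zeta> \<odot> \<theta>)) * indicator {0<..} r \<partial>sphere_measure \<partial>lborel)"
          unfolding H'_def by (rule sphere_lborel_swap) measurable
        also have "\<dots> = (\<integral>\<^sup>+r\<in>{0<..}. ennreal (r ^ 3) * ?\<Phi> (r *\<^sub>R \<zeta>) \<partial>lborel)"
        proof (rule nn_integral_cong)
          fix r :: real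
          have "(\<integral>\<^sup>+\<eta>. ennreal (r ^ 3) * (indicator K (r *\<^sub>R \<theta>) * W (imq \<eta> \<bullet> (r *\<^sub>R \<zeta>)) * f (\<zeta> \<odot> \<theta>)) * indicator {0<..} r \<partial>sphere_measure)
            = (\<integral>\<^sup>+\<eta>. (ennreal (r ^ 3) * indicator {0<..} r * indicator K (r *\<^sub>R \<theta>) * f (\<zeta> \<odot> \<theta>)) * W (imq \<eta> \<bullet> (r *\<^sub>R \<zeta>)) \<partial>sphere_measure)"
            by (intro nn_integral_cong) (simp add: ac_simps)
          also have "\<dots> = (ennreal (r ^ 3) * indicator {0<..} r * indicator K (r *\<^sub>R \<theta>) * f (\<zeta> \<odot> \<theta>)) * (\<integral>\<^sup>+\<eta>. W (imq \<eta> \<bullet> (r *\<^sub>R \<zeta>)) \<partial>sphere_measure)"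
            by (rule nn_integral_cmult) measurable
          also have "\<dots> = ennreal (r ^ 3) * ?\<Phi> (r *\<^sub>R \<zeta>) * indicator {0<..} r"
            using \<zeta> by (cases "r > 0") (simp_all add: ac_simps)
          finally show "(\<integral>\<^sup>+\<eta>. ennreal (r ^ 3) * (indicator K (r *\<^sub>R \<theta>) * W (imq \<eta> \<bullet> (r *\<^sub>R \<zeta>)) * f (\<zeta> \<odot> \<theta>)) * indicator {0<..} r \<partial>sphere_measure)
            = ennreal (r ^ 3) * ?\<Phi> (r *\<^sub>R \<zeta>) * indicator {0<..} r" .
        qed
        finally show "(\<integral>\<^sup>+\<eta>. H' \<zeta> \<eta> \<theta> \<partial>sphere_measure) = (\<integral>\<^sup>+r\<in>{0<..}. ennreal (r ^ 3) * ?\<Phi> (r *\<^sub>R \<zeta>) \<partial>lborel)" .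
      qed
    qed
    also have "\<dots> = (\<integral>\<^sup>+q. ?\<Phi> q \<partial>lborel)"
      by (subst nn_integral_polar[symmetric]) simp_all
    finally show "(\<integral>\<^sup>+\<zeta>. \<integral>\<^sup>+\<eta>. H' \<zeta> \<eta> \<theta> \<partial>sphere_measure \<partial>sphere_measure) = (\<integral>\<^sup>+q. ?\<Phi> q \<partial>lborel)" .
  qed
  finally show ?thesis .
qed

section \<open>The hat kernel from Archimedes' theorem\<close>

lemma fst_borel [measurable]: "fst \<in> (borel :: ('a::topological_space \<times> 'b::topological_space) measure) \<rightarrow>\<^sub>M borel"
  by (intro borel_measurable_continuous_onI continuous_intros)

lemma snd_borel [measurable]: "snd \<in> (borel :: ('a::topological_space \<times> 'b::topological_space) measure) \<rightarrow>\<^sub>M borel"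
  by (intro borel_measurable_continuous_onI continuous_intros)

lemma sphere_measure_UNIV_finite [simp]: "emeasure (sphere_measure :: 'a::euclidean_space measure) UNIV < top"
  using sphere.emeasure_finite[of "UNIV :: 'a set"] by (simp add: less_top[symmetric])

text \<open>The radial profile of the kernel: 2 on (0,1], 3 / r - 1 on [1,3] and 0 from 3 on. At r =
  0 division by zero yields the value 0, so the plateau excludes the origin.\<close>

definition hat :: "real \<Rightarrow> real" where
  "hat r = 3 * min 1 (1 / r) - min 1 (3 / r)"

lemma hat_nonneg: "r \<ge> 0 \<Longrightarrow> hat r \<ge> 0"
  by (cases "r = 0") (auto simp: hat_def min_def field_simps)

lemma hat_le_2: "r \<ge> 0 \<Longrightarrow> hat r \<le> 2"
  by (cases "r = 0") (auto simp: hat_def min_def field_simps)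

lemma hat_eq_0: "r \<ge> 3 \<Longrightarrow> hat r = 0"
  by (auto simp: hat_def min_def field_simps)

lemma hat_eq_2: "0 < r \<Longrightarrow> r \<le> 1 \<Longrightarrow> hat r = 2"
  by (auto simp: hat_def min_def field_simps)

lemma measurable_hat [measurable]: "hat \<in> borel_measurable borel"
  unfolding hat_def by measurable

definition hat_kernel :: "real^3 \<Rightarrow> ennreal" where
  "hat_kernel v = ennreal (hat (norm v)) * emeasure (sphere_measure :: (real^3) measure) UNIV"

lemma measurable_hat_kernel [measurable]: "hat_kernel \<in> borel_measurable borel"
  unfolding hat_kernel_def by measurable

lemma hat_kernel_finite: "hat_kernel v < top"
  by (simp add: hat_kernel_def ennreal_mult_less_top)

definition slab_sphere :: "real \<Rightarrow> real^3 \<Rightarrow> ennreal" where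
  "slab_sphere c v = emeasure sphere_measure {x. \<bar>x \<bullet> v\<bar> \<le> c}"

lemma slab_sphere_integral: "slab_sphere c v = (\<integral>\<^sup>+x. indicator {s. \<bar>s\<bar> \<le> c} (x \<bullet> v) \<partial>sphere_measure)"
proof -
  have "slab_sphere c v = (\<integral>\<^sup>+x. indicator {x. \<bar>x \<bullet> v\<bar> \<le> c} x \<partial>sphere_measure)"
    unfolding slab_sphere_def by (subst nn_integral_indicator) auto
  then show ?thesis by (simp add: indicator_def)
qed

lemma measurable_slab_sphere [measurable]: "slab_sphere c \<in> borel_measurable borel"
  unfolding slab_sphere_integral[abs_def] by measurable

text \<open>Up to the total area, the hat-box theorem evaluates the two slabs as
  \<open>min 1 (d / norm v)\<close> and \<open>min 1 (3 * d / norm v)\<close>. The additive form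
  avoids subtraction in \<open>ennreal\<close>.\<close>

lemma three_slab_sphere:
  assumes "v \<noteq> 0" "d > 0"
  shows "3 * slab_sphere d v = slab_sphere (3 * d) v + hat_kernel (v /\<^sub>R d)"
proof -
  let ?n = "norm v"
  have n: "?n > 0" using assms by simp
  have h: "hat (?n / d) \<ge> 0" using assms by (intro hat_nonneg) simp
  have "3 * min 1 (d / ?n) = min 1 (3 * d / ?n) + hat (?n / d)"
    by (simp add: hat_def)
  then have "ennreal (3 * min 1 (d / ?n)) = ennreal (min 1 (3 * d / ?n)) + ennreal (hat (?n / d))"
    using h n assms by (simp add: ennreal_plus[symmetric] del: ennreal_plus)
  moreover have "ennreal (3 * min 1 (d / ?n)) = 3 * ennreal (min 1 (d / ?n))"
    using n assms by (subst ennreal_mult) auto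
  moreover have "norm (v /\<^sub>R d) = ?n / d" using assms by (simp add: divide_inverse_commute)
  ultimately show ?thesis
    using assms by (simp add: slab_sphere_def archimedes_hat_box hat_kernel_def mult.assoc[symmetric] distrib_right[symmetric])
qed

definition hat_mass :: real where "hat_mass = enn2real (\<integral>\<^sup>+v. hat_kernel v \<partial>lborel)"

text \<open>Finite because the kernel is bounded and vanishes outside the ball of radius 3; positive
  because it is a positive constant on the punctured unit ball.\<close>

lemma nn_integral_hat_kernel: "(\<integral>\<^sup>+v. hat_kernel v \<partial>lborel) = ennreal hat_mass" and hat_mass_pos: "hat_mass > 0"
proof -
  let ?k = "emeasure (sphere_measure :: (real^3) measure) UNIV"
  have "(\<integral>\<^sup>+v. hat_kernel v \<partial>lborel) \<le> (\<integral>\<^sup>+v. 2 * ?k * indicator (cball 0 3 :: (real^3) set) v \<partial>lborel)"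
  proof (rule nn_integral_mono)
    show "hat_kernel v \<le> 2 * ?k * indicator (cball 0 3 :: (real^3) set) v" for v
      using hat_le_2[of "norm v"] hat_eq_0[of "norm v"]
      by (cases "norm v \<le> 3") (auto simp: hat_kernel_def intro!: mult_right_mono simp flip: ennreal_numeral)
  qed
  also have "\<dots> = 2 * ?k * emeasure lborel (cball 0 3 :: (real^3) set)"
    by (rule nn_integral_cmult_indicator) simp
  also have "\<dots> < top"
    using emeasure_lborel_cball_finite[of "0 :: real^3" 3]
    by (simp add: ennreal_mult_less_top)
  finally have fin: "(\<integral>\<^sup>+v. hat_kernel v \<partial>lborel) < top" .
  then show "(\<integral>\<^sup>+v. hat_kernel v \<partial>lborel) = ennreal hat_mass" by (simp add: hat_mass_def)
  have "0 < 2 * ?k * emeasure lborel (ball 0 1 :: (real^3) set)"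
    using emeasure_sphere_measure_pos by (auto simp: ennreal_zero_less_mult_iff emeasure_ball)
  also have "\<dots> = (\<integral>\<^sup>+v. 2 * ?k * indicator (ball 0 1 :: (real^3) set) v \<partial>lborel)"
    by (rule nn_integral_cmult_indicator[symmetric]) simp
  also have "\<dots> \<le> (\<integral>\<^sup>+v. hat_kernel v \<partial>lborel)"
  proof (rule nn_integral_mono_AE, rule AE_I[where N="{0}"])
    show "{x \<in> space lborel. \<not> 2 * ?k * indicator (ball 0 1) x \<le> hat_kernel x} \<subseteq> {0}"
    proof -
      have "hat_kernel x = 2 * ?k" if "x \<noteq> 0" "norm x < 1" for x
        using hat_eq_2[of "norm x"] that by (simp add: hat_kernel_def)
      then have "2 * ?k * indicator (ball 0 1 :: (real^3) set) x \<le> hat_kernel x" if "x \<noteq> 0" for x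
        using that by (cases "norm x < 1") auto
      then show ?thesis by auto
    qed
  qed auto
  finally show "hat_mass > 0" using fin by (simp add: hat_mass_def enn2real_positive_iff)
qed

section \<open>Slab volumes and their defects\<close>

definition slab_volume :: "(real^4) set \<Rightarrow> real \<Rightarrow> real^4 \<Rightarrow> ennreal" where
  "slab_volume K c \<xi> = (\<integral>\<^sup>+x. indicator K x * indicator {s. \<bar>s\<bar> \<le> c} (x \<bullet> \<xi>) \<partial>lborel)"

lemma measurable_slab_volume:
  assumes [measurable]: "K \<in> sets borel" shows "slab_volume K c \<in> borel_measurable borel"
  unfolding slab_volume_def by measurable

lemma slab_volume_eq:
  assumes [measurable]: "K \<in> sets borel" shows "slab_volume K c \<xi> = emeasure lborel (K \<inter> {x. \<bar>x \<bullet> \<xi>\<bar> \<le> c})"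
proof -
  have "emeasure lborel (K \<inter> {x. \<bar>x \<bullet> \<xi>\<bar> \<le> c}) = (\<integral>\<^sup>+x. indicator (K \<inter> {x. \<bar>x \<bullet> \<xi>\<bar> \<le> c}) x \<partial>lborel)"
    by (subst nn_integral_indicator) auto
  then show ?thesis by (simp add: slab_volume_def indicator_def if_distrib cong: if_cong) (auto intro!: nn_integral_cong)
qed

lemma AE_lborel_snd_nonzero: "AE p in (lborel :: ('a::euclidean_space \<times> 'b::euclidean_space) measure). snd p \<noteq> 0"
proof (rule AE_I[where N="UNIV \<times> {0}"])
  have "emeasure (lborel \<Otimes>\<^sub>M lborel) ((UNIV :: 'a set) \<times> {0 :: 'b}) = emeasure lborel (UNIV :: 'a set) * emeasure lborel {0 :: 'b}"
    by (rule lborel.emeasure_pair_measure_Times) auto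
  then show "emeasure (lborel :: ('a \<times> 'b) measure) (UNIV \<times> {0}) = 0" by (simp add: lborel_prod)
  show "UNIV \<times> {0} \<in> sets (lborel :: ('a \<times> 'b) measure)" by (simp add: closed_Times borel_closed)
qed auto

lemma AE_lborel_fst_not_in:
  assumes "finite A"
  shows "AE p in (lborel :: ('a::euclidean_space \<times> 'b::euclidean_space) measure). fst p \<notin> A"
proof (rule AE_I[where N="A \<times> UNIV"])
  have "emeasure (lborel \<Otimes>\<^sub>M lborel) (A \<times> (UNIV :: 'b set)) = emeasure lborel A * emeasure lborel (UNIV :: 'b set)"
    using assms by (intro lborel.emeasure_pair_measure_Times) (auto intro: borel_closed finite_imp_closed)
  then show "emeasure (lborel :: ('a \<times> 'b) measure) (A \<times> UNIV) = 0"
    using assms by (simp add: lborel_prod emeasure_lborel_countable countable_finite)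
  show "A \<times> UNIV \<in> sets (lborel :: ('a \<times> 'b) measure)"
    using assms by (simp add: closed_Times borel_closed finite_imp_closed)
qed auto

lemma measurable_quat [measurable]: "quat \<in> borel \<rightarrow>\<^sub>M borel"
  by (rule measurable_linear_borel[OF linear_quat])

lemma nn_integral_quat:
  assumes [measurable]: "F \<in> borel_measurable borel"
  shows "(\<integral>\<^sup>+q. F q \<partial>lborel) = (\<integral>\<^sup>+p. F (quat p) \<partial>lborel)"
  by (subst distr_lborel_quat[symmetric], subst nn_integral_distr) auto

locale symmetric_convex_body4 = symmetric_convex_body K r M for K :: "(real^4) set" and r M :: real
begin

definition polar_integrand :: "(real^4 \<Rightarrow> ennreal) \<Rightarrow> real^4 \<Rightarrow> real \<times> (real^3) \<Rightarrow> ennreal" where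
  "polar_integrand f \<theta> p = indicator K (norm (quat p) *\<^sub>R \<theta>) * f ((quat p /\<^sub>R norm (quat p)) \<odot> \<theta>)"

lemma measurable_polar_integrand [measurable (raw)]:
  assumes [measurable]: "f \<in> borel_measurable borel" "a \<in> borel_measurable N" "b \<in> borel_measurable N"
  shows "(\<lambda>x. polar_integrand f (a x) (b x)) \<in> borel_measurable N"
  unfolding polar_integrand_def by measurable

definition slab_defect :: "real \<Rightarrow> real^4 \<Rightarrow> ennreal" where
  "slab_defect d \<xi> = 3 * slab_volume K d \<xi> - slab_volume K (3 * d) \<xi>"

lemma measurable_slab_volume_K [measurable]: "slab_volume K c \<in> borel_measurable borel"
  by (rule measurable_slab_volume[OF borel])

lemma measurable_slab_defect [measurable]: "slab_defect d \<in> borel_measurable borel"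
  unfolding slab_defect_def by measurable

text \<open>The Brunn--Minkowski inequality for slabs enters here: it makes the truncated
  subtraction in \<open>slab_defect\<close> an honest difference.\<close>

lemma slab_defect_add: "slab_volume K (3 * d) \<xi> + slab_defect d \<xi> = 3 * slab_volume K d \<xi>"
proof -
  have "slab_volume K (3 * d) \<xi> \<le> 3 * slab_volume K d \<xi>"
    unfolding slab_volume_eq[OF borel]
    using emeasure_slab_le[OF prekopa_leindler_real4 convex borel] sym by (simp add: origin_symmetric_def)
  then show ?thesis by (simp add: slab_defect_def add_diff_inverse_ennreal)
qed

lemma slab_volume_finite: "slab_volume K c \<xi> \<le> emeasure lborel K" "emeasure lborel K < top"
proof -
  show "slab_volume K c \<xi> \<le> emeasure lborel K"
    unfolding slab_volume_eq[OF borel] by (intro emeasure_mono) auto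
  show "emeasure lborel K < top"
    using emeasure_compact_finite[OF compact] by (simp add: less_top)
qed

lemma slab_defect_le: "slab_defect d \<xi> \<le> 3 * emeasure lborel K"
proof -
  have "slab_defect d \<xi> \<le> 3 * slab_volume K d \<xi>"
    unfolding slab_defect_def by (rule diff_le_self_ennreal)
  also have "\<dots> \<le> 3 * emeasure lborel K" by (intro mult_left_mono slab_volume_finite) auto
  finally show ?thesis .
qed

text \<open>An imaginary \<eta> pairs only with the imaginary part of q, so the integral over \<eta>
  is the area of a slab of S^2.\<close>

lemma slab_volume_nn_radon:
  assumes [measurable]: "f \<in> borel_measurable borel"
  shows "(\<integral>\<^sup>+\<xi>. slab_volume K c \<xi> * nn_radon f \<xi> \<partial>sphere_measure) =
    (\<integral>\<^sup>+\<theta>. \<integral>\<^sup>+p. polar_integrand f \<theta> p * slab_sphere c (snd p) \<partial>lborel \<partial>sphere_measure)"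
proof -
  have "(\<integral>\<^sup>+\<xi>. slab_volume K c \<xi> * nn_radon f \<xi> \<partial>sphere_measure) =
    (\<integral>\<^sup>+\<theta>. \<integral>\<^sup>+q. indicator K (norm q *\<^sub>R \<theta>) * f ((q /\<^sub>R norm q) \<odot> \<theta>) *
      (\<integral>\<^sup>+\<eta>. indicator {s. \<bar>s\<bar> \<le> c} (imq \<eta> \<bullet> q) \<partial>sphere_measure) \<partial>lborel \<partial>sphere_measure)"
    unfolding slab_volume_def by (rule nn_integral_nn_radon) measurable
  also have "\<dots> = (\<integral>\<^sup>+\<theta>. \<integral>\<^sup>+p. polar_integrand f \<theta> p * slab_sphere c (snd p) \<partial>lborel \<partial>sphere_measure)"
  proof (rule nn_integral_cong)
    fix \<theta> :: "real^4"
    have "(\<integral>\<^sup>+q. indicator K (norm q *\<^sub>R \<theta>) * f ((q /\<^sub>R norm q) \<odot> \<theta>) *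
      (\<integral>\<^sup>+\<eta>. indicator {s. \<bar>s\<bar> \<le> c} (imq \<eta> \<bullet> q) \<partial>sphere_measure) \<partial>lborel) =
      (\<integral>\<^sup>+p. indicator K (norm (quat p) *\<^sub>R \<theta>) * f ((quat p /\<^sub>R norm (quat p)) \<odot> \<theta>) *
      (\<integral>\<^sup>+\<eta>. indicator {s. \<bar>s\<bar> \<le> c} (imq \<eta> \<bullet> quat p) \<partial>sphere_measure) \<partial>lborel)"
      by (rule nn_integral_quat) measurable
    also have "\<dots> = (\<integral>\<^sup>+p. polar_integrand f \<theta> p * slab_sphere c (snd p) \<partial>lborel)"
    proof (rule nn_integral_cong)
      fix p :: "real \<times> (real^3)"
      have "imq \<eta> \<bullet> quat p = \<eta> \<bullet> snd p" for \<eta> using inner_imq_quat[of \<eta> "fst p" "snd p"] by simp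
      then show "indicator K (norm (quat p) *\<^sub>R \<theta>) * f ((quat p /\<^sub>R norm (quat p)) \<odot> \<theta>) *
      (\<integral>\<^sup>+\<eta>. indicator {s. \<bar>s\<bar> \<le> c} (imq \<eta> \<bullet> quat p) \<partial>sphere_measure) = polar_integrand f \<theta> p * slab_sphere c (snd p)"
        by (simp add: polar_integrand_def slab_sphere_integral)
    qed
    finally show "(\<integral>\<^sup>+q. indicator K (norm q *\<^sub>R \<theta>) * f ((q /\<^sub>R norm q) \<odot> \<theta>) *
      (\<integral>\<^sup>+\<eta>. indicator {s. \<bar>s\<bar> \<le> c} (imq \<eta> \<bullet> q) \<partial>sphere_measure) \<partial>lborel) = \<dots>" .
  qed
  finally show ?thesis .
qed

text \<open>Adding the term for half-width 3 d to both sides removes the subtraction. The sums agree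
  by \<open>three_slab_sphere\<close> off the null set of real quaternions, and the added term may
  be cancelled because it is finite for bounded f.\<close>

lemma slab_defect_nn_radon:
  assumes [measurable]: "f \<in> borel_measurable borel" and B: "\<And>x. f x \<le> ennreal B" and d: "d > 0"
  shows "(\<integral>\<^sup>+\<xi>. slab_defect d \<xi> * nn_radon f \<xi> \<partial>sphere_measure) =
    (\<integral>\<^sup>+\<theta>. \<integral>\<^sup>+p. polar_integrand f \<theta> p * hat_kernel (snd p /\<^sub>R d) \<partial>lborel \<partial>sphere_measure)"
    (is "?D = ?Z")
proof -
  let ?N = "\<lambda>c. \<integral>\<^sup>+\<xi>. slab_volume K c \<xi> * nn_radon f \<xi> \<partial>sphere_measure"
  have "?N (3 * d) + ?D = (\<integral>\<^sup>+\<xi>. 3 * (slab_volume K d \<xi> * nn_radon f \<xi>) \<partial>sphere_measure)"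
    by (subst nn_integral_add[symmetric])
       (simp_all add: distrib_right[symmetric] slab_defect_add mult.assoc)
  also have "\<dots> = 3 * ?N d" by (rule nn_integral_cmult) measurable
  also have "\<dots> = (\<integral>\<^sup>+\<theta>. \<integral>\<^sup>+p. 3 * (polar_integrand f \<theta> p * slab_sphere d (snd p)) \<partial>lborel \<partial>sphere_measure)"
    by (simp add: slab_volume_nn_radon nn_integral_cmult)
  also have "\<dots> = (\<integral>\<^sup>+\<theta>. \<integral>\<^sup>+p. polar_integrand f \<theta> p * slab_sphere (3 * d) (snd p) + polar_integrand f \<theta> p * hat_kernel (snd p /\<^sub>R d) \<partial>lborel \<partial>sphere_measure)"
  proof (rule nn_integral_cong, rule nn_integral_cong_AE)
    fix \<theta> :: "real^4"
    show "AE p in lborel. 3 * (polar_integrand f \<theta> p * slab_sphere d (snd p)) =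
      polar_integrand f \<theta> p * slab_sphere (3 * d) (snd p) + polar_integrand f \<theta> p * hat_kernel (snd p /\<^sub>R d)"
      using AE_lborel_snd_nonzero
    proof eventually_elim
      fix p :: "real \<times> (real^3)" assume p: "snd p \<noteq> 0"
      have "3 * (polar_integrand f \<theta> p * slab_sphere d (snd p)) = polar_integrand f \<theta> p * (3 * slab_sphere d (snd p))"
        by (simp add: ac_simps)
      then show "3 * (polar_integrand f \<theta> p * slab_sphere d (snd p)) =
        polar_integrand f \<theta> p * slab_sphere (3 * d) (snd p) + polar_integrand f \<theta> p * hat_kernel (snd p /\<^sub>R d)"
        by (simp add: three_slab_sphere[OF p d] distrib_left)
    qed
  qed
  also have "\<dots> = ?N (3 * d) + ?Z"
    by (simp add: nn_integral_add slab_volume_nn_radon)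
  finally have eq: "?N (3 * d) + ?D = ?N (3 * d) + ?Z" .
  have "nn_radon f \<xi> \<le> ennreal B * emeasure (sphere_measure :: (real^3) measure) UNIV" for \<xi>
  proof -
    have "nn_radon f \<xi> \<le> (\<integral>\<^sup>+\<eta>. ennreal B \<partial>(sphere_measure :: (real^3) measure))"
      unfolding nn_radon_def by (intro nn_integral_mono B)
    then show ?thesis by simp
  qed
  then have "?N (3 * d) \<le> (\<integral>\<^sup>+\<xi>. emeasure lborel K * (ennreal B * emeasure (sphere_measure :: (real^3) measure) UNIV) \<partial>(sphere_measure :: (real^4) measure))"
    by (intro nn_integral_mono mult_mono slab_volume_finite) auto
  also have "\<dots> < top"
    using slab_volume_finite(2) by (simp add: ennreal_mult_less_top)
  finally show ?thesis using eq by (simp add: ennreal_add_left_cancel less_top[symmetric])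
qed

text \<open>Only the three imaginary coordinates are rescaled by d; this produces the factor d^3 and
  moves the dependence on d from the kernel into the integrand.\<close>

lemma slab_defect_nn_radon_scaled:
  assumes [measurable]: "f \<in> borel_measurable borel" and B: "\<And>x. f x \<le> ennreal B" and d: "d > 0"
  shows "(\<integral>\<^sup>+\<xi>. slab_defect d \<xi> * nn_radon f \<xi> \<partial>sphere_measure) = ennreal (d ^ 3) *
    (\<integral>\<^sup>+\<theta>. \<integral>\<^sup>+p. polar_integrand f \<theta> (fst p, d *\<^sub>R snd p) * hat_kernel (snd p) \<partial>lborel \<partial>sphere_measure)"
proof -
  have "(\<integral>\<^sup>+p. polar_integrand f \<theta> p * hat_kernel (snd p /\<^sub>R d) \<partial>lborel) =
    ennreal (d ^ 3) * (\<integral>\<^sup>+p. polar_integrand f \<theta> (fst p, d *\<^sub>R snd p) * hat_kernel (snd p) \<partial>lborel)" for \<theta>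
  proof -
    let ?G = "\<lambda>a v. polar_integrand f \<theta> (a, v) * hat_kernel (v /\<^sub>R d)"
    have "(\<integral>\<^sup>+v. ?G a v \<partial>lborel) = ennreal (d ^ 3) * (\<integral>\<^sup>+v. polar_integrand f \<theta> (a, d *\<^sub>R v) * hat_kernel v \<partial>lborel)" for a
    proof -
      have "(\<integral>\<^sup>+v. ?G a (d *\<^sub>R v) \<partial>lborel) = ennreal (1 / d ^ DIM(real^3)) * (\<integral>\<^sup>+v. ?G a v \<partial>lborel)"
        by (rule nn_integral_lborel_scale[OF _ d]) measurable
      then have "ennreal (d ^ 3) * (\<integral>\<^sup>+v. ?G a (d *\<^sub>R v) \<partial>lborel) = (ennreal (d ^ 3) * ennreal (1 / d ^ 3)) * (\<integral>\<^sup>+v. ?G a v \<partial>lborel)"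
        by (simp add: mult.assoc)
      also have "ennreal (d ^ 3) * ennreal (1 / d ^ 3) = 1" using d by (simp add: ennreal_mult[symmetric])
      finally show ?thesis using d by simp
    qed
    then have "(\<integral>\<^sup>+a. \<integral>\<^sup>+v. ?G a v \<partial>lborel \<partial>lborel) = ennreal (d ^ 3) * (\<integral>\<^sup>+a. \<integral>\<^sup>+v. polar_integrand f \<theta> (a, d *\<^sub>R v) * hat_kernel v \<partial>lborel \<partial>lborel)"
      by (simp add: nn_integral_cmult)
    then show ?thesis
      by (subst (1 2) nn_integral_lborel_pair) simp_all
  qed
  then show ?thesis
    by (simp add: slab_defect_nn_radon[OF assms] nn_integral_cmult)
qed

end

section \<open>Shrinking slabs\<close>

lemma quat_real_qmul: "quat (a, 0) \<odot> q = a *\<^sub>R q"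
  by (simp add: qmul_def vec_eq_iff forall_4)

context symmetric_convex_body4
begin

definition step :: "nat \<Rightarrow> real" where "step n = 1 / real (Suc n)"

lemma step_pos: "step n > 0" by (simp add: step_def)

lemma step_tendsto: "step \<longlonglongrightarrow> 0"
  unfolding step_def using LIMSEQ_inverse_real_of_nat by (simp add: inverse_eq_divide)

text \<open>The bound is uniform in v, hence in the scaling of the imaginary part; it confines only
  the real part, and integrability in v is left to the kernel.\<close>

lemma polar_integrand_le:
  assumes "norm \<theta> = 1" "\<And>x. f x \<le> ennreal B"
  shows "polar_integrand f \<theta> (a, v) \<le> ennreal B * indicator {-M..M} a"
proof (cases "norm (quat (a, v)) *\<^sub>R \<theta> \<in> K")
  case True
  then have "norm (a, v) \<le> M" using M[OF True] assms(1) by (simp add: norm_quat)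
  then have "\<bar>a\<bar> \<le> M" using norm_fst_le[of a v] by simp
  then show ?thesis using True assms(2) by (auto simp: polar_integrand_def abs_le_iff)
qed (simp add: polar_integrand_def)

text \<open>At a = 0 the direction q / norm q of the limit is undefined, and at |a| =
  \<open>radial_fun K \<theta>\<close> the indicator of K may jump. For all other a the indicator is
  eventually constant and the direction tends to the sign of a.\<close>

lemma polar_integrand_tendsto:
  assumes \<theta>: "norm \<theta> = 1" and f: "continuous_on UNIV f"
    and a: "a \<noteq> 0" "\<bar>a\<bar> \<noteq> radial_fun K \<theta>"
  shows "(\<lambda>n. polar_integrand (\<lambda>x. ennreal (f x)) \<theta> (a, step n *\<^sub>R v))
    \<longlonglongrightarrow> indicator K (\<bar>a\<bar> *\<^sub>R \<theta>) * ennreal (f (sgn a *\<^sub>R \<theta>))"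
proof -
  let ?q = "\<lambda>n. quat (a, step n *\<^sub>R v)"
  have q: "?q \<longlonglongrightarrow> quat (a, 0)"
  proof -
    have "(\<lambda>n. (a, step n *\<^sub>R v)) \<longlonglongrightarrow> (a, 0 *\<^sub>R v)" by (intro tendsto_intros step_tendsto)
    from tendsto_compose[OF _ this, of quat] show ?thesis
      using linear_continuous_at[OF linear_quat[unfolded linear_conv_bounded_linear], of "(a, 0)"] by (simp add: continuous_at o_def)
  qed
  have n0: "norm (quat (a, 0)) = \<bar>a\<bar>" by (simp add: norm_quat norm_Pair)
  have nq: "(\<lambda>n. norm (?q n)) \<longlonglongrightarrow> \<bar>a\<bar>" using tendsto_norm[OF q] n0 by simp
  have ev: "\<forall>\<^sub>F n in sequentially. indicator K (norm (?q n) *\<^sub>R \<theta>) = (indicator K (\<bar>a\<bar> *\<^sub>R \<theta>) :: ennreal)"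
  proof (cases "\<bar>a\<bar> < radial_fun K \<theta>")
    case True
    have "\<forall>\<^sub>F n in sequentially. norm (?q n) < radial_fun K \<theta>" by (rule order_tendstoD(2)[OF nq True])
    then show ?thesis by (rule eventually_mono) (use True \<theta> in \<open>simp add: scaleR_in\<close>)
  next
    case False
    then have gt: "radial_fun K \<theta> < \<bar>a\<bar>" using a by simp
    have "\<forall>\<^sub>F n in sequentially. norm (?q n) > radial_fun K \<theta>" by (rule order_tendstoD(1)[OF nq gt])
    then show ?thesis by (rule eventually_mono) (use gt \<theta> in \<open>simp add: scaleR_notin\<close>)
  qed
  have "(\<lambda>n. (?q n /\<^sub>R norm (?q n)) \<odot> \<theta>) \<longlonglongrightarrow> (quat (a, 0) /\<^sub>R \<bar>a\<bar>) \<odot> \<theta>"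
  proof -
    have "continuous_on UNIV (\<lambda>p. p \<odot> \<theta>)" by (intro continuous_intros)
    then have "isCont (\<lambda>p. p \<odot> \<theta>) (quat (a, 0) /\<^sub>R \<bar>a\<bar>)" by (simp add: continuous_on_eq_continuous_at)
    moreover have "(\<lambda>n. ?q n /\<^sub>R norm (?q n)) \<longlonglongrightarrow> quat (a, 0) /\<^sub>R \<bar>a\<bar>"
      using a by (intro tendsto_intros q nq) auto
    ultimately show ?thesis by (rule isCont_tendsto_compose)
  qed
  also have "(quat (a, 0) /\<^sub>R \<bar>a\<bar>) \<odot> \<theta> = sgn a *\<^sub>R \<theta>"
  proof -
    have "quat (a, 0) /\<^sub>R \<bar>a\<bar> = quat (sgn a, 0)"
      by (simp add: linear_cmul[OF linear_quat, symmetric] sgn_div_norm)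
    then show ?thesis by (simp add: quat_real_qmul)
  qed
  finally have "(\<lambda>n. f ((?q n /\<^sub>R norm (?q n)) \<odot> \<theta>)) \<longlonglongrightarrow> f (sgn a *\<^sub>R \<theta>)"
    using f by (intro isCont_tendsto_compose[of _ f]) (simp_all add: continuous_on_eq_continuous_at)
  then have "(\<lambda>n. ennreal (f ((?q n /\<^sub>R norm (?q n)) \<odot> \<theta>))) \<longlonglongrightarrow> ennreal (f (sgn a *\<^sub>R \<theta>))"
    by (rule tendsto_ennrealI)
  then have "(\<lambda>n. indicator K (\<bar>a\<bar> *\<^sub>R \<theta>) * ennreal (f ((?q n /\<^sub>R norm (?q n)) \<odot> \<theta>))) \<longlonglongrightarrow> indicator K (\<bar>a\<bar> *\<^sub>R \<theta>) * ennreal (f (sgn a *\<^sub>R \<theta>))"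
    by (rule ennreal_tendsto_cmult[rotated]) (simp add: indicator_def)
  moreover have "\<forall>\<^sub>F n in sequentially. indicator K (\<bar>a\<bar> *\<^sub>R \<theta>) * ennreal (f ((?q n /\<^sub>R norm (?q n)) \<odot> \<theta>)) = polar_integrand (\<lambda>x. ennreal (f x)) \<theta> (a, step n *\<^sub>R v)"
    using ev by eventually_elim (simp add: polar_integrand_def)
  ultimately show ?thesis by (rule Lim_transform_eventually)
qed

text \<open>Set to 0 off the sphere, since continuity of \<open>radial_fun K\<close> is established
  only there; the result is Borel on the whole space.\<close>

definition sphere_radial :: "(real^4 \<Rightarrow> real) \<Rightarrow> real^4 \<Rightarrow> real" where
  "sphere_radial f \<theta> = indicator (sphere 0 1) \<theta> *\<^sub>R (radial_fun K \<theta> * f \<theta>)"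

lemma measurable_sphere_radial [measurable]:
  assumes "continuous_on UNIV f" shows "sphere_radial f \<in> borel_measurable borel"
  unfolding sphere_radial_def using assms
  by (intro borel_measurable_continuous_on_indicator continuous_intros continuous_on_radial_fun)
     (auto intro: continuous_on_subset)

text \<open>Positive a contribute f(\<theta>) and negative a contribute f(-\<theta>), each over an
  interval of length \<open>radial_fun K \<theta>\<close>, which by symmetry is also the radius in
  direction -\<theta>.\<close>

lemma nn_integral_ray:
  assumes \<theta>: "norm \<theta> = 1" and f: "\<And>x. f x \<ge> 0"
  shows "(\<integral>\<^sup>+a. indicator K (\<bar>a\<bar> *\<^sub>R \<theta>) * ennreal (f (sgn a *\<^sub>R \<theta>)) \<partial>lborel)
    = ennreal (sphere_radial f \<theta>) + ennreal (sphere_radial f (- \<theta>))"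
proof -
  let ?\<rho> = "radial_fun K \<theta>"
  have \<rho>: "?\<rho> > 0" by (rule radial_fun_pos[OF \<theta>])
  have "(\<integral>\<^sup>+a. indicator K (\<bar>a\<bar> *\<^sub>R \<theta>) * ennreal (f (sgn a *\<^sub>R \<theta>)) \<partial>lborel)
    = (\<integral>\<^sup>+a. ennreal (f \<theta>) * indicator {0<..<?\<rho>} a + ennreal (f (- \<theta>)) * indicator {-?\<rho><..<0} a \<partial>lborel)"
  proof (rule nn_integral_cong_AE, rule AE_I[where N="{0, ?\<rho>, -?\<rho>}"])
    show "{a \<in> space lborel. \<not> indicator K (\<bar>a\<bar> *\<^sub>R \<theta>) * ennreal (f (sgn a *\<^sub>R \<theta>)) =
        ennreal (f \<theta>) * indicator {0<..<?\<rho>} a + ennreal (f (- \<theta>)) * indicator {-?\<rho><..<0} a} \<subseteq> {0, ?\<rho>, -?\<rho>}"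
    proof (intro subsetI, rule ccontr)
      fix a assume 1: "a \<in> {a \<in> space lborel. \<not> indicator K (\<bar>a\<bar> *\<^sub>R \<theta>) * ennreal (f (sgn a *\<^sub>R \<theta>)) =
        ennreal (f \<theta>) * indicator {0<..<?\<rho>} a + ennreal (f (- \<theta>)) * indicator {-?\<rho><..<0} a}"
        and "a \<notin> {0, ?\<rho>, -?\<rho>}"
      then have a: "a \<noteq> 0" "\<bar>a\<bar> \<noteq> ?\<rho>" by auto
      have "\<bar>a\<bar> *\<^sub>R \<theta> \<in> K \<longleftrightarrow> \<bar>a\<bar> < ?\<rho>"
        using scaleR_in[OF \<theta>, of "\<bar>a\<bar>"] scaleR_notin[OF \<theta>, of "\<bar>a\<bar>"] a by linarith
      then have "indicator K (\<bar>a\<bar> *\<^sub>R \<theta>) * ennreal (f (sgn a *\<^sub>R \<theta>)) =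
        ennreal (f \<theta>) * indicator {0<..<?\<rho>} a + ennreal (f (- \<theta>)) * indicator {-?\<rho><..<0} a"
        using a by (cases "a > 0") (auto simp: indicator_def)
      with 1 show False by simp
    qed
  qed (auto simp: emeasure_lborel_countable)
  also have "\<dots> = ennreal (f \<theta>) * ennreal ?\<rho> + ennreal (f (- \<theta>)) * ennreal ?\<rho>"
    using \<rho> by (subst nn_integral_add) (auto simp: nn_integral_cmult_indicator)
  also have "\<dots> = ennreal (sphere_radial f \<theta>) + ennreal (sphere_radial f (- \<theta>))"
    using f \<theta> \<rho> by (simp add: sphere_radial_def radial_fun_uminus ennreal_mult[symmetric] mult.commute)
  finally show ?thesis .
qed

text \<open>Dominated convergence is used inside over p and again outside over \<theta>. The limit
  separates into the mass of the kernel times an integral along a line, and antipodal invariance of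
  the surface measure merges the terms for \<theta> and -\<theta>; this is the origin of the
  constant \<open>2 * hat_mass\<close>.\<close>

lemma nn_radon_limit:
  assumes f: "continuous_on UNIV f" "\<And>x. 0 \<le> f x" "\<And>x. f x \<le> B"
  shows "(\<lambda>n. \<integral>\<^sup>+\<xi>. ennreal (1 / (2 * hat_mass * step n ^ 3)) * slab_defect (step n) \<xi> * nn_radon (\<lambda>x. ennreal (f x)) \<xi> \<partial>sphere_measure)
    \<longlonglongrightarrow> (\<integral>\<^sup>+\<theta>. ennreal (sphere_radial f \<theta>) \<partial>sphere_measure)"
proof -
  let ?F = "\<lambda>x. ennreal (f x)"
  have [measurable]: "f \<in> borel_measurable borel" using f(1) by (rule borel_measurable_continuous_onI)
  note measurable_sphere_radial[OF f(1), measurable]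
  have FB: "?F x \<le> ennreal B" for x using f by (intro ennreal_leI)
  \<comment> \<open>A majorant for all n at once: an interval for the real part times the integrable
    kernel for the imaginary part.\<close>
  let ?w = "\<lambda>p::real \<times> (real^3). ennreal B * indicator {-M..M} (fst p) * hat_kernel (snd p)"
  let ?G = "\<lambda>n \<theta> (p::real \<times> (real^3)). polar_integrand ?F \<theta> (fst p, step n *\<^sub>R snd p) * hat_kernel (snd p)"
  let ?u = "\<lambda>\<theta> (p::real \<times> (real^3)). indicator K (\<bar>fst p\<bar> *\<^sub>R \<theta>) * ?F (sgn (fst p) *\<^sub>R \<theta>) * hat_kernel (snd p)"
  have "(\<integral>\<^sup>+p. ?w p \<partial>lborel) = (\<integral>\<^sup>+a. \<integral>\<^sup>+v. ennreal B * indicator {-M..M} a * hat_kernel v \<partial>lborel \<partial>lborel)"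
    by (subst nn_integral_lborel_pair) auto
  also have "\<dots> = ennreal B * emeasure lborel {-M..M} * ennreal hat_mass"
    by (simp add: nn_integral_cmult nn_integral_hat_kernel nn_integral_multc nn_integral_cmult_indicator)
  also have "\<dots> < top" by (simp add: ennreal_mult_less_top emeasure_lborel_Icc_eq)
  finally have w: "(\<integral>\<^sup>+p. ?w p \<partial>lborel) < \<infinity>" by simp
  have G_le: "?G n \<theta> p \<le> ?w p" if "norm \<theta> = 1" for n \<theta> p
    using polar_integrand_le[OF that FB] by (intro mult_right_mono) auto
  have inner: "(\<lambda>n. \<integral>\<^sup>+p. ?G n \<theta> p \<partial>lborel) \<longlonglongrightarrow> (\<integral>\<^sup>+p. ?u \<theta> p \<partial>lborel)" if \<theta>: "norm \<theta> = 1" for \<theta>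
  proof (rule nn_integral_dominated_convergence[OF _ _ _ _ w])
    show "AE p in lborel. ?G n \<theta> p \<le> ?w p" for n using G_le[OF \<theta>] by simp
    have "AE p in (lborel :: (real \<times> (real^3)) measure). fst p \<notin> {0, radial_fun K \<theta>, - radial_fun K \<theta>}"
      by (rule AE_lborel_fst_not_in) simp
    then show "AE p in lborel. (\<lambda>n. ?G n \<theta> p) \<longlonglongrightarrow> ?u \<theta> p"
    proof eventually_elim
      fix p :: "real \<times> (real^3)" assume "fst p \<notin> {0, radial_fun K \<theta>, - radial_fun K \<theta>}"
      then have "fst p \<noteq> 0" "\<bar>fst p\<bar> \<noteq> radial_fun K \<theta>" by auto
      from polar_integrand_tendsto[OF \<theta> f(1) this, of "snd p"]
      have "(\<lambda>n. hat_kernel (snd p) * polar_integrand ?F \<theta> (fst p, step n *\<^sub>R snd p)) \<longlonglongrightarrow> hat_kernel (snd p) * (indicator K (\<bar>fst p\<bar> *\<^sub>R \<theta>) * ?F (sgn (fst p) *\<^sub>R \<theta>))"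
        by (rule ennreal_tendsto_cmult[OF hat_kernel_finite])
      then show "(\<lambda>n. ?G n \<theta> p) \<longlonglongrightarrow> ?u \<theta> p" by (simp add: mult.commute mult.left_commute)
    qed
  qed measurable
  have u: "(\<integral>\<^sup>+p. ?u \<theta> p \<partial>lborel) = ennreal hat_mass * (ennreal (sphere_radial f \<theta>) + ennreal (sphere_radial f (- \<theta>)))"
    if \<theta>: "norm \<theta> = 1" for \<theta>
  proof -
    have "(\<integral>\<^sup>+p. ?u \<theta> p \<partial>lborel) = (\<integral>\<^sup>+a. \<integral>\<^sup>+v. indicator K (\<bar>a\<bar> *\<^sub>R \<theta>) * ?F (sgn a *\<^sub>R \<theta>) * hat_kernel v \<partial>lborel \<partial>lborel)"
      by (subst nn_integral_lborel_pair) auto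
    also have "\<dots> = (\<integral>\<^sup>+a. indicator K (\<bar>a\<bar> *\<^sub>R \<theta>) * ?F (sgn a *\<^sub>R \<theta>) \<partial>lborel) * ennreal hat_mass"
      by (simp add: nn_integral_cmult nn_integral_hat_kernel nn_integral_multc)
    also note nn_integral_ray[OF \<theta> f(2)]
    finally show ?thesis by (simp only: mult.commute[of "ennreal hat_mass"])
  qed
  have lim: "(\<lambda>n. \<integral>\<^sup>+\<theta>. \<integral>\<^sup>+p. ?G n \<theta> p \<partial>lborel \<partial>sphere_measure) \<longlonglongrightarrow> (\<integral>\<^sup>+\<theta>. \<integral>\<^sup>+p. ?u \<theta> p \<partial>lborel \<partial>sphere_measure)"
  proof (rule nn_integral_dominated_convergence[where w="\<lambda>_. \<integral>\<^sup>+p. ?w p \<partial>lborel"])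
    show "AE \<theta> in sphere_measure. (\<integral>\<^sup>+p. ?G n \<theta> p \<partial>lborel) \<le> (\<integral>\<^sup>+p. ?w p \<partial>lborel)" for n
      using AE_sphere_measure by eventually_elim (intro nn_integral_mono G_le)
    show "AE \<theta> in sphere_measure. (\<lambda>n. \<integral>\<^sup>+p. ?G n \<theta> p \<partial>lborel) \<longlonglongrightarrow> (\<integral>\<^sup>+p. ?u \<theta> p \<partial>lborel)"
      using AE_sphere_measure by eventually_elim (rule inner)
    show "(\<integral>\<^sup>+(\<theta>::real^4). (\<integral>\<^sup>+p. ?w p \<partial>lborel) \<partial>sphere_measure) < \<infinity>"
      using w by (simp add: ennreal_mult_less_top)
  qed measurable
  have "(\<integral>\<^sup>+\<theta>. \<integral>\<^sup>+p. ?u \<theta> p \<partial>lborel \<partial>sphere_measure)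
    = (\<integral>\<^sup>+\<theta>. ennreal hat_mass * (ennreal (sphere_radial f \<theta>) + ennreal (sphere_radial f (- \<theta>))) \<partial>sphere_measure)"
    by (rule nn_integral_cong_AE) (use AE_sphere_measure in eventually_elim, rule u)
  also have "\<dots> = ennreal hat_mass * ((\<integral>\<^sup>+\<theta>. ennreal (sphere_radial f \<theta>) \<partial>sphere_measure) + (\<integral>\<^sup>+\<theta>. ennreal (sphere_radial f (- \<theta>)) \<partial>sphere_measure))"
    by (subst nn_integral_cmult, measurable) (subst nn_integral_add, measurable)
  also have "(\<integral>\<^sup>+\<theta>. ennreal (sphere_radial f (- \<theta>)) \<partial>sphere_measure) = (\<integral>\<^sup>+\<theta>. ennreal (sphere_radial f \<theta>) \<partial>sphere_measure)"
  proof (rule nn_integral_sphere_orthogonal)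
    show "orthogonal_transformation (\<lambda>x::real^4. - x)"
      unfolding orthogonal_transformation by (auto intro!: linearI)
  qed measurable
  finally have U: "(\<integral>\<^sup>+\<theta>. \<integral>\<^sup>+p. ?u \<theta> p \<partial>lborel \<partial>sphere_measure) = ennreal (2 * hat_mass) * (\<integral>\<^sup>+\<theta>. ennreal (sphere_radial f \<theta>) \<partial>sphere_measure)"
    using hat_mass_pos by (simp add: ennreal_mult mult_2[symmetric] ac_simps)
  have eq: "(\<integral>\<^sup>+\<xi>. ennreal (1 / (2 * hat_mass * step n ^ 3)) * slab_defect (step n) \<xi> * nn_radon ?F \<xi> \<partial>sphere_measure)
    = ennreal (1 / (2 * hat_mass)) * (\<integral>\<^sup>+\<theta>. \<integral>\<^sup>+p. ?G n \<theta> p \<partial>lborel \<partial>sphere_measure)" for n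
  proof -
    have "(\<integral>\<^sup>+\<xi>. ennreal (1 / (2 * hat_mass * step n ^ 3)) * slab_defect (step n) \<xi> * nn_radon ?F \<xi> \<partial>sphere_measure)
      = ennreal (1 / (2 * hat_mass * step n ^ 3)) * (\<integral>\<^sup>+\<xi>. slab_defect (step n) \<xi> * nn_radon ?F \<xi> \<partial>sphere_measure)"
      unfolding mult.assoc by (rule nn_integral_cmult) measurable
    also have "\<dots> = (ennreal (1 / (2 * hat_mass * step n ^ 3)) * ennreal (step n ^ 3)) * (\<integral>\<^sup>+\<theta>. \<integral>\<^sup>+p. ?G n \<theta> p \<partial>lborel \<partial>sphere_measure)"
      by (subst slab_defect_nn_radon_scaled[OF _ FB step_pos]) (simp_all add: mult.assoc)
    also have "ennreal (1 / (2 * hat_mass * step n ^ 3)) * ennreal (step n ^ 3) = ennreal (1 / (2 * hat_mass))"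
      using step_pos[of n] hat_mass_pos by (simp add: ennreal_mult[symmetric])
    finally show ?thesis .
  qed
  have "(\<lambda>n. ennreal (1 / (2 * hat_mass)) * (\<integral>\<^sup>+\<theta>. \<integral>\<^sup>+p. ?G n \<theta> p \<partial>lborel \<partial>sphere_measure)) \<longlonglongrightarrow>
    ennreal (1 / (2 * hat_mass)) * (ennreal (2 * hat_mass) * (\<integral>\<^sup>+\<theta>. ennreal (sphere_radial f \<theta>) \<partial>sphere_measure))"
    unfolding U[symmetric] by (rule ennreal_tendsto_cmult[OF _ lim]) simp
  also have "ennreal (1 / (2 * hat_mass)) * (ennreal (2 * hat_mass) * (\<integral>\<^sup>+\<theta>. ennreal (sphere_radial f \<theta>) \<partial>sphere_measure)) = (\<integral>\<^sup>+\<theta>. ennreal (sphere_radial f \<theta>) \<partial>sphere_measure)"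
    using hat_mass_pos by (simp add: mult.assoc[symmetric] ennreal_mult[symmetric])
  finally show ?thesis by (simp only: eq)
qed

end

section \<open>The limit measure\<close>

lemma distr_sphere_orthogonal:
  fixes T :: "real^'n::{finite,wellorder} \<Rightarrow> real^'n::_"
  assumes T: "orthogonal_transformation T"
  shows "distr sphere_measure borel T = sphere_measure"
proof (rule measure_eqI)
  have [measurable]: "T \<in> borel \<rightarrow>\<^sub>M borel"
    using T by (intro measurable_linear_borel orthogonal_transformation_linear)
  fix A assume "A \<in> sets (distr sphere_measure borel T)"
  then have [measurable]: "A \<in> sets borel" by simp
  have "emeasure (distr sphere_measure borel T) A = (\<integral>\<^sup>+x. indicator A x \<partial>distr sphere_measure borel T)" by simp
  also have "\<dots> = (\<integral>\<^sup>+x. indicator A (T x) \<partial>sphere_measure)"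
    by (rule nn_integral_distr) measurable
  also have "\<dots> = (\<integral>\<^sup>+x. indicator A x \<partial>sphere_measure)"
    by (rule nn_integral_sphere_orthogonal[OF T]) measurable
  also have "\<dots> = emeasure sphere_measure A" by simp
  finally show "emeasure (distr sphere_measure borel T) A = emeasure sphere_measure A" .
qed simp

definition radon :: "(real^4 \<Rightarrow> real) \<Rightarrow> real^4 \<Rightarrow> real" where
  "radon f \<xi> = (\<integral>\<eta>. f (imq \<eta> \<odot> \<xi>) \<partial>sphere_measure)"

lemma linear_imq_qmul: "linear (\<lambda>y. imq y \<odot> \<xi>)"
  using linear_compose[OF linear_imq linear_qmul_left[of \<xi>]] by (simp add: o_def)

text \<open>Every x equals \<open>x \<odot> qcnj \<xi> \<odot> \<xi>\<close>, and the real part of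
  \<open>x \<odot> qcnj \<xi>\<close> is x \<bullet> \<xi>; so the left factor is imaginary when x
  is orthogonal to \<xi>.\<close>

lemma range_imq_qmul:
  assumes "norm \<xi> = 1"
  shows "range (\<lambda>y. imq y \<odot> \<xi>) = {x. x \<bullet> \<xi> = 0}"
proof (intro set_eqI iffI)
  fix x assume "x \<in> {x. x \<bullet> \<xi> = 0}"
  then have x: "x \<bullet> \<xi> = 0" by simp
  obtain p where p: "x \<odot> qcnj \<xi> = quat p" using quat_surj by blast
  have "fst p = (x \<odot> qcnj \<xi>) $ 1" by (simp add: p)
  also have "\<dots> = x \<bullet> \<xi>" by (simp add: qmul_def qcnj_def inner_vec_def sum_4)
  finally have "x \<odot> qcnj \<xi> = imq (snd p)" using p x by (simp add: imq_def prod_eq_iff) (metis prod.collapse)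
  moreover have "x \<odot> qcnj \<xi> \<odot> \<xi> = (\<xi> \<bullet> \<xi>) *\<^sub>R x"
    by (simp add: qmul_def qcnj_def inner_vec_def sum_4 vec_eq_iff forall_4 algebra_simps)
  moreover have "\<xi> \<bullet> \<xi> = 1" using assms by (simp add: norm_eq_1)
  ultimately have "x = imq (snd p) \<odot> \<xi>" by simp
  then show "x \<in> range (\<lambda>y. imq y \<odot> \<xi>)" by blast
qed (auto simp: inner_qmul_imq_orthogonal)

text \<open>The isometry picked by Hilbert choice and the quaternionic one have the same range, so
  they differ by an orthogonal transformation of R^3, which preserves the surface measure.\<close>

lemma spherical_radon_eq_radon:
  assumes \<xi>: "norm \<xi> = 1" and [measurable]: "f \<in> borel_measurable borel"
  shows "spherical_radon f \<xi> = radon f \<xi>"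
proof -
  let ?P = "\<lambda>L :: real^3 \<Rightarrow> real^4. linear L \<and> (\<forall>y. norm (L y) = norm y) \<and> range L = {x. x \<bullet> \<xi> = 0}"
  let ?L0 = "\<lambda>y. imq y \<odot> \<xi>"
  define L where "L = (SOME L. ?P L)"
  have P0: "?P ?L0"
    using \<xi> by (simp only: linear_imq_qmul range_imq_qmul) (simp add: norm_qmul)
  have P: "?P L" unfolding L_def by (rule someI[of ?P, OF P0])
  have inj: "u = v" if "?L0 u = ?L0 v" for u v
  proof -
    have "?L0 (u - v) = 0" using that linear_diff[OF linear_imq_qmul, of u v] by simp
    moreover have "norm (?L0 (u - v)) = norm (u - v)" using P0 by (simp only: simp_thms)
    ultimately show ?thesis by simp
  qed
  have "\<exists>z. ?L0 z = L y" for y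
  proof -
    have "L y \<in> range ?L0" using P P0 by blast
    then obtain z where "L y = ?L0 z" by (rule imageE)
    then show ?thesis by (intro exI[of _ z]) simp
  qed
  then have "\<forall>y. \<exists>z. ?L0 z = L y" ..
  from choice[OF this] obtain U where U': "\<forall>y. ?L0 (U y) = L y" ..
  then have U: "?L0 (U y) = L y" for y ..
  have "linear U"
  proof (rule linearI)
    show "U (x + y) = U x + U y" for x y
      by (rule inj) (use P in \<open>simp add: U linear_add[OF linear_imq_qmul] linear_add\<close>)
    show "U (c *\<^sub>R x) = c *\<^sub>R U x" for c x
      by (rule inj) (use P in \<open>simp add: U linear_cmul[OF linear_imq_qmul] linear_cmul\<close>)
  qed
  moreover have "norm (U y) = norm y" for y
  proof -
    have "norm (U y) = norm (?L0 (U y))" using P0 by (simp only: simp_thms)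
    also have "\<dots> = norm y" using P by (simp only: U)
    finally show ?thesis .
  qed
  ultimately have UT: "orthogonal_transformation U" by (simp add: orthogonal_transformation)
  have [measurable]: "U \<in> borel \<rightarrow>\<^sub>M borel" by (rule measurable_linear_borel) fact
  have "spherical_radon f \<xi> = (\<integral>y. f (L y) \<partial>sphere_measure)"
    by (simp add: spherical_radon_def L_def Let_def)
  also have "\<dots> = (\<integral>y. f (imq (U y) \<odot> \<xi>) \<partial>sphere_measure)" by (simp add: U)
  also have "\<dots> = (\<integral>y. f (imq y \<odot> \<xi>) \<partial>distr sphere_measure borel U)"
    by (rule integral_distr[symmetric]) measurable
  also have "\<dots> = radon f \<xi>" by (simp add: distr_sphere_orthogonal[OF UT] radon_def)
  finally show ?thesis .
qed

lemma measure_sphere_pos: "0 < measure (sphere_measure :: 'a::euclidean_space measure) UNIV"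
  using emeasure_sphere_measure_pos[where 'a='a] by (simp add: sphere.emeasure_eq_measure)

lemma integrable_sphere_bounded:
  fixes f :: "'a::euclidean_space \<Rightarrow> real"
  assumes [measurable]: "f \<in> borel_measurable borel" and "\<And>x. norm x = 1 \<Longrightarrow> \<bar>f x\<bar> \<le> B"
  shows "integrable sphere_measure f"
proof (rule sphere.integrable_const_bound)
  show "AE x in sphere_measure. norm (f x) \<le> B"
    using AE_sphere_measure by eventually_elim (use assms in auto)
qed measurable

text \<open>Makes the Radon transform of f an admissible test function for weak convergence.\<close>

lemma continuous_on_radon:
  assumes f: "continuous_on UNIV f" and B: "\<And>x. \<bar>f x\<bar> \<le> B"
  shows "continuous_on UNIV (radon f)"
proof -
  have [measurable]: "f \<in> borel_measurable borel" using f by (rule borel_measurable_continuous_onI)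
  have "continuous (at \<xi>) (radon f)" for \<xi>
    unfolding continuous_at_sequentially
  proof (intro allI impI)
    fix x :: "nat \<Rightarrow> real^4" assume x: "x \<longlonglongrightarrow> \<xi>"
    have "(\<lambda>n. \<integral>\<eta>. f (imq \<eta> \<odot> x n) \<partial>sphere_measure) \<longlonglongrightarrow> (\<integral>\<eta>. f (imq \<eta> \<odot> \<xi>) \<partial>sphere_measure)"
    proof (rule integral_dominated_convergence[where w="\<lambda>_. B"])
      show "AE \<eta> in sphere_measure. (\<lambda>n. f (imq \<eta> \<odot> x n)) \<longlonglongrightarrow> f (imq \<eta> \<odot> \<xi>)"
      proof (rule AE_I2)
        fix \<eta> :: "real^3"
        have "continuous_on UNIV (\<lambda>\<xi>. f (imq \<eta> \<odot> \<xi>))"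
          by (rule continuous_on_compose2[OF f]) (auto intro!: continuous_intros)
        then have "isCont (\<lambda>\<xi>. f (imq \<eta> \<odot> \<xi>)) \<xi>" by (simp add: continuous_on_eq_continuous_at)
        then show "(\<lambda>n. f (imq \<eta> \<odot> x n)) \<longlonglongrightarrow> f (imq \<eta> \<odot> \<xi>)" using x by (rule isCont_tendsto_compose)
      qed
    qed (use B in auto)
    then show "(radon f \<circ> x) \<longlonglongrightarrow> radon f \<xi>" by (simp add: radon_def o_def)
  qed
  then show ?thesis by (simp add: continuous_on_eq_continuous_at)
qed

lemma nn_radon_eq_radon:
  assumes f: "f \<in> borel_measurable borel" and B: "\<And>x. 0 \<le> f x" "\<And>x. f x \<le> B"
  shows "nn_radon (\<lambda>x. ennreal (f x)) \<xi> = ennreal (radon f \<xi>)"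
proof -
  note f[measurable]
  have "integrable sphere_measure (\<lambda>\<eta>. f (imq \<eta> \<odot> \<xi>))"
    by (rule integrable_sphere_bounded[where B=B]) (simp_all add: abs_of_nonneg B)
  then show ?thesis unfolding nn_radon_def radon_def using B by (intro nn_integral_eq_integral) auto
qed

lemma radon_nonneg: "(\<And>x. 0 \<le> f x) \<Longrightarrow> 0 \<le> radon f \<xi>"
  unfolding radon_def by (intro integral_nonneg_AE) auto

section \<open>Approximating measures and the passage to the limit\<close>

context symmetric_convex_body4
begin

definition density_fun :: "nat \<Rightarrow> real^4 \<Rightarrow> ennreal" where
  "density_fun n \<xi> = ennreal (1 / (2 * hat_mass * step n ^ 3)) * slab_defect (step n) \<xi>"

lemma measurable_density_fun [measurable]: "density_fun n \<in> borel_measurable borel"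
  unfolding density_fun_def by measurable

definition approx :: "nat \<Rightarrow> (real^4) measure" where
  "approx n = density sphere_measure (density_fun n)"

lemma sets_approx [simp, measurable_cong]: "sets (approx n) = sets borel"
  by (simp add: approx_def)

lemma AE_approx: "AE x in approx n. norm x = 1"
  unfolding approx_def using AE_sphere_measure by (subst AE_density) auto

lemma emeasure_approx: "emeasure (approx n) UNIV = (\<integral>\<^sup>+\<xi>. density_fun n \<xi> \<partial>sphere_measure)"
  by (simp add: approx_def emeasure_density)

lemma emeasure_approx_finite: "emeasure (approx n) UNIV < top"
proof -
  have "emeasure (approx n) UNIV \<le> (\<integral>\<^sup>+(\<xi>::real^4). ennreal (1 / (2 * hat_mass * step n ^ 3)) * (3 * emeasure lborel K) \<partial>sphere_measure)"
    unfolding emeasure_approx density_fun_def by (intro nn_integral_mono mult_left_mono slab_defect_le) auto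
  also have "\<dots> < top"
    using slab_volume_finite(2) by (simp add: ennreal_mult_less_top)
  finally show ?thesis .
qed

lemma integrable_sphere_radial:
  assumes f: "continuous_on UNIV f" shows "integrable sphere_measure (sphere_radial f)"
proof -
  have "compact (f ` cball 0 1)" by (intro compact_continuous_image continuous_on_subset[OF f]) auto
  then obtain B where B: "\<And>x. x \<in> f ` cball 0 1 \<Longrightarrow> \<bar>x\<bar> \<le> B"
    by (metis bounded_iff compact_imp_bounded real_norm_def)
  show ?thesis
  proof (rule integrable_sphere_bounded[where B="M * B"])
    fix x :: "real^4" assume x: "norm x = 1"
    have "\<bar>radial_fun K x\<bar> * \<bar>f x\<bar> \<le> M * B"
      using radial_fun_pos[OF x] radial_fun_le[OF x] B[of "f x"] x by (intro mult_mono) auto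
    then show "\<bar>sphere_radial f x\<bar> \<le> M * B" using x by (simp add: sphere_radial_def abs_mult)
  qed (rule measurable_sphere_radial[OF f])
qed

lemma sphere_radial_nonneg: "(\<And>x. 0 \<le> f x) \<Longrightarrow> 0 \<le> sphere_radial f x"
  using radial_fun_pos[of x] by (auto simp: sphere_radial_def indicator_def)

lemma approx_limit:
  assumes f: "continuous_on UNIV f" "\<And>x. 0 \<le> f x" "\<And>x. f x \<le> B"
  shows "(\<lambda>n. \<integral>\<xi>. radon f \<xi> \<partial>approx n) \<longlonglongrightarrow> (\<integral>\<theta>. sphere_radial f \<theta> \<partial>sphere_measure)"
proof -
  have [measurable]: "f \<in> borel_measurable borel" using f(1) by (rule borel_measurable_continuous_onI)
  have "continuous_on UNIV (radon f)" using f by (intro continuous_on_radon[where B=B]) (simp_all add: abs_of_nonneg)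
  then have [measurable]: "radon f \<in> borel_measurable borel" by (rule borel_measurable_continuous_onI)
  have "(\<integral>\<xi>. radon f \<xi> \<partial>approx n) = enn2real (\<integral>\<^sup>+\<xi>. density_fun n \<xi> * nn_radon (\<lambda>x. ennreal (f x)) \<xi> \<partial>sphere_measure)" for n
  proof -
    have "(\<integral>\<xi>. radon f \<xi> \<partial>approx n) = enn2real (\<integral>\<^sup>+\<xi>. ennreal (radon f \<xi>) \<partial>approx n)"
      using radon_nonneg[OF f(2)] by (intro integral_eq_nn_integral) auto
    also have "(\<integral>\<^sup>+\<xi>. ennreal (radon f \<xi>) \<partial>approx n) = (\<integral>\<^sup>+\<xi>. density_fun n \<xi> * ennreal (radon f \<xi>) \<partial>sphere_measure)"
      unfolding approx_def by (rule nn_integral_density) measurable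
    also have "\<dots> = (\<integral>\<^sup>+\<xi>. density_fun n \<xi> * nn_radon (\<lambda>x. ennreal (f x)) \<xi> \<partial>sphere_measure)"
      using nn_radon_eq_radon[OF _ f(2,3)] by simp
    finally show ?thesis .
  qed
  moreover have "(\<lambda>n. enn2real (\<integral>\<^sup>+\<xi>. density_fun n \<xi> * nn_radon (\<lambda>x. ennreal (f x)) \<xi> \<partial>sphere_measure))
    \<longlonglongrightarrow> (\<integral>\<theta>. sphere_radial f \<theta> \<partial>sphere_measure)"
  proof (rule tendsto_enn2real)
    have "(\<integral>\<^sup>+\<theta>. ennreal (sphere_radial f \<theta>) \<partial>sphere_measure) = ennreal (\<integral>\<theta>. sphere_radial f \<theta> \<partial>sphere_measure)"
      by (intro nn_integral_eq_integral integrable_sphere_radial f(1) AE_I2 sphere_radial_nonneg f(2))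
    then show "(\<lambda>n. \<integral>\<^sup>+\<xi>. density_fun n \<xi> * nn_radon (\<lambda>x. ennreal (f x)) \<xi> \<partial>sphere_measure)
      \<longlonglongrightarrow> ennreal (\<integral>\<theta>. sphere_radial f \<theta> \<partial>sphere_measure)"
      using nn_radon_limit[OF f] unfolding density_fun_def by simp
    show "0 \<le> (\<integral>\<theta>. sphere_radial f \<theta> \<partial>sphere_measure)"
      by (intro integral_nonneg_AE AE_I2 sphere_radial_nonneg f(2))
  qed
  ultimately show ?thesis by simp
qed

text \<open>Testing with f = 1 yields the masses, as the Radon transform of 1 is the constant area
  of S^2. The limit is positive because the radial function is at least r / 2.\<close>

lemma mass_limit:
  obtains m where "m > 0" "(\<lambda>n. measure (approx n) UNIV) \<longlonglongrightarrow> m"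
proof -
  let ?k = "measure (sphere_measure :: (real^3) measure) UNIV"
  have k: "?k > 0" by (rule measure_sphere_pos)
  have "(\<lambda>n. \<integral>\<xi>. radon (\<lambda>_. 1) \<xi> \<partial>approx n) \<longlonglongrightarrow> (\<integral>\<theta>. sphere_radial (\<lambda>_. 1) \<theta> \<partial>sphere_measure)" (is "_ \<longlonglongrightarrow> ?m")
    by (rule approx_limit[where B=1]) auto
  moreover have "(\<integral>\<xi>. radon (\<lambda>_. 1) \<xi> \<partial>approx n) = measure (approx n) UNIV * ?k" for n
  proof -
    have "space (approx n) = UNIV" by (simp add: approx_def)
    then show ?thesis by (simp add: radon_def)
  qed
  ultimately have "(\<lambda>n. measure (approx n) UNIV * ?k) \<longlonglongrightarrow> ?m" by simp
  then have "(\<lambda>n. measure (approx n) UNIV * ?k / ?k) \<longlonglongrightarrow> ?m / ?k" using k by (intro tendsto_divide) auto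
  then have lim: "(\<lambda>n. measure (approx n) UNIV) \<longlonglongrightarrow> ?m / ?k" using k by simp
  have "0 < (\<integral>(\<theta>::real^4). r / 2 \<partial>sphere_measure)"
    using r measure_sphere_pos[where 'a="real^4"] by simp
  also have "\<dots> \<le> ?m"
  proof (rule integral_mono_AE)
    show "AE \<theta> in sphere_measure. r / 2 \<le> sphere_radial (\<lambda>_. 1) \<theta>"
      using AE_sphere_measure
    proof eventually_elim
      fix \<theta> :: "real^4" assume "norm \<theta> = 1"
      with radial_fun_ge_r[OF this] show "r / 2 \<le> sphere_radial (\<lambda>_. 1) \<theta>" by (simp add: sphere_radial_def)
    qed
  qed (auto intro: integrable_sphere_radial)
  finally have "?m / ?k > 0" using k by simp
  then show thesis using lim by (rule that)
qed

lemma intersection_body: "intersection_body K"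
proof -
  obtain m where m: "m > 0" "(\<lambda>n. measure (approx n) UNIV) \<longlonglongrightarrow> m" by (rule mass_limit)
  \<comment> \<open>Early measures might have mass zero and could not be normalized to probability
    measures; the sequence is shifted by N to skip them.\<close>
  from order_tendstoD(1)[OF m(2,1)] obtain N where N: "\<And>n. n \<ge> N \<Longrightarrow> measure (approx n) UNIV > 0"
    by (auto simp: eventually_sequentially)
  obtain s :: "nat \<Rightarrow> nat" and \<nu> :: "(real^4) measure" where s: "strict_mono s"
    and sets: "sets \<nu> = sets borel" and fin: "finite_measure \<nu>"
    and intg: "\<And>g :: real^4 \<Rightarrow> real. continuous_on UNIV g \<Longrightarrow> integrable \<nu> g"
    and lim: "\<And>g :: real^4 \<Rightarrow> real. continuous_on UNIV g \<Longrightarrow> (\<lambda>n. \<integral>x. g x \<partial>approx (s n + N)) \<longlonglongrightarrow> (\<integral>x. g x \<partial>\<nu>)"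
  proof (rule weakly_convergent_subsequence[of "\<lambda>n. approx (n + N)" m "\<lambda>n. measure (approx (n + N)) UNIV"])
    show "AE x in approx (n + N). norm x \<le> 1" for n using AE_approx by eventually_elim simp
    show "emeasure (approx (n + N)) UNIV = ennreal (measure (approx (n + N)) UNIV)" for n
      using emeasure_approx_finite[of "n + N"] by (simp add: emeasure_eq_ennreal_measure less_top)
    show "(\<lambda>n. measure (approx (n + N)) UNIV) \<longlonglongrightarrow> m" using m(2) by (rule LIMSEQ_ignore_initial_segment)
  qed (use m N in auto)
  have [measurable_cong]: "sets \<nu> = sets borel" by (rule sets)
  have sN: "strict_mono (\<lambda>n. s n + N)" using s by (simp add: strict_mono_def)
  \<comment> \<open>The continuous nonnegative test function |norm x - 1| vanishes exactly on the
    sphere and has integral 0 for every approximating measure, hence also for the limit.\<close>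
  have AE1: "AE x in \<nu>. norm x = 1"
  proof -
    let ?h = "\<lambda>x::real^4. \<bar>norm x - 1\<bar>"
    have h: "continuous_on UNIV ?h" by (intro continuous_intros)
    have "(\<integral>x. ?h x \<partial>approx n) = 0" for n
      by (rule integral_eq_zero_AE) (use AE_approx[of n] in eventually_elim, simp)
    then have "(\<integral>x. ?h x \<partial>\<nu>) = 0" using lim[OF h] by (simp add: LIMSEQ_const_iff)
    then have "AE x in \<nu>. ?h x = 0" using integral_nonneg_eq_0_iff_AE[OF intg[OF h]] by simp
    then show ?thesis by eventually_elim simp
  qed
  have key: "(\<integral>\<xi>. radon f \<xi> \<partial>\<nu>) = (\<integral>\<theta>. sphere_radial f \<theta> \<partial>sphere_measure) \<and> integrable \<nu> (radon f)"
    if f: "continuous_on UNIV f" "\<And>x. 0 \<le> f x" "\<And>x. f x \<le> B" for f B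
  proof -
    have c: "continuous_on UNIV (radon f)" using f by (intro continuous_on_radon[where B=B]) (simp_all add: abs_of_nonneg)
    have "(\<lambda>n. \<integral>\<xi>. radon f \<xi> \<partial>approx (s n + N)) \<longlonglongrightarrow> (\<integral>\<theta>. sphere_radial f \<theta> \<partial>sphere_measure)"
      using LIMSEQ_subseq_LIMSEQ[OF approx_limit[OF f] sN] by (simp add: o_def)
    then show ?thesis using lim[OF c] intg[OF c] by (auto intro: LIMSEQ_unique)
  qed
  have eq: "(\<integral>\<theta>\<in>sphere 0 1. radial_fun K \<theta> * f \<theta> \<partial>sphere_measure) = (\<integral>\<xi>\<in>sphere 0 1. spherical_radon f \<xi> \<partial>\<nu>)"
    if f: "continuous_on UNIV f" for f :: "real^4 \<Rightarrow> real"
  proof -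
    have "compact (f ` cball 0 1)" by (intro compact_continuous_image continuous_on_subset[OF f]) auto
    then obtain B where B: "\<And>x. x \<in> f ` cball 0 1 \<Longrightarrow> \<bar>x\<bar> \<le> B"
      by (metis bounded_iff compact_imp_bounded real_norm_def)
    have "\<bar>f 0\<bar> \<le> B" by (rule B) auto
    then have B0: "0 \<le> B" by linarith
    \<comment> \<open>The limit formula is available for nonnegative bounded functions, while f may
      be unbounded away from the sphere. Its positive and negative parts are clipped at the bound B
      for |f| on the unit ball; on the sphere their difference is still f.\<close>
    define p q where "p x = min B (max 0 (f x))" and "q x = min B (max 0 (- f x))" for x
    have p: "continuous_on UNIV p" "\<And>x. 0 \<le> p x" "\<And>x. p x \<le> B"
      unfolding p_def using B0 f by (auto intro!: continuous_intros)
    have q: "continuous_on UNIV q" "\<And>x. 0 \<le> q x" "\<And>x. q x \<le> B"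
      unfolding q_def using B0 f by (auto intro!: continuous_intros)
    have pq: "f x = p x - q x" if "norm x = 1" for x
      using B[of "f x"] that by (auto simp: p_def q_def min_def max_def abs_le_iff)
    note [measurable] = borel_measurable_continuous_onI[OF f] borel_measurable_continuous_onI[OF p(1)] borel_measurable_continuous_onI[OF q(1)]
    have "sphere_radial f x = sphere_radial p x - sphere_radial q x" for x
      by (cases "norm x = 1") (simp_all add: sphere_radial_def pq right_diff_distrib)
    then have diff: "sphere_radial f = (\<lambda>x. sphere_radial p x - sphere_radial q x)" by (rule ext)
    have "(\<integral>\<theta>\<in>sphere 0 1. radial_fun K \<theta> * f \<theta> \<partial>sphere_measure) = (\<integral>\<theta>. sphere_radial p \<theta> - sphere_radial q \<theta> \<partial>sphere_measure)"
      unfolding diff[symmetric] by (simp add: set_lebesgue_integral_def sphere_radial_def[abs_def])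
    also have "\<dots> = (\<integral>\<theta>. sphere_radial p \<theta> \<partial>sphere_measure) - (\<integral>\<theta>. sphere_radial q \<theta> \<partial>sphere_measure)"
      by (intro Bochner_Integration.integral_diff integrable_sphere_radial p q)
    also have "\<dots> = (\<integral>\<xi>. radon p \<xi> \<partial>\<nu>) - (\<integral>\<xi>. radon q \<xi> \<partial>\<nu>)" using key[OF p] key[OF q] by simp
    also have "\<dots> = (\<integral>\<xi>. radon p \<xi> - radon q \<xi> \<partial>\<nu>)"
      using key[OF p] key[OF q] by (intro Bochner_Integration.integral_diff[symmetric]) auto
    also have "\<dots> = (\<integral>\<xi>. indicator (sphere 0 1) \<xi> *\<^sub>R (radon p \<xi> - radon q \<xi>) \<partial>\<nu>)"
    proof (rule integral_cong_AE)
      have [measurable]: "radon p \<in> borel_measurable \<nu>" "radon q \<in> borel_measurable \<nu>"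
        using key[OF p] key[OF q] by auto
      show "(\<lambda>\<xi>. radon p \<xi> - radon q \<xi>) \<in> borel_measurable \<nu>" by measurable
      have [measurable]: "sphere (0::real^4) 1 \<in> sets borel" by simp
      show "(\<lambda>\<xi>. indicator (sphere 0 1) \<xi> *\<^sub>R (radon p \<xi> - radon q \<xi>)) \<in> borel_measurable \<nu>" by measurable
      show "AE \<xi> in \<nu>. radon p \<xi> - radon q \<xi> = indicator (sphere 0 1) \<xi> *\<^sub>R (radon p \<xi> - radon q \<xi>)"
        using AE1 by eventually_elim simp
    qed
    \<comment> \<open>Off the sphere both sides vanish; for unit \<xi> the great sphere consists of
      unit vectors, where f = p - q.\<close>
    also have "(\<lambda>\<xi>. indicator (sphere 0 1) \<xi> *\<^sub>R (radon p \<xi> - radon q \<xi>)) = (\<lambda>\<xi>. indicator (sphere 0 1) \<xi> *\<^sub>R spherical_radon f \<xi>)"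
    proof
      fix \<xi> :: "real^4"
      show "indicator (sphere 0 1) \<xi> *\<^sub>R (radon p \<xi> - radon q \<xi>) = indicator (sphere 0 1) \<xi> *\<^sub>R spherical_radon f \<xi>"
      proof (cases "norm \<xi> = 1")
        case True
        have "radon f \<xi> = (\<integral>\<eta>. p (imq \<eta> \<odot> \<xi>) - q (imq \<eta> \<odot> \<xi>) \<partial>sphere_measure)"
          unfolding radon_def
        proof (rule integral_cong_AE)
          show "AE \<eta> in sphere_measure. f (imq \<eta> \<odot> \<xi>) = p (imq \<eta> \<odot> \<xi>) - q (imq \<eta> \<odot> \<xi>)"
            using AE_sphere_measure by eventually_elim (rule pq, simp add: norm_qmul True)
        qed measurable
        also have "\<dots> = radon p \<xi> - radon q \<xi>"
          unfolding radon_def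
          by (intro Bochner_Integration.integral_diff integrable_sphere_bounded[where B=B]) (simp_all add: abs_of_nonneg p q)
        finally show ?thesis using True by (simp add: spherical_radon_eq_radon)
      qed simp
    qed
    finally show ?thesis unfolding set_lebesgue_integral_def .
  qed
  have null: "emeasure \<nu> (- sphere 0 1) = 0"
  proof -
    have "- sphere 0 1 \<in> null_sets \<nu>"
    proof -
      have "- sphere 0 1 \<in> sets \<nu>" by (simp add: sets borel_closed)
      moreover have "AE x in \<nu>. x \<notin> - sphere 0 1" using AE1 by eventually_elim simp
      ultimately show ?thesis by (simp add: AE_iff_null_sets)
    qed
    then show ?thesis by auto
  qed
  show ?thesis
    unfolding intersection_body_def
    by (intro conjI exI[of _ \<nu>] allI impI star_body sym sets fin null eq)
qed

end

theorem theorem3: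
  fixes K :: "(real^4) set"
  assumes "convex_body K" and "origin_symmetric K"
  shows "intersection_body K"
proof -
  obtain r where r: "r > 0" "ball 0 r \<subseteq> K" using assms by (rule convex_body_ball)
  have "bounded K" using assms(1) by (simp add: convex_body_def compact_imp_bounded)
  then obtain M where M: "\<And>x. x \<in> K \<Longrightarrow> norm x \<le> M" by (auto simp: bounded_iff)
  interpret symmetric_convex_body4 K r M
    by unfold_locales (use assms r M in auto)
  show ?thesis by (rule intersection_body)
qed

end
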